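(* Let $p$ be an odd prime and let $k$ be a field of characteristic not $p$ containing a primitive $p$-th root of unity $\zeta$. The group $$\Phi_4(221)a=\langle\alpha,\alpha_1,\alpha_2,\beta_1,\beta_2:\ [\alpha_i,\alpha]=\beta_i,\ \alpha^p=\beta_2,\ \alpha_1^p=\beta_1,\ \alpha_2^p=\beta_i^p=1\ (i=1,2)\rangle$$ of order $p^5$ (where all commutators of pairs of generators not listed are trivial) is realizable as a Galois group over $k$ if and only if there exist elements $a_1,a_2,a_3\in k^\times$, independent modulo $k^{\times p}$, such that $$(\zeta^{-1}a_2,a_3;\zeta)=(a_1,\zeta a_3;\zeta)=1\in\mathrm{Br}(k).$$
   Context: $[x,y]=x^{-1}y^{-1}xy$. A finite group $G$ is realizable as a Galois group over $k$ if there is a Galois field extension $M/k$ with $\mathrm{Gal}(M/k)\cong G$. Elements of $k^\times$ are independent modulo $k^{\times p}$ if their classes are linearly independent in the $\mathbb F_p$-vector space $k^\times/k^{\times p}$. For $a,b\in k^\times$, $(a,b;\zeta)\in\mathrm{Br}(k)$ is the class of the $p$-cyclic $k$-algebra generated by $i_1,i_2$ with $i_1^p=b$, $i_2^p=a$, $i_1i_2=\zeta i_2i_1$. *)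

theory Defs
  imports
    "HOL-Algebra.Algebra"
    "HOL-Algebra.Algebraic_Closure_Type"
    "HOL-Computational_Algebra.Computational_Algebra"
begin

section \<open>Groups given by generators and relations\<close>

text \<open>A letter \<open>(g, True)\<close> stands for the generator \<open>g\<close> and \<open>(g, False)\<close> for its inverse.\<close>

type_synonym 'g word = "('g \<times> bool) list"

definition gen :: "'g \<Rightarrow> 'g word" where
  "gen g = [(g, True)]"

definition word_inv :: "'g word \<Rightarrow> 'g word" where
  "word_inv w = rev (map (\<lambda>(g, b). (g, \<not> b)) w)"

definition word_pow :: "'g word \<Rightarrow> nat \<Rightarrow> 'g word" where
  "word_pow w n = concat (replicate n w)"

definition word_comm :: "'g word \<Rightarrow> 'g word \<Rightarrow> 'g word" where
  "word_comm x y = word_inv x @ word_inv y @ x @ y"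

inductive pres_eq :: "'g word set \<Rightarrow> 'g word \<Rightarrow> 'g word \<Rightarrow> bool" for R where
  refl: "pres_eq R u u"
| sym: "pres_eq R u v \<Longrightarrow> pres_eq R v u"
| trans: "pres_eq R u v \<Longrightarrow> pres_eq R v w \<Longrightarrow> pres_eq R u w"
| append: "pres_eq R u u' \<Longrightarrow> pres_eq R v v' \<Longrightarrow> pres_eq R (u @ v) (u' @ v')"
| cancel: "pres_eq R [(g, b), (g, \<not> b)] []"
| relator: "r \<in> R \<Longrightarrow> pres_eq R r []"

definition pres_rel :: "'g word set \<Rightarrow> 'g word rel" where
  "pres_rel R = {(u, v). pres_eq R u v}"

text \<open>The group on all elements of the type \<^typ>\<open>'g\<close> as generators, with the relators in \<open>R\<close>.\<close>

definition presented_group :: "'g word set \<Rightarrow> 'g word set monoid" where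
  "presented_group R =
    \<lparr>carrier = UNIV // pres_rel R,
     monoid.mult = (\<lambda>S T. \<Union>u\<in>S. \<Union>v\<in>T. pres_rel R `` {u @ v}),
     one = pres_rel R `` {[]}\<rparr>"

lemma equiv_pres_rel: "equiv UNIV (pres_rel R)"
  by (auto simp: pres_rel_def intro!: equivI refl_onI symI transI
      intro: pres_eq.refl pres_eq.sym pres_eq.trans)

lemma presented_group_mult:
  "pres_rel R `` {u} \<otimes>\<^bsub>presented_group R\<^esub> pres_rel R `` {v} = pres_rel R `` {u @ v}"
proof -
  have "(\<lambda>u v. pres_rel R `` {u @ v}) respects2 pres_rel R"
    by (intro congruent2I' equiv_class_eq[OF equiv_pres_rel])
       (auto simp: pres_rel_def intro: pres_eq.append)
  from UN_equiv_class2[OF equiv_pres_rel equiv_pres_rel this] show ?thesis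
    by (simp add: presented_group_def)
qed

lemma pres_eq_word_inv_append: "pres_eq R (word_inv w @ w) []"
proof (induction w)
  case Nil
  show ?case by (simp add: word_inv_def pres_eq.refl)
next
  case (Cons x w)
  obtain g b where x: "x = (g, b)" by (cases x)
  have c: "pres_eq R [(g, \<not> b), (g, b)] []"
    using pres_eq.cancel[of R g "\<not> b"] by simp
  have "pres_eq R (word_inv w @ ([(g, \<not> b), (g, b)] @ w)) (word_inv w @ ([] @ w))"
    by (intro pres_eq.append c pres_eq.refl)
  then have "pres_eq R (word_inv (x # w) @ x # w) (word_inv w @ w)"
    by (simp add: word_inv_def x)
  then show ?case using Cons.IH by (rule pres_eq.trans)
qed

lemma group_presented_group: "group (presented_group R)"
proof -
  define G where "G = presented_group R"
  define cl where "cl u = pres_rel R `` {u}" for u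
  have carr: "carrier G = range cl"
    by (auto simp: G_def cl_def presented_group_def quotient_def)
  have one: "\<one>\<^bsub>G\<^esub> = cl []"
    by (simp add: G_def cl_def presented_group_def)
  have mult: "cl u \<otimes>\<^bsub>G\<^esub> cl v = cl (u @ v)" for u v
    unfolding G_def cl_def by (rule presented_group_mult)
  have inv: "cl (word_inv u) \<otimes>\<^bsub>G\<^esub> cl u = \<one>\<^bsub>G\<^esub>" for u
    unfolding mult one unfolding cl_def
    by (rule equiv_class_eq[OF equiv_pres_rel]) (simp add: pres_rel_def pres_eq_word_inv_append)
  have "group G"
  proof (rule groupI)
    show "\<exists>y\<in>carrier G. y \<otimes>\<^bsub>G\<^esub> x = \<one>\<^bsub>G\<^esub>" if "x \<in> carrier G" for x
    proof -
      from that obtain u where "x = cl u" unfolding carr by (rule rangeE)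
      then show ?thesis by (intro bexI[of _ "cl (word_inv u)"]) (simp_all add: inv carr)
    qed
  qed (auto simp: carr one mult)
  then show ?thesis by (simp add: G_def)
qed

datatype phi4_gen = \<alpha> | \<alpha>\<^sub>1 | \<alpha>\<^sub>2 | \<beta>\<^sub>1 | \<beta>\<^sub>2

definition phi4_221a_relators :: "nat \<Rightarrow> phi4_gen word set" where
  "phi4_221a_relators p =
    {word_comm (gen \<alpha>\<^sub>1) (gen \<alpha>) @ word_inv (gen \<beta>\<^sub>1),
     word_comm (gen \<alpha>\<^sub>2) (gen \<alpha>) @ word_inv (gen \<beta>\<^sub>2),
     word_pow (gen \<alpha>) p @ word_inv (gen \<beta>\<^sub>2),
     word_pow (gen \<alpha>\<^sub>1) p @ word_inv (gen \<beta>\<^sub>1),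
     word_pow (gen \<alpha>\<^sub>2) p,
     word_pow (gen \<beta>\<^sub>1) p,
     word_pow (gen \<beta>\<^sub>2) p} \<union>
    {word_comm (gen x) (gen y) | x y. {x, y} \<noteq> {\<alpha>\<^sub>1, \<alpha>} \<and> {x, y} \<noteq> {\<alpha>\<^sub>2, \<alpha>}}"

definition phi4_221a :: "nat \<Rightarrow> phi4_gen word set monoid" where
  "phi4_221a p = presented_group (phi4_221a_relators p)"


section \<open>Galois extensions\<close>

text \<open>
  Every algebraic extension of the field \<^typ>\<open>'k\<close> is isomorphic over \<^typ>\<open>'k\<close> to a subfield of
  the algebraic closure \<^typ>\<open>'k alg_closure\<close> that contains the image of \<^const>\<open>to_ac\<close>.  So
  the extensions of \<^typ>\<open>'k\<close> are taken to be such subfields, and algebraicity is automatic.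
\<close>

definition subfield_ring :: "'k::field alg_closure set \<Rightarrow> 'k alg_closure ring" where
  "subfield_ring M = ring_of_type_algebra \<lparr>carrier := M\<rparr>"

definition extension_field :: "'k::field alg_closure set \<Rightarrow> bool" where
  "extension_field M \<longleftrightarrow>
     subfield M (ring_of_type_algebra :: 'k alg_closure ring) \<and> range to_ac \<subseteq> M"

definition galois_group ::
    "'k::field alg_closure set \<Rightarrow> ('k alg_closure \<Rightarrow> 'k alg_closure) monoid" where
  "galois_group M = BijGroup M
     \<lparr>carrier := {\<sigma> \<in> Bij M. \<sigma> \<in> ring_hom (subfield_ring M) (subfield_ring M) \<and>
                           (\<forall>c. \<sigma> (to_ac c) = to_ac c)}\<rparr>"

definition galois_extension :: "'k::field alg_closure set \<Rightarrow> bool" where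
  "galois_extension M \<longleftrightarrow> extension_field M \<and>
     {x \<in> M. \<forall>\<sigma>\<in>carrier (galois_group M). \<sigma> x = x} = range to_ac"

definition galois_realizable :: "'k::field itself \<Rightarrow> ('g, 'm) monoid_scheme \<Rightarrow> bool" where
  "galois_realizable _ G \<longleftrightarrow>
     (\<exists>M :: 'k alg_closure set. galois_extension M \<and> galois_group M \<cong> G)"


section \<open>Elements of the base field\<close>

definition primitive_root_of_unity :: "nat \<Rightarrow> 'k::field \<Rightarrow> bool" where
  "primitive_root_of_unity n \<zeta> \<longleftrightarrow> n > 0 \<and> \<zeta> ^ n = 1 \<and> (\<forall>m. 0 < m \<and> m < n \<longrightarrow> \<zeta> ^ m \<noteq> 1)"

text \<open>
  Linear independence over the field with \<open>p\<close> elements of the classes of a family in the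
  multiplicative group modulo \<open>p\<close>-th powers, written multiplicatively: integers \<open>e i\<close> represent the
  coefficients, and a linear combination vanishes iff the corresponding product is a \<open>p\<close>-th power.
\<close>

definition independent_mod_powers :: "nat \<Rightarrow> 'k::field list \<Rightarrow> bool" where
  "independent_mod_powers p as \<longleftrightarrow> (\<forall>a\<in>set as. a \<noteq> 0) \<and>
     (\<forall>e :: nat \<Rightarrow> int. (\<exists>c. c \<noteq> 0 \<and> (\<Prod>i<length as. as ! i powi e i) = c ^ p) \<longrightarrow>
        (\<forall>i<length as. int p dvd e i))"


section \<open>Algebras over a field and Brauer equivalence\<close>

text \<open>
  An algebra over the field \<^typ>\<open>'k\<close> is a record of type \<^typ>\<open>('k, 'b) module\<close>.  (The locale
  \<open>algebra\<close> of the library is not used, since it is restricted to commutative algebras.)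
\<close>

definition algebra_isomorphic :: "('k, 'b) module \<Rightarrow> ('k, 'c) module \<Rightarrow> bool" where
  "algebra_isomorphic A B \<longleftrightarrow>
     (\<exists>h \<in> ring_iso A B. \<forall>c. \<forall>x \<in> carrier A. h (c \<odot>\<^bsub>A\<^esub> x) = c \<odot>\<^bsub>B\<^esub> h x)"

definition matrix_algebra ::
    "nat \<Rightarrow> ('k, 'b) module \<Rightarrow> ('k, nat \<times> nat \<Rightarrow> 'b) module" where
  "matrix_algebra n A =
    \<lparr>carrier = {..<n} \<times> {..<n} \<rightarrow>\<^sub>E carrier A,
     monoid.mult = (\<lambda>S T. \<lambda>(i, j)\<in>{..<n} \<times> {..<n}. \<Oplus>\<^bsub>A\<^esub>l\<in>{..<n}. S (i, l) \<otimes>\<^bsub>A\<^esub> T (l, j)),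
     one = (\<lambda>(i, j)\<in>{..<n} \<times> {..<n}. if i = j then \<one>\<^bsub>A\<^esub> else \<zero>\<^bsub>A\<^esub>),
     ring.zero = (\<lambda>(i, j)\<in>{..<n} \<times> {..<n}. \<zero>\<^bsub>A\<^esub>),
     add = (\<lambda>S T. \<lambda>(i, j)\<in>{..<n} \<times> {..<n}. S (i, j) \<oplus>\<^bsub>A\<^esub> T (i, j)),
     module.smult = (\<lambda>c S. \<lambda>(i, j)\<in>{..<n} \<times> {..<n}. c \<odot>\<^bsub>A\<^esub> S (i, j))\<rparr>"

definition base_algebra :: "('k::field, 'k) module" where
  "base_algebra =
    \<lparr>carrier = UNIV, monoid.mult = (*), one = 1, ring.zero = 0, add = (+), module.smult = (*)\<rparr>"

text \<open>
  Two central simple algebras have the same class in the Brauer group iff they are equivalent in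
  the following sense; the identity of the Brauer group is the class of the base field.
\<close>

definition brauer_equivalent :: "('k, 'b) module \<Rightarrow> ('k, 'c) module \<Rightarrow> bool" where
  "brauer_equivalent A B \<longleftrightarrow>
     (\<exists>m>0. \<exists>n>0. algebra_isomorphic (matrix_algebra m A) (matrix_algebra n B))"

definition brauer_trivial :: "('k::field, 'b) module \<Rightarrow> bool" where
  "brauer_trivial A \<longleftrightarrow> brauer_equivalent A base_algebra"


section \<open>Cyclic algebras\<close>

text \<open>
  The \<open>p\<close>-cyclic algebra generated by \<open>i\<^sub>1\<close>, \<open>i\<^sub>2\<close> with \<open>i\<^sub>1\<^sup>p = b\<close>, \<open>i\<^sub>2\<^sup>p = a\<close>,
  \<open>i\<^sub>1 i\<^sub>2 = \<zeta> i\<^sub>2 i\<^sub>1\<close>, of dimension \<open>p\<^sup>2\<close>.  An element \<open>f\<close> is given by its coordinates \<open>f (s, r)\<close>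
  with respect to the basis of the \<open>i\<^sub>2\<^sup>s i\<^sub>1\<^sup>r\<close> with \<open>s, r < p\<close>, and basis elements multiply by
  \<open>(i\<^sub>2\<^sup>s i\<^sub>1\<^sup>r) (i\<^sub>2\<^sup>t i\<^sub>1\<^sup>q) = \<zeta>\<^sup>r\<^sup>t i\<^sub>2\<^sup>s\<^sup>+\<^sup>t i\<^sub>1\<^sup>r\<^sup>+\<^sup>q\<close>, where powers of \<open>i\<^sub>2\<close> and \<open>i\<^sub>1\<close> with exponent
  at least \<open>p\<close> are reduced by means of \<open>i\<^sub>2\<^sup>p = a\<close> and \<open>i\<^sub>1\<^sup>p = b\<close>.
\<close>

definition cyclic_index :: "nat \<Rightarrow> nat \<times> nat \<Rightarrow> nat \<times> nat \<Rightarrow> nat \<times> nat" where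
  "cyclic_index p = (\<lambda>(s, r) (t, q). ((s + t) mod p, (r + q) mod p))"

definition cyclic_coeff ::
    "nat \<Rightarrow> 'k::field \<Rightarrow> 'k \<Rightarrow> 'k \<Rightarrow> nat \<times> nat \<Rightarrow> nat \<times> nat \<Rightarrow> 'k" where
  "cyclic_coeff p a b \<zeta> =
     (\<lambda>(s, r) (t, q). \<zeta> ^ (r * t) * a ^ ((s + t) div p) * b ^ ((r + q) div p))"

definition cyclic_algebra ::
    "nat \<Rightarrow> 'k::field \<Rightarrow> 'k \<Rightarrow> 'k \<Rightarrow> ('k, nat \<times> nat \<Rightarrow> 'k) module" where
  "cyclic_algebra p a b \<zeta> =
    \<lparr>carrier = {f. \<forall>u. u \<notin> {..<p} \<times> {..<p} \<longrightarrow> f u = 0},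
     monoid.mult = (\<lambda>f g w. \<Sum>u\<in>{..<p} \<times> {..<p}. \<Sum>v\<in>{..<p} \<times> {..<p}.
        if cyclic_index p u v = w then cyclic_coeff p a b \<zeta> u v * f u * g v else 0),
     one = (\<lambda>u. if u = (0, 0) then 1 else 0),
     ring.zero = (\<lambda>u. 0),
     add = (\<lambda>f g u. f u + g u),
     module.smult = (\<lambda>c f u. c * f u)\<rparr>"

definition cyclic_i1 :: "nat \<times> nat \<Rightarrow> 'k::field" where
  "cyclic_i1 = (\<lambda>u. if u = (0, 1) then 1 else 0)"

definition cyclic_i2 :: "nat \<times> nat \<Rightarrow> 'k::field" where
  "cyclic_i2 = (\<lambda>u. if u = (1, 0) then 1 else 0)"

lemma cyclic_algebra_relations:
  fixes a b \<zeta> :: "'k::field"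
  assumes "p > 1"
  defines "A \<equiv> cyclic_algebra p a b \<zeta>"
  shows "cyclic_i1 \<in> carrier A" "cyclic_i2 \<in> carrier A"
    and "cyclic_i1 \<otimes>\<^bsub>A\<^esub> cyclic_i2 = \<zeta> \<odot>\<^bsub>A\<^esub> (cyclic_i2 \<otimes>\<^bsub>A\<^esub> cyclic_i1)"
    and "cyclic_i1 [^]\<^bsub>A\<^esub> p = b \<odot>\<^bsub>A\<^esub> \<one>\<^bsub>A\<^esub>"
    and "cyclic_i2 [^]\<^bsub>A\<^esub> p = a \<odot>\<^bsub>A\<^esub> \<one>\<^bsub>A\<^esub>"
    and "f \<in> carrier A \<Longrightarrow> f = (\<lambda>w. \<Sum>(s, r)\<in>{..<p} \<times> {..<p}.
           (f (s, r) \<odot>\<^bsub>A\<^esub> (cyclic_i2 [^]\<^bsub>A\<^esub> s \<otimes>\<^bsub>A\<^esub> cyclic_i1 [^]\<^bsub>A\<^esub> r)) w)"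
proof -
  define \<delta> :: "nat \<times> nat \<Rightarrow> nat \<times> nat \<Rightarrow> 'k" where "\<delta> u = (\<lambda>w. if w = u then 1 else 0)" for u
  have mult: "\<delta> u \<otimes>\<^bsub>A\<^esub> \<delta> v = cyclic_coeff p a b \<zeta> u v \<odot>\<^bsub>A\<^esub> \<delta> (cyclic_index p u v)"
    if "u \<in> {..<p} \<times> {..<p}" "v \<in> {..<p} \<times> {..<p}" for u v
  proof
    fix w
    have "(\<delta> u \<otimes>\<^bsub>A\<^esub> \<delta> v) w = (\<Sum>u'\<in>{..<p} \<times> {..<p}. \<Sum>v'\<in>{..<p} \<times> {..<p}.
        if v' = v then if u' = u then
          (if cyclic_index p u v = w then cyclic_coeff p a b \<zeta> u v else 0) else 0 else 0)"
      unfolding A_def cyclic_algebra_def \<delta>_def monoid.simps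
      by (intro sum.cong HOL.refl) (auto split: if_splits)
    also have "\<dots> = (if cyclic_index p u v = w then cyclic_coeff p a b \<zeta> u v else 0)"
      using that by (simp add: sum.delta)
    finally show "(\<delta> u \<otimes>\<^bsub>A\<^esub> \<delta> v) w = (cyclic_coeff p a b \<zeta> u v \<odot>\<^bsub>A\<^esub> \<delta> (cyclic_index p u v)) w"
      by (auto simp: A_def cyclic_algebra_def \<delta>_def)
  qed
  have smult: "(c \<odot>\<^bsub>A\<^esub> f) w = c * f w" for c f w
    by (simp add: A_def cyclic_algebra_def)
  have smult1: "1 \<odot>\<^bsub>A\<^esub> f = f" for f by (simp add: fun_eq_iff smult)
  have one: "\<one>\<^bsub>A\<^esub> = \<delta> (0, 0)"
    by (auto simp: A_def cyclic_algebra_def \<delta>_def)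
  have i1: "cyclic_i1 = \<delta> (0, 1)" by (auto simp: cyclic_i1_def \<delta>_def)
  have i2: "cyclic_i2 = \<delta> (1, 0)" by (auto simp: cyclic_i2_def \<delta>_def)
  note [simp] = cyclic_coeff_def cyclic_index_def smult1
  show "cyclic_i1 \<in> carrier A" "cyclic_i2 \<in> carrier A"
    using assms(1) by (auto simp: A_def cyclic_algebra_def cyclic_i1_def cyclic_i2_def)
  show "cyclic_i1 \<otimes>\<^bsub>A\<^esub> cyclic_i2 = \<zeta> \<odot>\<^bsub>A\<^esub> (cyclic_i2 \<otimes>\<^bsub>A\<^esub> cyclic_i1)"
    using assms(1) by (simp add: i1 i2 mult)
  have pow1: "cyclic_i1 [^]\<^bsub>A\<^esub> r = \<delta> (0, r)" if "r < p" for r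
    using that
    by (induction r) (use assms(1) in \<open>simp_all add: i1 one mult nat_pow_def\<close>)
  have pow2: "cyclic_i2 [^]\<^bsub>A\<^esub> r = \<delta> (r, 0)" if "r < p" for r
    using that
    by (induction r) (use assms(1) in \<open>simp_all add: i2 one mult nat_pow_def\<close>)
  obtain q where q: "p = Suc q" using assms(1) by (cases p) auto
  have "cyclic_i1 [^]\<^bsub>A\<^esub> p = cyclic_i1 [^]\<^bsub>A\<^esub> q \<otimes>\<^bsub>A\<^esub> cyclic_i1" by (simp add: q nat_pow_def)
  also have "\<dots> = b \<odot>\<^bsub>A\<^esub> \<one>\<^bsub>A\<^esub>"
    using mult[of "(0, q)" "(0, 1)"] pow1[of q] assms(1) by (simp add: i1 one q)
  finally show "cyclic_i1 [^]\<^bsub>A\<^esub> p = b \<odot>\<^bsub>A\<^esub> \<one>\<^bsub>A\<^esub>" .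
  have "cyclic_i2 [^]\<^bsub>A\<^esub> p = cyclic_i2 [^]\<^bsub>A\<^esub> q \<otimes>\<^bsub>A\<^esub> cyclic_i2" by (simp add: q nat_pow_def)
  also have "\<dots> = a \<odot>\<^bsub>A\<^esub> \<one>\<^bsub>A\<^esub>"
    using mult[of "(q, 0)" "(1, 0)"] pow2[of q] assms(1) by (simp add: i2 one q)
  finally show "cyclic_i2 [^]\<^bsub>A\<^esub> p = a \<odot>\<^bsub>A\<^esub> \<one>\<^bsub>A\<^esub>" .
  show "f = (\<lambda>w. \<Sum>(s, r)\<in>{..<p} \<times> {..<p}.
           (f (s, r) \<odot>\<^bsub>A\<^esub> (cyclic_i2 [^]\<^bsub>A\<^esub> s \<otimes>\<^bsub>A\<^esub> cyclic_i1 [^]\<^bsub>A\<^esub> r)) w)" if "f \<in> carrier A"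
  proof
    fix w
    have "(\<Sum>(s, r)\<in>{..<p} \<times> {..<p}.
           (f (s, r) \<odot>\<^bsub>A\<^esub> (cyclic_i2 [^]\<^bsub>A\<^esub> s \<otimes>\<^bsub>A\<^esub> cyclic_i1 [^]\<^bsub>A\<^esub> r)) w) =
          (\<Sum>u\<in>{..<p} \<times> {..<p}. if u = w then f u else 0)"
    proof (intro sum.cong HOL.refl)
      fix u :: "nat \<times> nat" assume "u \<in> {..<p} \<times> {..<p}"
      then obtain s r where u: "u = (s, r)" "s < p" "r < p" by auto
      then have "cyclic_i2 [^]\<^bsub>A\<^esub> s \<otimes>\<^bsub>A\<^esub> cyclic_i1 [^]\<^bsub>A\<^esub> r = \<delta> (s, r)"
        using assms(1) by (simp add: pow1 pow2 mult)
      then show "(case u of (s, r) \<Rightarrow>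
            (f (s, r) \<odot>\<^bsub>A\<^esub> (cyclic_i2 [^]\<^bsub>A\<^esub> s \<otimes>\<^bsub>A\<^esub> cyclic_i1 [^]\<^bsub>A\<^esub> r)) w) =
          (if u = w then f u else 0)"
        by (auto simp: u smult \<delta>_def)
    qed
    also have "\<dots> = f w"
      using that unfolding A_def cyclic_algebra_def by (cases w) auto
    finally show "f w = (\<Sum>(s, r)\<in>{..<p} \<times> {..<p}.
           (f (s, r) \<odot>\<^bsub>A\<^esub> (cyclic_i2 [^]\<^bsub>A\<^esub> s \<otimes>\<^bsub>A\<^esub> cyclic_i1 [^]\<^bsub>A\<^esub> r)) w)" ..
  qed
qed

lemma cyclic_algebra_ring:
  fixes a b \<zeta> :: "'k::field"
  assumes p: "p > 1" and \<zeta>: "\<zeta> ^ p = 1"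
  shows "ring (cyclic_algebra p a b \<zeta>)"
proof -
  define B where "B = {..<p} \<times> {..<p}"
  define A where "A = cyclic_algebra p a b \<zeta>"
  define I where "I = cyclic_index p"
  define C where "C = cyclic_coeff p a b \<zeta>"
  have finB: "finite B" by (simp add: B_def)
  have mult: "(f \<otimes>\<^bsub>A\<^esub> g) w = (\<Sum>u\<in>B. \<Sum>v\<in>B. if I u v = w then C u v * f u * g v else 0)"
    for f g w
    unfolding A_def cyclic_algebra_def B_def I_def C_def by simp
  have I_B: "I u v \<in> B" for u v
    using p by (auto simp: I_def B_def cyclic_index_def split: prod.splits)
  have I_assoc: "I (I u v) w = I u (I v w)" for u v w
    by (auto simp: I_def cyclic_index_def mod_simps add.assoc split: prod.splits)
  have zpow: "\<zeta> ^ (m mod p) = \<zeta> ^ m" for m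
  proof -
    have "\<zeta> ^ m = \<zeta> ^ (p * (m div p) + m mod p)" by simp
    also have "\<dots> = \<zeta> ^ (m mod p)" by (simp only: power_add power_mult \<zeta>) simp
    finally show ?thesis by simp
  qed
  have zpow1: "\<zeta> ^ ((m mod p) * n) = \<zeta> ^ (m * n)" for m n
    by (subst (1 2) zpow [symmetric]) (simp only: mod_mult_left_eq)
  have zpow2: "\<zeta> ^ (n * (m mod p)) = \<zeta> ^ (n * m)" for m n
    by (subst (1 2) zpow [symmetric]) (simp only: mod_mult_right_eq)
  have divs: "(x + y) div p + ((x + y) mod p + z) div p = (x + y + z) div p" for x y z :: nat
  proof -
    have "x + y + z = ((x + y) mod p + z) + (x + y) div p * p"
      using div_mult_mod_eq[of "x + y" p] by linarith
    then have "(x + y + z) div p = (((x + y) mod p + z) + (x + y) div p * p) div p"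
      by (rule arg_cong)
    also have "\<dots> = (x + y) div p + ((x + y) mod p + z) div p"
      using p by (subst div_mult_self1) auto
    finally show ?thesis ..
  qed
  have divs': "(y + z) div p + (x + (y + z) mod p) div p = (x + y + z) div p" for x y z :: nat
    using divs[of y z x] by (simp only: ac_simps)
  have C_assoc: "C u v * C (I u v) w = C v w * C u (I v w)" for u v w
  proof -
    obtain s1 r1 s2 r2 s3 r3 where uvw: "u = (s1, r1)" "v = (s2, r2)" "w = (s3, r3)"
      by (metis surj_pair)
    have "C u v * C (I u v) w =
        \<zeta> ^ (r1 * s2) * \<zeta> ^ ((r1 + r2) * s3) *
        (a ^ ((s1 + s2) div p + ((s1 + s2) mod p + s3) div p)) *
        (b ^ ((r1 + r2) div p + ((r1 + r2) mod p + r3) div p))"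
      by (simp add: uvw C_def I_def cyclic_coeff_def cyclic_index_def zpow1 power_add)
    also have "\<dots> = \<zeta> ^ (r1 * s2 + (r1 + r2) * s3) *
        a ^ ((s1 + s2 + s3) div p) * b ^ ((r1 + r2 + r3) div p)"
      by (simp only: divs power_add)
    also have "r1 * s2 + (r1 + r2) * s3 = r2 * s3 + r1 * (s2 + s3)"
      by (simp add: algebra_simps)
    also have "\<zeta> ^ (r2 * s3 + r1 * (s2 + s3)) *
        a ^ ((s1 + s2 + s3) div p) * b ^ ((r1 + r2 + r3) div p) =
        \<zeta> ^ (r2 * s3) * \<zeta> ^ (r1 * (s2 + s3)) *
        (a ^ ((s2 + s3) div p + (s1 + (s2 + s3) mod p) div p)) *
        (b ^ ((r2 + r3) div p + (r1 + (r2 + r3) mod p) div p))"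
      by (simp only: divs' power_add)
    also have "\<dots> = C v w * C u (I v w)"
      by (simp add: uvw C_def I_def cyclic_coeff_def cyclic_index_def zpow2 power_add)
    finally show ?thesis .
  qed
  have I_one: "I (0, 0) u = u" "I u (0, 0) = u" and C_one: "C (0, 0) u = 1" "C u (0, 0) = 1"
    if "u \<in> B" for u
    using that by (auto simp: I_def C_def cyclic_index_def cyclic_coeff_def B_def)
  have zero_B: "(0, 0) \<in> B" using p by (simp add: B_def)
  have carr: "f \<in> carrier A \<longleftrightarrow> (\<forall>u. u \<notin> B \<longrightarrow> f u = 0)" for f
    by (simp add: A_def cyclic_algebra_def B_def)
  have one: "\<one>\<^bsub>A\<^esub> u = (if u = (0, 0) then 1 else 0)" for u
    by (simp add: A_def cyclic_algebra_def)
  have add: "(f \<oplus>\<^bsub>A\<^esub> g) u = f u + g u" for f g u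
    by (simp add: A_def cyclic_algebra_def)
  have zero: "\<zero>\<^bsub>A\<^esub> u = 0" for u
    by (simp add: A_def cyclic_algebra_def)
  have "ring A"
  proof (rule ringI)
    show "abelian_group A"
    proof (rule abelian_groupI)
      show "\<exists>g\<in>carrier A. g \<oplus>\<^bsub>A\<^esub> f = \<zero>\<^bsub>A\<^esub>" if "f \<in> carrier A" for f
        using that by (intro bexI[of _ "\<lambda>u. - f u"]) (auto simp: carr add zero fun_eq_iff)
    qed (auto simp: carr add zero fun_eq_iff)
    show "monoid A"
    proof (rule monoidI)
      show "f \<otimes>\<^bsub>A\<^esub> g \<in> carrier A" for f g
        unfolding carr mult by (intro allI impI sum.neutral ballI if_not_P) (metis I_B)
      show "\<one>\<^bsub>A\<^esub> \<in> carrier A" using zero_B by (auto simp: carr one)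
      show "f \<otimes>\<^bsub>A\<^esub> g \<otimes>\<^bsub>A\<^esub> h = f \<otimes>\<^bsub>A\<^esub> (g \<otimes>\<^bsub>A\<^esub> h)" for f g h
      proof
        fix x
        have "(f \<otimes>\<^bsub>A\<^esub> g \<otimes>\<^bsub>A\<^esub> h) x = (\<Sum>y\<in>B. \<Sum>w\<in>B. if I y w = x then
            C y w * (\<Sum>u\<in>B. \<Sum>v\<in>B. if I u v = y then C u v * f u * g v else 0) * h w else 0)"
          by (simp only: mult)
        also have "\<dots> = (\<Sum>y\<in>B. \<Sum>w\<in>B. \<Sum>u\<in>B. \<Sum>v\<in>B. if I u v = y then
            (if I (I u v) w = x then C u v * C (I u v) w * f u * g v * h w else 0) else 0)"
        proof (intro sum.cong HOL.refl)
          fix y w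
          show "(if I y w = x then
              C y w * (\<Sum>u\<in>B. \<Sum>v\<in>B. if I u v = y then C u v * f u * g v else 0) * h w else 0) =
            (\<Sum>u\<in>B. \<Sum>v\<in>B. if I u v = y then
              (if I (I u v) w = x then C u v * C (I u v) w * f u * g v * h w else 0) else 0)"
          proof (cases "I y w = x")
            case True
            show ?thesis
              unfolding if_P[OF True] sum_distrib_left sum_distrib_right
              by (intro sum.cong HOL.refl) (use True in \<open>auto simp: mult_ac\<close>)
          next
            case False
            show ?thesis
              unfolding if_not_P[OF False]
              by (rule HOL.sym, intro sum.neutral ballI) (use False in auto)
          qed
        qed
        also have "\<dots> = (\<Sum>w\<in>B. \<Sum>u\<in>B. \<Sum>v\<in>B. \<Sum>y\<in>B. if I u v = y then
            (if I (I u v) w = x then C u v * C (I u v) w * f u * g v * h w else 0) else 0)"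
          by (rule HOL.trans[OF sum.swap], rule sum.cong[OF HOL.refl], rule HOL.trans[OF sum.swap], rule sum.cong[OF HOL.refl], rule sum.swap)
        also have "\<dots> = (\<Sum>w\<in>B. \<Sum>u\<in>B. \<Sum>v\<in>B.
            if I u (I v w) = x then C v w * C u (I v w) * f u * g v * h w else 0)"
          using I_B by (intro sum.cong HOL.refl) (simp add: finB sum.delta' I_assoc C_assoc)
        also have "\<dots> = (\<Sum>u\<in>B. \<Sum>v\<in>B. \<Sum>w\<in>B.
            if I u (I v w) = x then C v w * C u (I v w) * f u * g v * h w else 0)"
          by (rule HOL.trans[OF sum.swap], rule sum.cong[OF HOL.refl], rule sum.swap)
        also have "\<dots> = (\<Sum>u\<in>B. \<Sum>v\<in>B. \<Sum>w\<in>B. \<Sum>y\<in>B. if I v w = y then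
            (if I u (I v w) = x then C v w * C u (I v w) * f u * g v * h w else 0) else 0)"
          using I_B by (intro sum.cong HOL.refl) (simp add: finB sum.delta')
        also have "\<dots> = (\<Sum>u\<in>B. \<Sum>y\<in>B. \<Sum>v\<in>B. \<Sum>w\<in>B. if I v w = y then
            (if I u (I v w) = x then C v w * C u (I v w) * f u * g v * h w else 0) else 0)"
          by (rule sum.cong[OF HOL.refl], rule HOL.trans[OF _ sum.swap], rule sum.cong[OF HOL.refl], rule sum.swap)
        also have "\<dots> = (\<Sum>u\<in>B. \<Sum>y\<in>B. if I u y = x then
            C u y * f u * (\<Sum>v\<in>B. \<Sum>w\<in>B. if I v w = y then C v w * g v * h w else 0) else 0)"
        proof (intro sum.cong HOL.refl)
          fix u y
          show "(\<Sum>v\<in>B. \<Sum>w\<in>B. if I v w = y then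
              (if I u (I v w) = x then C v w * C u (I v w) * f u * g v * h w else 0) else 0) =
            (if I u y = x then
              C u y * f u * (\<Sum>v\<in>B. \<Sum>w\<in>B. if I v w = y then C v w * g v * h w else 0) else 0)"
          proof (cases "I u y = x")
            case True
            show ?thesis
              unfolding if_P[OF True] sum_distrib_left sum_distrib_right
              by (intro sum.cong HOL.refl) (use True in \<open>auto simp: mult_ac\<close>)
          next
            case False
            show ?thesis
              unfolding if_not_P[OF False]
              by (intro sum.neutral ballI) (use False in auto)
          qed
        qed
        also have "\<dots> = (f \<otimes>\<^bsub>A\<^esub> (g \<otimes>\<^bsub>A\<^esub> h)) x"
          by (simp only: mult)
        finally show "(f \<otimes>\<^bsub>A\<^esub> g \<otimes>\<^bsub>A\<^esub> h) x = (f \<otimes>\<^bsub>A\<^esub> (g \<otimes>\<^bsub>A\<^esub> h)) x" .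
      qed
      show "\<one>\<^bsub>A\<^esub> \<otimes>\<^bsub>A\<^esub> f = f" if f: "f \<in> carrier A" for f
      proof
        fix x
        have "(\<one>\<^bsub>A\<^esub> \<otimes>\<^bsub>A\<^esub> f) x = (\<Sum>v\<in>B. \<Sum>u\<in>B. if u = (0, 0) then
            (if v = x then f v else 0) else 0)"
          unfolding mult one by (subst sum.swap) (auto intro!: sum.cong simp: I_one C_one)
        also have "\<dots> = f x" using f zero_B by (cases x) (auto simp: finB carr)
        finally show "(\<one>\<^bsub>A\<^esub> \<otimes>\<^bsub>A\<^esub> f) x = f x" .
      qed
      show "f \<otimes>\<^bsub>A\<^esub> \<one>\<^bsub>A\<^esub> = f" if f: "f \<in> carrier A" for f
      proof
        fix x
        have "(f \<otimes>\<^bsub>A\<^esub> \<one>\<^bsub>A\<^esub>) x = (\<Sum>u\<in>B. \<Sum>v\<in>B. if v = (0, 0) then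
            (if u = x then f u else 0) else 0)"
          unfolding mult one by (auto intro!: sum.cong simp: I_one C_one)
        also have "\<dots> = f x" using f zero_B by (cases x) (auto simp: finB carr)
        finally show "(f \<otimes>\<^bsub>A\<^esub> \<one>\<^bsub>A\<^esub>) x = f x" .
      qed
    qed
    show "(f \<oplus>\<^bsub>A\<^esub> g) \<otimes>\<^bsub>A\<^esub> h = f \<otimes>\<^bsub>A\<^esub> h \<oplus>\<^bsub>A\<^esub> g \<otimes>\<^bsub>A\<^esub> h" for f g h
      by (auto simp: fun_eq_iff mult add algebra_simps simp flip: sum.distrib intro!: sum.cong)
    show "h \<otimes>\<^bsub>A\<^esub> (f \<oplus>\<^bsub>A\<^esub> g) = h \<otimes>\<^bsub>A\<^esub> f \<oplus>\<^bsub>A\<^esub> h \<otimes>\<^bsub>A\<^esub> g" for f g h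
      by (auto simp: fun_eq_iff mult add algebra_simps simp flip: sum.distrib intro!: sum.cong)
  qed
  then show ?thesis by (simp add: A_def)
qed

end

theory Submission
  imports Defs "HOL-Number_Theory.Cong"
begin

text \<open>
  Suppose \<open>G\<close> acts on \<open>M\<close> as a Galois group. Eigenvectors \<open>t\<close>, \<open>u\<close>, \<open>s\<close> for the characters of \<open>G\<close> dual to
  \<open>\<alpha>\<close>, \<open>\<alpha>\<^sub>2\<close>, \<open>\<alpha>\<^sub>1\<close> are \<open>p\<close>-th roots of elements \<open>a\<^sub>3\<close>, \<open>a\<^sub>2\<close>, \<open>a\<^sub>1\<close> of \<open>k\<close>. The subgroup
  \<open>A = \<langle>\<alpha>\<^sup>p, \<alpha>\<^sub>1, \<alpha>\<^sub>2\<rangle>\<close>, with fixed field \<open>k(t)\<close>, has a character that kills \<open>\<alpha>\<^sub>1\<close> and \<open>\<alpha>\<^sub>2\<close> and maps \<open>\<alpha>\<^sup>p\<close> to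
  \<open>\<zeta>\<close>. For an eigenvector \<open>w\<close> of it, \<open>c = \<alpha>(w) / (u w)\<close> is fixed by \<open>A\<close>, and applying \<open>\<alpha>\<close> to \<open>w\<close> \<open>p\<close> times gives
  \<open>N(c) a\<^sub>2 = \<zeta>\<close>. So \<open>\<zeta>\<^sup>-\<^sup>1 a\<^sub>2\<close> is a norm from \<open>k(t)\<close>. Likewise \<open>\<langle>\<alpha>, \<alpha>\<^sub>1\<^sup>p, \<alpha>\<^sub>2\<rangle>\<close>
  and \<open>d = t \<alpha>\<^sub>1(v) / v\<close> show that \<open>\<zeta> a\<^sub>3\<close> is a norm from \<open>k(s)\<close>. By a rank one argument, a cyclic algebra
  splits exactly when one slot is a norm from the radical extension given by the other.

  Conversely, given elements of norm \<open>\<zeta>\<^sup>-\<^sup>1 a\<^sub>2\<close> and \<open>\<zeta> a\<^sub>3\<close>, Hilbert 90 provides \<open>w\<close> in \<open>k(t)\<close> and \<open>v\<close> in \<open>k(s)\<close>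
  with the same transformation laws for \<open>p\<close>-th roots \<open>W\<close> and \<open>V\<close> of them. Neither radical lies in the field below it,
  so \<open>k(t, u, s, W, V)\<close> has degree \<open>p\<^sup>5\<close>, and the automorphisms with the prescribed images of the five radicals
  satisfy the relations of \<open>G\<close>.
\<close>

section \<open>A normal form model of the group\<close>

text \<open>The twists by \<zeta> in the two symbols have one source. The character of A that
  defines w is not invariant under conjugation by \<alpha>: it changes by the character dual to
  \<open>\<alpha>\<^sub>2\<close>, so \<alpha>(w) / w is an eigenvector for that character and
  division by u makes it fixed. Conjugation by \<open>\<alpha>\<^sub>1\<close> changes the character
  of v by the inverse of the one dual to \<alpha>, so there t multiplies. The p-th powers of
  \<alpha> and \<open>\<alpha>\<^sub>1\<close> act on w and v by \<zeta>, and this value enters the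
  two norm equations. In the converse the same value makes the norm of (c u)^p equal to 1, as
  Hilbert 90 demands, and it also keeps W and V out of the fields below them.

  Field degrees are never counted. All fields are subsets of one algebraic closure, and
  automorphisms are compared through the images of the radicals. Brauer triviality offers only an
  isomorphism between matrix algebras of possibly different sizes; a single element r of the algebra
  with r A r = k r replaces the structure theory of simple algebras.\<close>

lemma one_plus_pow_cong:
  fixes p n :: nat shows "[(1 + p) ^ n = 1 + p * n] (mod p\<^sup>2)"
proof (induction n)
  case (Suc n)
  have "[(1 + p) * (1 + p) ^ n = (1 + p) * (1 + p * n)] (mod p\<^sup>2)"
    by (rule cong_mult[OF cong_refl Suc])
  also have "(1 + p) * (1 + p * n) = 1 + p * Suc n + p\<^sup>2 * n"
    by (simp add: algebra_simps power2_eq_square)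
  also have "[1 + p * Suc n + p\<^sup>2 * n = 1 + p * Suc n] (mod p\<^sup>2)"
    by (metis cong_add_lcancel_0_nat cong_mult_self_left)
  finally show ?case by simp
qed simp

text \<open>
  The triple \<open>(i, j, k)\<close> stands for \<open>\<alpha>\<^sup>i \<alpha>\<^sub>1\<^sup>j \<alpha>\<^sub>2\<^sup>k\<close>; here \<open>\<beta>\<^sub>1 = \<alpha>\<^sub>1\<^sup>p\<close> and \<open>\<beta>\<^sub>2 = \<alpha>\<^sup>p\<close>
  are absorbed into exponents modulo \<open>p\<^sup>2\<close>.
\<close>

definition triple_group :: "nat \<Rightarrow> (nat \<times> nat \<times> nat) monoid" where
  "triple_group p =
    \<lparr>carrier = {..<p\<^sup>2} \<times> {..<p\<^sup>2} \<times> {..<p},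
     monoid.mult = (\<lambda>(i, j, k) (i', j', k').
       ((i + i' + p * k * i') mod p\<^sup>2, (j + j' + p * j * i') mod p\<^sup>2, (k + k') mod p)),
     one = (0, 0, 0)\<rparr>"

lemma triple_mult:
  "(i, j, k) \<otimes>\<^bsub>triple_group p\<^esub> (i', j', k') =
     ((i + i' + p * k * i') mod p\<^sup>2, (j + j' + p * j * i') mod p\<^sup>2, (k + k') mod p)"
  by (simp add: triple_group_def)

lemma triple_one: "\<one>\<^bsub>triple_group p\<^esub> = (0, 0, 0)"
  by (simp add: triple_group_def)

lemma triple_carrier: "carrier (triple_group p) = {..<p\<^sup>2} \<times> {..<p\<^sup>2} \<times> {..<p}"
  by (simp add: triple_group_def)

lemma mod_square_eqI: "(a :: nat) + p\<^sup>2 * c = b + p\<^sup>2 * d \<Longrightarrow> a mod p\<^sup>2 = b mod p\<^sup>2"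
  by (metis mod_mult_self2)

lemma mod_mult_middle_eq: "a * (b mod q) * c mod q = a * b * c mod (q::nat)"
  by (metis mod_mult_left_eq mod_mult_right_eq)

lemma triple_assoc_aux:
  fixes p :: nat
  shows "p * ((k + k') mod p) * l mod p\<^sup>2 = p * (k + k') * l mod p\<^sup>2"
proof -
  have "[p * ((k + k') mod p) = p * (k + k')] (mod p * p)"
    by (metis cong_def mod_mult_mult1 mod_mod_trivial)
  then have "[p * ((k + k') mod p) * l = p * (k + k') * l] (mod p\<^sup>2)"
    unfolding power2_eq_square by (rule cong_scalar_right)
  then show ?thesis by (simp add: cong_def)
qed

text \<open>The twisting terms carry a factor p, so their interaction carries
  \<open>p\<^sup>2\<close> and the two bracketings of a product agree.\<close>

lemma group_triple_group:
  assumes p: "p > 0" shows "group (triple_group p)"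
proof (rule groupI)
  let ?G = "triple_group p"
  show "x \<otimes>\<^bsub>?G\<^esub> y \<in> carrier ?G" if "x \<in> carrier ?G" "y \<in> carrier ?G" for x y
    using p by (cases x; cases y) (simp add: triple_mult triple_carrier)
  show "\<one>\<^bsub>?G\<^esub> \<in> carrier ?G" using p by (simp add: triple_one triple_carrier)
  show "\<one>\<^bsub>?G\<^esub> \<otimes>\<^bsub>?G\<^esub> x = x" if "x \<in> carrier ?G" for x
    using that by (cases x) (simp add: triple_one triple_mult triple_carrier)
  show "x \<otimes>\<^bsub>?G\<^esub> y \<otimes>\<^bsub>?G\<^esub> z = x \<otimes>\<^bsub>?G\<^esub> (y \<otimes>\<^bsub>?G\<^esub> z)" for x y z
  proof -
    obtain i j k i' j' k' l m n where xyz: "x = (i, j, k)" "y = (i', j', k')" "z = (l, m, n)"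
      by (metis prod_cases3)
    have 1: "((i + i' + p * k * i') mod p\<^sup>2 + l + p * ((k + k') mod p) * l) mod p\<^sup>2 =
        (i + (i' + l + p * k' * l) mod p\<^sup>2 + p * k * ((i' + l + p * k' * l) mod p\<^sup>2)) mod p\<^sup>2"
    proof -
      have "((i + i' + p * k * i') mod p\<^sup>2 + l + p * ((k + k') mod p) * l) mod p\<^sup>2 =
          (i + i' + p * k * i' + l + p * (k + k') * l) mod p\<^sup>2"
        by (intro mod_add_cong) (simp_all add: triple_assoc_aux)
      also have "\<dots> = (i + (i' + l + p * k' * l) + p * k * (i' + l + p * k' * l)) mod p\<^sup>2"
        by (rule mod_square_eqI[where c = "k * k' * l" and d = 0]) (simp add: algebra_simps power2_eq_square)
      also have "\<dots> = (i + (i' + l + p * k' * l) mod p\<^sup>2 + p * k * ((i' + l + p * k' * l) mod p\<^sup>2)) mod p\<^sup>2"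
        by (intro mod_add_cong) (simp_all add: mod_mult_right_eq)
      finally show ?thesis .
    qed
    have 2: "((j + j' + p * j * i') mod p\<^sup>2 + m + p * ((j + j' + p * j * i') mod p\<^sup>2) * l) mod p\<^sup>2 =
        (j + (j' + m + p * j' * l) mod p\<^sup>2 + p * j * ((i' + l + p * k' * l) mod p\<^sup>2)) mod p\<^sup>2"
    proof -
      have "((j + j' + p * j * i') mod p\<^sup>2 + m + p * ((j + j' + p * j * i') mod p\<^sup>2) * l) mod p\<^sup>2 =
          (j + j' + p * j * i' + m + p * (j + j' + p * j * i') * l) mod p\<^sup>2"
        by (intro mod_add_cong) (simp_all add: mod_mult_right_eq mod_mult_middle_eq)
      also have "\<dots> = (j + (j' + m + p * j' * l) + p * j * (i' + l + p * k' * l)) mod p\<^sup>2"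
        by (rule mod_square_eqI[where c = "j * k' * l" and d = "j * i' * l"]) (simp add: algebra_simps power2_eq_square)
      also have "\<dots> = (j + (j' + m + p * j' * l) mod p\<^sup>2 + p * j * ((i' + l + p * k' * l) mod p\<^sup>2)) mod p\<^sup>2"
        by (intro mod_add_cong) (simp_all add: mod_mult_right_eq mod_mult_middle_eq)
      finally show ?thesis .
    qed
    show ?thesis unfolding xyz triple_mult 1 2 by (simp add: mod_simps add.assoc)
  qed
  show "\<exists>y\<in>carrier ?G. y \<otimes>\<^bsub>?G\<^esub> x = \<one>\<^bsub>?G\<^esub>" if x: "x \<in> carrier ?G" for x
  proof -
    obtain i j k where xx: "x = (i, j, k)" "i < p\<^sup>2" "j < p\<^sup>2" "k < p"
      using x by (auto simp: triple_carrier)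
    \<comment> \<open>The product is the identity when k' = -k modulo p, i' = -(i + p k' i) and j'
      (1 + p i) = -j modulo \<open>p\<^sup>2\<close>; the inverse of 1 + p i is 1 - p i. The moduli
      are added first so that natural subtraction does not truncate.\<close>
    define k' where "k' = (p - k) mod p"
    define i' where "i' = (p\<^sup>2 - (i + p * k' * i) mod p\<^sup>2) mod p\<^sup>2"
    define j' where "j' = (p\<^sup>2 - j) * (p\<^sup>2 + 1 - p * i mod p\<^sup>2) mod p\<^sup>2"
    have neg: "((q - a mod q) mod q + a) mod q = 0" if "q > 0" for a q :: nat
    proof -
      have "((q - a mod q) mod q + a) mod q = (q - a mod q + a mod q) mod q" by (simp add: mod_simps)
      also have "\<dots> = 0" using that by (simp add: less_imp_le)
      finally show ?thesis .
    qed
    have "(i' + i + p * k' * i) mod p\<^sup>2 = 0"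
      using neg[of "p\<^sup>2" "i + p * k' * i"] p by (simp add: i'_def add.assoc)
    moreover have "(j' + j + p * j' * i) mod p\<^sup>2 = 0"
    proof -
      define c where "c = p * i mod p\<^sup>2"
      have c: "c \<le> p\<^sup>2" unfolding c_def using p by (simp add: less_imp_le)
      have cc: "int (p\<^sup>2) dvd int c * int c"
      proof -
        have "[c * c = (p * i) * (p * i)] (mod p\<^sup>2)"
          unfolding c_def by (intro cong_mult) (simp_all add: cong_def)
        moreover have "[(p * i) * (p * i) = 0] (mod p\<^sup>2)"
          by (simp add: cong_0_iff power2_eq_square mult_ac)
        ultimately have "p\<^sup>2 dvd c * c" using cong_trans cong_0_iff by blast
        then show ?thesis by (metis int_dvd_int_iff of_nat_mult)
      qed
      have "[int (j' + j + p * j' * i) = int j' * (1 + int c) + int j] (mod int (p\<^sup>2))"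
      proof -
        have "[int (p * i) = int c] (mod int (p\<^sup>2))" unfolding c_def cong_int_iff by (simp add: cong_def)
        then have "[int j' + int j + int j' * int (p * i) = int j' + int j + int j' * int c] (mod int (p\<^sup>2))"
          by (intro cong_add cong_mult) simp_all
        then show ?thesis by (simp add: algebra_simps)
      qed
      also have "[int j' * (1 + int c) + int j = (int (p\<^sup>2) - int j) * (int (p\<^sup>2) + 1 - int c) * (1 + int c) + int j] (mod int (p\<^sup>2))"
      proof -
        have "[j' = (p\<^sup>2 - j) * (p\<^sup>2 + 1 - c)] (mod p\<^sup>2)" by (simp add: j'_def c_def cong_def)
        then have "[int j' = int ((p\<^sup>2 - j) * (p\<^sup>2 + 1 - c))] (mod int (p\<^sup>2))" by (simp only: cong_int_iff)
        also have "int ((p\<^sup>2 - j) * (p\<^sup>2 + 1 - c)) = (int (p\<^sup>2) - int j) * (int (p\<^sup>2) + 1 - int c)"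
          using xx(3) c by (simp add: of_nat_diff less_imp_le)
        finally show ?thesis by (intro cong_add cong_mult) simp_all
      qed
      also have "(int (p\<^sup>2) - int j) * (int (p\<^sup>2) + 1 - int c) * (1 + int c) + int j =
          int (p\<^sup>2) * ((int (p\<^sup>2) + 1 - int c) * (1 + int c) - int j * (1 + int c)) + int j * (int c * int c)"
        by (simp add: algebra_simps)
      also have "[\<dots> = 0] (mod int (p\<^sup>2))"
        using cc by (simp add: cong_0_iff)
      finally have "int (p\<^sup>2) dvd int (j' + j + p * j' * i)" by (simp only: cong_0_iff)
      then show ?thesis by (metis int_dvd_int_iff dvd_imp_mod_0)
    qed
    moreover have "(k' + k) mod p = 0" using neg[of p k] xx p by (simp add: k'_def)
    ultimately have "(i', j', k') \<otimes>\<^bsub>?G\<^esub> x = \<one>\<^bsub>?G\<^esub>" by (simp add: xx triple_mult triple_one)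
    moreover have "(i', j', k') \<in> carrier ?G" using p by (simp add: triple_carrier i'_def j'_def k'_def)
    ultimately show ?thesis by blast
  qed
qed

lemma triple_powers:
  "(Suc 0, 0, 0) [^]\<^bsub>triple_group p\<^esub> n = (n mod p\<^sup>2, 0, 0)"
  "(0, Suc 0, 0) [^]\<^bsub>triple_group p\<^esub> n = (0, n mod p\<^sup>2, 0)"
  "(0, 0, Suc 0) [^]\<^bsub>triple_group p\<^esub> n = (0, 0, n mod p)" for n :: nat
  by (induction n; simp add: triple_one triple_mult mod_simps)+

context group
begin

lemma nat_pow_mod:
  assumes "x \<in> carrier G" "x [^] (n::nat) = \<one>" shows "x [^] (m mod n) = x [^] m"
proof -
  have "x [^] m = x [^] (n * (m div n) + m mod n)" by simp
  also have "\<dots> = x [^] (m mod n)"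
    using assms by (simp only: nat_pow_mult[symmetric] nat_pow_pow[symmetric]) simp
  finally show ?thesis by simp
qed

text \<open>The relations sort any product into normal form: conjugation turns x into
  \<open>x [^] (1 + p)\<close> when z passes it and y into \<open>y [^] (1 + p)\<close> when x is
  pulled to its left. Both the presented group and the Galois group of the tower receive their map
  from the model here.\<close>

lemma triple_hom:
  assumes [simp]: "x \<in> carrier G" "y \<in> carrier G" "z \<in> carrier G"
    and yx: "y \<otimes> x = x \<otimes> y [^] (1 + p)" and zx: "z \<otimes> x = x [^] (1 + p) \<otimes> z"
    and zy: "z \<otimes> y = y \<otimes> z"
    and x1: "x [^] p\<^sup>2 = \<one>" and y1: "y [^] p\<^sup>2 = \<one>" and z1: "z [^] p = \<one>"
  shows "(\<lambda>(i, j, k). x [^] i \<otimes> y [^] j \<otimes> z [^] k) \<in> hom (triple_group p) G"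
proof -
  have yjx: "y [^] j \<otimes> x = x \<otimes> y [^] (j * (1 + p))" for j
  proof (induction j)
    case (Suc j)
    have "y [^] Suc j \<otimes> x = y [^] j \<otimes> (y \<otimes> x)" by (simp add: m_assoc)
    also have "\<dots> = (y [^] j \<otimes> x) \<otimes> y [^] (1 + p)" unfolding yx by (simp add: m_assoc del: nat_pow_Suc)
    also have "\<dots> = x \<otimes> (y [^] (j * (1 + p)) \<otimes> y [^] (1 + p))"
      unfolding Suc by (simp add: m_assoc del: nat_pow_Suc)
    also have "\<dots> = x \<otimes> y [^] (Suc j * (1 + p))"
      by (simp only: nat_pow_mult[OF assms(2)] mult_Suc add.commute)
    finally show ?case .
  qed simp
  have yjxi: "y [^] j \<otimes> x [^] i = x [^] i \<otimes> y [^] (j * (1 + p) ^ i)" for i j :: nat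
  proof (induction i)
    case (Suc i)
    have "y [^] j \<otimes> x [^] Suc i = (y [^] j \<otimes> x [^] i) \<otimes> x" by (simp add: m_assoc)
    also have "\<dots> = x [^] i \<otimes> (y [^] (j * (1 + p) ^ i) \<otimes> x)" unfolding Suc by (simp add: m_assoc)
    also have "\<dots> = x [^] Suc i \<otimes> y [^] (j * (1 + p) ^ Suc i)"
      unfolding yjx by (simp add: m_assoc mult_ac)
    finally show ?case .
  qed simp
  have zxn: "z \<otimes> x [^] n = x [^] (n * (1 + p)) \<otimes> z" for n
  proof (induction n)
    case (Suc n)
    have "z \<otimes> x [^] Suc n = (z \<otimes> x [^] n) \<otimes> x" by (simp add: m_assoc)
    also have "\<dots> = x [^] (n * (1 + p)) \<otimes> (z \<otimes> x)" unfolding Suc by (simp add: m_assoc)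
    also have "\<dots> = (x [^] (n * (1 + p)) \<otimes> x [^] (1 + p)) \<otimes> z"
      unfolding zx by (simp add: m_assoc del: nat_pow_Suc)
    also have "\<dots> = x [^] (Suc n * (1 + p)) \<otimes> z"
      by (simp only: nat_pow_mult[OF assms(1)] mult_Suc add.commute)
    finally show ?case .
  qed simp
  have zkxi: "z [^] k \<otimes> x [^] i = x [^] (i * (1 + p) ^ k) \<otimes> z [^] k" for i k :: nat
  proof (induction k)
    case (Suc k)
    have "z [^] Suc k \<otimes> x [^] i = z [^] k \<otimes> (z \<otimes> x [^] i)" by (simp add: m_assoc)
    also have "\<dots> = z [^] k \<otimes> x [^] (i * (1 + p)) \<otimes> z" unfolding zxn by (simp add: m_assoc)
    also have "z [^] k \<otimes> x [^] (i * (1 + p)) = x [^] (i * (1 + p) ^ Suc k) \<otimes> z [^] k"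
    proof -
      \<comment> \<open>Conjugation by \<open>z [^] k\<close> respects powers, so its effect on
        \<open>x [^] i'\<close> fixes its effect on \<open>x [^] (i' * n)\<close>; the case n = 1 +
        p closes the induction.\<close>
      have "z [^] k \<otimes> x [^] (i' * n) = x [^] (i' * (1 + p) ^ k * n) \<otimes> z [^] k"
        if "z [^] k \<otimes> x [^] i' = x [^] (i' * (1 + p) ^ k) \<otimes> z [^] k" for i' n
      proof (induction n)
        case (Suc n)
        have "z [^] k \<otimes> x [^] (i' * Suc n) = (z [^] k \<otimes> x [^] (i' * n)) \<otimes> x [^] i'"
          by (simp add: m_assoc nat_pow_mult add.commute)
        also have "\<dots> = x [^] (i' * (1 + p) ^ k * n) \<otimes> (z [^] k \<otimes> x [^] i')"
          unfolding Suc by (simp add: m_assoc)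
        also have "\<dots> = (x [^] (i' * (1 + p) ^ k * n) \<otimes> x [^] (i' * (1 + p) ^ k)) \<otimes> z [^] k"
          unfolding that by (simp add: m_assoc)
        also have "\<dots> = x [^] (i' * (1 + p) ^ k * Suc n) \<otimes> z [^] k"
          by (simp only: nat_pow_mult[OF assms(1)] mult_Suc_right add.commute)
        finally show ?case .
      qed simp
      from this[OF Suc, of "1 + p"] show ?thesis by (simp only: power_Suc mult_ac)
    qed
    finally show ?case by (simp add: m_assoc)
  qed simp
  have zkyj: "z [^] k \<otimes> y [^] j = y [^] j \<otimes> z [^] k" for j k :: nat
    using group_commutes_pow[OF group_commutes_pow[OF zy, of k, symmetric], of j] by simp
  have xc: "x [^] a = x [^] b" if "[a = b] (mod p\<^sup>2)" for a b :: nat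
    using nat_pow_mod[OF assms(1) x1] that by (metis cong_def)
  have yc: "y [^] a = y [^] b" if "[a = b] (mod p\<^sup>2)" for a b :: nat
    using nat_pow_mod[OF assms(2) y1] that by (metis cong_def)
  show ?thesis
  proof (rule homI)
    fix u v assume "u \<in> carrier (triple_group p)" "v \<in> carrier (triple_group p)"
    obtain i j k i' j' k' where uv: "u = (i, j, k)" "v = (i', j', k')" by (metis prod_cases3)
    \<comment> \<open>\<open>e\<close> is the exponent of x after \<open>z [^] k\<close> has passed.
      Modulo \<open>p\<^sup>2\<close> the powers of 1 + p become linear in their exponent, and in
      \<open>p * e\<close> only e modulo p counts, so k drops out of the exponent of y.\<close>
    define e where "e = i' * (1 + p) ^ k"
    have e: "[e = i' + p * k * i'] (mod p\<^sup>2)"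
      using cong_mult[OF cong_refl one_plus_pow_cong, of i' p k] by (simp add: e_def algebra_simps)
    have "[j * (1 + p) ^ e = j * (1 + p * e)] (mod p\<^sup>2)"
      by (intro cong_mult cong_refl one_plus_pow_cong)
    also have "[j * (1 + p * e) = j * (1 + p * (i' + p * k * i'))] (mod p\<^sup>2)"
      by (intro cong_mult cong_add cong_refl e)
    also have "j * (1 + p * (i' + p * k * i')) = (j + p * j * i') + p\<^sup>2 * (j * k * i')"
      by (simp add: algebra_simps power2_eq_square)
    also have "[\<dots> = j + p * j * i'] (mod p\<^sup>2)"
      by (metis cong_add_lcancel_0_nat cong_mult_self_left)
    finally have je: "[j * (1 + p) ^ e = j + p * j * i'] (mod p\<^sup>2)" .
    have "(x [^] i \<otimes> y [^] j \<otimes> z [^] k) \<otimes> (x [^] i' \<otimes> y [^] j' \<otimes> z [^] k') =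
       x [^] i \<otimes> y [^] j \<otimes> (z [^] k \<otimes> x [^] i') \<otimes> y [^] j' \<otimes> z [^] k'"
      by (simp add: m_assoc)
    also have "\<dots> = x [^] i \<otimes> (y [^] j \<otimes> x [^] e) \<otimes> (z [^] k \<otimes> y [^] j') \<otimes> z [^] k'"
      unfolding zkxi e_def[symmetric] by (simp add: m_assoc)
    also have "\<dots> = (x [^] i \<otimes> x [^] e) \<otimes> (y [^] (j * (1 + p) ^ e) \<otimes> y [^] j') \<otimes> (z [^] k \<otimes> z [^] k')"
      unfolding yjxi zkyj by (simp add: m_assoc)
    also have "\<dots> = x [^] (i + e) \<otimes> y [^] (j * (1 + p) ^ e + j') \<otimes> z [^] (k + k')"
      by (simp add: nat_pow_mult)
    also have "x [^] (i + e) = x [^] ((i + i' + p * k * i') mod p\<^sup>2)"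
      using e by (intro xc) (simp add: cong_def mod_simps, metis mod_add_right_eq add.assoc)
    also have "y [^] (j * (1 + p) ^ e + j') = y [^] ((j + j' + p * j * i') mod p\<^sup>2)"
      using je by (intro yc) (simp add: cong_def mod_simps, metis mod_add_left_eq add.assoc add.commute)
    also have "z [^] (k + k') = z [^] ((k + k') mod p)"
      using nat_pow_mod[OF assms(3) z1] by simp
    finally show "(case u \<otimes>\<^bsub>triple_group p\<^esub> v of (i, j, k) \<Rightarrow> x [^] i \<otimes> y [^] j \<otimes> z [^] k) =
      (case u of (i, j, k) \<Rightarrow> x [^] i \<otimes> y [^] j \<otimes> z [^] k) \<otimes>
      (case v of (i, j, k) \<Rightarrow> x [^] i \<otimes> y [^] j \<otimes> z [^] k)"
      unfolding uv triple_mult by simp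
  qed (auto split: prod.splits)
qed

end

section \<open>Words, their values in a group, and the presented group\<close>

context group
begin

text \<open>The homomorphism on words induced by an assignment of the generators. It is defined on
  unreduced words, so that cancellation is just one more rule to be respected in
  \<open>word_eval_pres_eq\<close>.\<close>

primrec word_eval :: "('g \<Rightarrow> 'a) \<Rightarrow> 'g word \<Rightarrow> 'a" where
  "word_eval g [] = \<one>"
| "word_eval g (l # w) = (if snd l then g (fst l) else inv (g (fst l))) \<otimes> word_eval g w"

context
  fixes g :: "'g \<Rightarrow> 'a"
  assumes g [simp]: "g a \<in> carrier G"
begin

lemma word_eval_closed [simp]: "word_eval g w \<in> carrier G"
  by (induction w) auto

lemma word_eval_append: "word_eval g (u @ v) = word_eval g u \<otimes> word_eval g v"
  by (induction u) (auto simp: m_assoc)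

lemma word_eval_gen: "word_eval g (gen a) = g a"
  by (simp add: gen_def)

lemma word_eval_inv: "word_eval g (word_inv w) = inv (word_eval g w)"
  by (induction w) (auto simp: word_inv_def word_eval_append inv_mult_group)

lemma word_eval_pow: "word_eval g (word_pow w n) = word_eval g w [^] n"
proof (induction n)
  case (Suc n)
  have "word_pow w (Suc n) = w @ word_pow w n" by (simp add: word_pow_def)
  then show ?case
    using Suc nat_pow_Suc2[of "word_eval g w" n] by (simp add: word_eval_append)
qed (simp add: word_pow_def)

lemma word_eval_commutator_iff:
  "word_eval g (word_comm u v @ word_inv w) = \<one> \<longleftrightarrow>
     word_eval g u \<otimes> word_eval g v = word_eval g v \<otimes> word_eval g u \<otimes> word_eval g w"
proof -
  let ?u = "word_eval g u" and ?v = "word_eval g v" and ?w = "word_eval g w"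
  have "word_eval g (word_comm u v @ word_inv w) = inv (?v \<otimes> ?u) \<otimes> (?u \<otimes> ?v) \<otimes> inv ?w"
    by (simp add: word_comm_def word_eval_append word_eval_inv inv_mult_group m_assoc)
  also have "\<dots> = \<one> \<longleftrightarrow> inv (?v \<otimes> ?u) \<otimes> (?u \<otimes> ?v) = ?w"
    by (metis inv_closed inv_equality inv_inv m_closed r_inv word_eval_closed)
  also have "\<dots> \<longleftrightarrow> ?u \<otimes> ?v = ?v \<otimes> ?u \<otimes> ?w"
    by (rule inv_solve_left') simp_all
  finally show ?thesis .
qed

lemma word_eval_commutator_iff':
  "word_eval g (word_comm u v) = \<one> \<longleftrightarrow>
     word_eval g u \<otimes> word_eval g v = word_eval g v \<otimes> word_eval g u"
  using word_eval_commutator_iff[of u v "[]"] by (simp add: word_inv_def)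

lemma word_eval_power_iff:
  "word_eval g (word_pow u n @ word_inv w) = \<one> \<longleftrightarrow> word_eval g u [^] n = word_eval g w"
  by (simp add: word_eval_append word_eval_pow word_eval_inv)
    (metis inv_closed inv_equality inv_inv nat_pow_closed r_inv word_eval_closed)

text \<open>Von Dyck's principle: each rule generating \<open>pres_eq\<close> preserves values in a
  group that satisfies the relators. Inequivalence of words is thereby shown by evaluating them in
  another group.\<close>

lemma word_eval_pres_eq:
  assumes "\<And>r. r \<in> R \<Longrightarrow> word_eval g r = \<one>" and "pres_eq R u v"
  shows "word_eval g u = word_eval g v"
  using assms(2) by induction (auto simp: word_eval_append assms(1))

end

end

definition word_class :: "'g word set \<Rightarrow> 'g word \<Rightarrow> 'g word set" where
  "word_class R u = pres_rel R `` {u}"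

lemma word_class_eq_iff: "word_class R u = word_class R v \<longleftrightarrow> pres_eq R u v"
  unfolding word_class_def by (subst eq_equiv_class_iff[OF equiv_pres_rel]) (auto simp: pres_rel_def)

lemma carrier_presented_group: "carrier (presented_group R) = range (word_class R)"
  by (auto simp: presented_group_def quotient_def word_class_def)

text \<open>Evaluation at the classes of the generators is the projection onto the presented group;
  it turns relators into equations between these classes.\<close>

lemma word_eval_presented_group:
  "group.word_eval (presented_group R) (\<lambda>a. word_class R (gen a)) w = word_class R w"
proof -
  let ?P = "presented_group R" and ?g = "\<lambda>a. word_class R (gen a)"
  interpret P: group ?P by (rule group_presented_group)
  have mult: "word_class R u \<otimes>\<^bsub>?P\<^esub> word_class R v = word_class R (u @ v)" for u v
    unfolding word_class_def by (rule presented_group_mult)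
  have one: "\<one>\<^bsub>?P\<^esub> = word_class R []" by (simp add: presented_group_def word_class_def)
  have c: "word_class R u \<in> carrier ?P" for u by (simp add: carrier_presented_group)
  have inv: "inv\<^bsub>?P\<^esub> (?g a) = word_class R [(a, False)]" for a
  proof (rule P.inv_equality)
    show "word_class R [(a, False)] \<otimes>\<^bsub>?P\<^esub> ?g a = \<one>\<^bsub>?P\<^esub>"
      unfolding mult one word_class_eq_iff using pres_eq.cancel[of R a False] by (simp add: gen_def)
  qed (auto simp: c)
  show ?thesis
  proof (induction w)
    case (Cons l w)
    have "(if snd l then ?g (fst l) else inv\<^bsub>?P\<^esub> (?g (fst l))) = word_class R [l]"
      unfolding inv by (cases l) (simp add: gen_def)
    then show ?case by (simp add: Cons mult)
  qed (simp add: one)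
qed

text \<open>The map out of the model comes from \<open>triple_hom\<close>, and its image contains
  the generators. It is injective because the model satisfies the relators itself, so that
  evaluating a word in the model recovers the triple.\<close>

theorem phi4_221a_iso_triple_group:
  assumes p: "p > 1"
  shows "triple_group p \<cong> phi4_221a p"
proof -
  define R where "R = phi4_221a_relators p"
  define P where "P = phi4_221a p"
  have P: "P = presented_group R" by (simp add: P_def R_def phi4_221a_def)
  let ?H = "triple_group p"
  interpret P: group P unfolding P by (rule group_presented_group)
  interpret H: group ?H using p by (intro group_triple_group) simp
  define c where "c a = word_class R (gen a)" for a
  have cc: "c a \<in> carrier P" for a by (simp add: c_def P carrier_presented_group)
  have ev: "P.word_eval c w = word_class R w" for w
    using word_eval_presented_group[of R w] unfolding P c_def .
  have rel: "P.word_eval c r = \<one>\<^bsub>P\<^esub>" if "r \<in> R" for r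
    using pres_eq.relator[OF that] by (metis P.word_eval.simps(1) ev word_class_eq_iff)
  note iffs = P.word_eval_commutator_iff[of c, OF cc] P.word_eval_commutator_iff'[of c, OF cc]
    P.word_eval_power_iff[of c, OF cc] P.word_eval_pow[of c, OF cc] P.word_eval_gen[of c, OF cc]
  have r1: "c \<alpha>\<^sub>1 \<otimes>\<^bsub>P\<^esub> c \<alpha> = c \<alpha> \<otimes>\<^bsub>P\<^esub> c \<alpha>\<^sub>1 \<otimes>\<^bsub>P\<^esub> c \<beta>\<^sub>1"
    and r2: "c \<alpha>\<^sub>2 \<otimes>\<^bsub>P\<^esub> c \<alpha> = c \<alpha> \<otimes>\<^bsub>P\<^esub> c \<alpha>\<^sub>2 \<otimes>\<^bsub>P\<^esub> c \<beta>\<^sub>2"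
    and r3: "c \<alpha> [^]\<^bsub>P\<^esub> p = c \<beta>\<^sub>2" and r4: "c \<alpha>\<^sub>1 [^]\<^bsub>P\<^esub> p = c \<beta>\<^sub>1"
    and r5: "c \<alpha>\<^sub>2 [^]\<^bsub>P\<^esub> p = \<one>\<^bsub>P\<^esub>" and r6: "c \<beta>\<^sub>1 [^]\<^bsub>P\<^esub> p = \<one>\<^bsub>P\<^esub>" and r7: "c \<beta>\<^sub>2 [^]\<^bsub>P\<^esub> p = \<one>\<^bsub>P\<^esub>"
    using rel[of "word_comm (gen \<alpha>\<^sub>1) (gen \<alpha>) @ word_inv (gen \<beta>\<^sub>1)"]
      rel[of "word_comm (gen \<alpha>\<^sub>2) (gen \<alpha>) @ word_inv (gen \<beta>\<^sub>2)"]
      rel[of "word_pow (gen \<alpha>) p @ word_inv (gen \<beta>\<^sub>2)"]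
      rel[of "word_pow (gen \<alpha>\<^sub>1) p @ word_inv (gen \<beta>\<^sub>1)"]
      rel[of "word_pow (gen \<alpha>\<^sub>2) p"] rel[of "word_pow (gen \<beta>\<^sub>1) p"] rel[of "word_pow (gen \<beta>\<^sub>2) p"]
    unfolding iffs by (simp_all add: R_def phi4_221a_relators_def)
  have comm: "c a \<otimes>\<^bsub>P\<^esub> c b = c b \<otimes>\<^bsub>P\<^esub> c a" if "{a, b} \<noteq> {\<alpha>\<^sub>1, \<alpha>}" "{a, b} \<noteq> {\<alpha>\<^sub>2, \<alpha>}" for a b
    using rel[of "word_comm (gen a) (gen b)"] that
    unfolding iffs by (auto simp: R_def phi4_221a_relators_def)
  define x y z where "x = c \<alpha>" and "y = c \<alpha>\<^sub>1" and "z = c \<alpha>\<^sub>2"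
  have xyz [simp]: "x \<in> carrier P" "y \<in> carrier P" "z \<in> carrier P"
    by (simp_all add: x_def y_def z_def cc)
  have b1: "c \<beta>\<^sub>1 = y [^]\<^bsub>P\<^esub> p" and b2: "c \<beta>\<^sub>2 = x [^]\<^bsub>P\<^esub> p"
    using r3 r4 by (simp_all add: x_def y_def)
  have yx: "y \<otimes>\<^bsub>P\<^esub> x = x \<otimes>\<^bsub>P\<^esub> y [^]\<^bsub>P\<^esub> (1 + p)"
    using r1 unfolding b1 x_def[symmetric] y_def[symmetric]
    by (simp add: P.m_assoc P.nat_pow_comm flip: P.nat_pow_Suc2)
  have zx: "z \<otimes>\<^bsub>P\<^esub> x = x [^]\<^bsub>P\<^esub> (1 + p) \<otimes>\<^bsub>P\<^esub> z"
  proof -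
    have "z \<otimes>\<^bsub>P\<^esub> x = x \<otimes>\<^bsub>P\<^esub> (z \<otimes>\<^bsub>P\<^esub> x [^]\<^bsub>P\<^esub> p)"
      using r2 unfolding b2 x_def[symmetric] z_def[symmetric] by (simp add: P.m_assoc)
    also have "z \<otimes>\<^bsub>P\<^esub> x [^]\<^bsub>P\<^esub> p = x [^]\<^bsub>P\<^esub> p \<otimes>\<^bsub>P\<^esub> z"
      using comm[of \<alpha>\<^sub>2 \<beta>\<^sub>2] unfolding b2 z_def by auto
    finally show ?thesis
      using P.nat_pow_Suc2[of x p] by (simp add: P.m_assoc[symmetric])
  qed
  have zy: "z \<otimes>\<^bsub>P\<^esub> y = y \<otimes>\<^bsub>P\<^esub> z" unfolding z_def y_def by (rule comm) auto
  have x1: "x [^]\<^bsub>P\<^esub> p\<^sup>2 = \<one>\<^bsub>P\<^esub>" and y1: "y [^]\<^bsub>P\<^esub> p\<^sup>2 = \<one>\<^bsub>P\<^esub>"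
    using r6 r7 by (simp_all add: b1 b2 P.nat_pow_pow power2_eq_square)
  have z1: "z [^]\<^bsub>P\<^esub> p = \<one>\<^bsub>P\<^esub>" using r5 by (simp add: z_def)
  define f where "f = (\<lambda>(i :: nat, j :: nat, k :: nat). x [^]\<^bsub>P\<^esub> i \<otimes>\<^bsub>P\<^esub> y [^]\<^bsub>P\<^esub> j \<otimes>\<^bsub>P\<^esub> z [^]\<^bsub>P\<^esub> k)"
  have f: "f \<in> hom ?H P"
    unfolding f_def by (rule P.triple_hom) (use yx zx zy x1 y1 z1 in auto)
  interpret f: group_hom ?H P f by unfold_locales (rule f)
  \<comment> \<open>The images of \<open>\<beta>\<^sub>1\<close> and \<open>\<beta>\<^sub>2\<close>
    are forced: they are the p-th powers of those of \<open>\<alpha>\<^sub>1\<close> and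
    \<open>\<alpha>\<close>.\<close>
  define e :: "phi4_gen \<Rightarrow> nat \<times> nat \<times> nat" where
    "e = case_phi4_gen (1, 0, 0) (0, 1, 0) (0, 0, 1) (0, p, 0) (p, 0, 0)"
  have p2: "p < p\<^sup>2" "1 < p\<^sup>2" using p by (auto simp: power2_eq_square intro: less_trans)
  have ec: "e a \<in> carrier ?H" for a
    using p p2 by (cases a) (auto simp: e_def triple_carrier)
  note pows = triple_powers triple_powers[folded One_nat_def]
  have sq: "Suc (p\<^sup>2) mod p\<^sup>2 = Suc 0" "Suc (p + p * p) mod p\<^sup>2 = Suc p mod p\<^sup>2"
    using p2 mod_add_self2[of "Suc 0" "p\<^sup>2"] mod_add_self2[of "Suc p" "p\<^sup>2"]
    by (simp_all add: power2_eq_square)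
  have eR: "H.word_eval e r = \<one>\<^bsub>?H\<^esub>" if "r \<in> R" for r
  proof -
    note iffs = H.word_eval_commutator_iff[of e, OF ec] H.word_eval_commutator_iff'[of e, OF ec]
      H.word_eval_power_iff[of e, OF ec] H.word_eval_pow[of e, OF ec] H.word_eval_gen[of e, OF ec]
    have pb1: "(0, p, 0) [^]\<^bsub>?H\<^esub> p = \<one>\<^bsub>?H\<^esub>" and pb2: "(p, 0, 0) [^]\<^bsub>?H\<^esub> p = \<one>\<^bsub>?H\<^esub>"
    proof -
      have "((0, 1, 0) [^]\<^bsub>?H\<^esub> p) [^]\<^bsub>?H\<^esub> p = \<one>\<^bsub>?H\<^esub>" "((1, 0, 0) [^]\<^bsub>?H\<^esub> p) [^]\<^bsub>?H\<^esub> p = \<one>\<^bsub>?H\<^esub>"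
        using H.nat_pow_pow[OF ec[of \<alpha>], of p p] H.nat_pow_pow[OF ec[of \<alpha>\<^sub>1], of p p]
        by (simp_all add: e_def pows triple_one power2_eq_square)
      then show "(0, p, 0) [^]\<^bsub>?H\<^esub> p = \<one>\<^bsub>?H\<^esub>" "(p, 0, 0) [^]\<^bsub>?H\<^esub> p = \<one>\<^bsub>?H\<^esub>"
        using p2 by (simp_all add: pows)
    qed
    consider "r = word_comm (gen \<alpha>\<^sub>1) (gen \<alpha>) @ word_inv (gen \<beta>\<^sub>1)"
      | "r = word_comm (gen \<alpha>\<^sub>2) (gen \<alpha>) @ word_inv (gen \<beta>\<^sub>2)"
      | "r = word_pow (gen \<alpha>) p @ word_inv (gen \<beta>\<^sub>2)"
      | "r = word_pow (gen \<alpha>\<^sub>1) p @ word_inv (gen \<beta>\<^sub>1)"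
      | "r = word_pow (gen \<alpha>\<^sub>2) p" | "r = word_pow (gen \<beta>\<^sub>1) p" | "r = word_pow (gen \<beta>\<^sub>2) p"
      | a b where "r = word_comm (gen a) (gen b)" "{a, b} \<noteq> {\<alpha>\<^sub>1, \<alpha>}" "{a, b} \<noteq> {\<alpha>\<^sub>2, \<alpha>}"
      using \<open>r \<in> R\<close> unfolding R_def phi4_221a_relators_def by blast
    then show ?thesis
    proof cases
      case (8 a b)
      with p show ?thesis
        unfolding 8(1) iffs by (cases a; cases b)
          (auto simp: e_def triple_mult add.commute sq simp flip: power2_eq_square)
    qed (use p p2 in \<open>simp_all only: iffs\<close>,
        simp_all add: e_def triple_mult pows sq triple_one pb1[unfolded triple_one] pb2[unfolded triple_one] add.commute)
  qed
  \<comment> \<open>Evaluation at \<open>e\<close> inverts \<open>f\<close>: the normal form word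
    \<open>w'\<close> represents \<open>f u\<close>, every other representative has the same value,
    and the value of \<open>w'\<close> is \<open>u\<close>.\<close>
  have ef: "H.word_eval e w = u" if "u \<in> carrier ?H" "f u = word_class R w" for u w
  proof -
    obtain i j k where u: "u = (i, j, k)" "i < p\<^sup>2" "j < p\<^sup>2" "k < p"
      using \<open>u \<in> carrier ?H\<close> by (auto simp: triple_carrier)
    define w' where "w' = word_pow (gen \<alpha>) i @ word_pow (gen \<alpha>\<^sub>1) j @ word_pow (gen \<alpha>\<^sub>2) k"
    have "word_class R w' = f u"
      unfolding ev[symmetric] w'_def
      by (simp add: P.word_eval_append[of c, OF cc] iffs f_def u x_def y_def z_def cc P.m_assoc)
    then have "pres_eq R w' w" using that by (simp add: word_class_eq_iff)
    then have "H.word_eval e w = H.word_eval e w'"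
      using H.word_eval_pres_eq[of e R w' w, OF ec eR] by simp
    also have "\<dots> = u"
      using u by (simp add: w'_def H.word_eval_append[of e, OF ec] H.word_eval_pow[of e, OF ec]
          H.word_eval_gen[of e, OF ec])
        (simp add: e_def pows triple_mult)
    finally show ?thesis .
  qed
  have inj: "inj_on f (carrier ?H)"
  proof (rule inj_onI)
    fix u v assume uv: "u \<in> carrier ?H" "v \<in> carrier ?H" "f u = f v"
    have "f u \<in> carrier P" using uv by simp
    then obtain w where w: "f u = word_class R w" by (auto simp: P carrier_presented_group)
    show "u = v" using ef[OF uv(1) w] ef[OF uv(2) HOL.trans[OF uv(3)[symmetric] w]] by (rule HOL.trans[OF HOL.sym])
  qed
  have sub: "subgroup (f ` carrier ?H) P" by (rule f.img_is_subgroup)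
  have fe: "f (e a) = c a" for a
    using p p2 by (cases a) (simp_all add: f_def e_def x_def y_def z_def cc r3 r4)
  have "word_class R w \<in> f ` carrier ?H" for w
    unfolding ev[symmetric]
  proof (induction w)
    case Nil
    show ?case using subgroup.one_closed[OF sub] by simp
  next
    case (Cons l w)
    have "c a \<in> f ` carrier ?H" for a using fe ec by (metis imageI)
    then show ?case
      using subgroup.m_closed[OF sub _ Cons] subgroup.m_inv_closed[OF sub] by simp
  qed
  then have "f ` carrier ?H = carrier P"
    using f.hom_closed by (auto simp: P carrier_presented_group)
  with f inj have "f \<in> iso ?H P" by (auto simp: iso_iff)
  then show ?thesis unfolding P_def by (rule is_isoI)
qed

section \<open>Subalgebras of the algebraic closure and embeddings\<close>

definition subalg :: "'k::field alg_closure set \<Rightarrow> bool" where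
  "subalg K \<longleftrightarrow> range to_ac \<subseteq> K \<and> (\<forall>x\<in>K. \<forall>y\<in>K. x + y \<in> K \<and> x * y \<in> K)"

definition coeffs_in :: "'a::zero set \<Rightarrow> 'a poly \<Rightarrow> bool" where
  "coeffs_in K f \<longleftrightarrow> (\<forall>i. poly.coeff f i \<in> K)"

text \<open>Polynomial values form a ring, which by \<open>subalg_inverse\<close> is already the
  field generated by \<open>z\<close> over \<open>K\<close>.\<close>

definition adjoin :: "'k::field alg_closure set \<Rightarrow> 'k alg_closure \<Rightarrow> 'k alg_closure set" where
  "adjoin K z = {poly f z | f. coeffs_in K f}"

text \<open>A function on the whole closure that is additive and multiplicative on \<open>K\<close>
  only. Restricting, extending and composing need no change of domain, but two embeddings are
  comparable only on \<open>K\<close>.\<close>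

definition embedding :: "'k::field alg_closure set \<Rightarrow> ('k alg_closure \<Rightarrow> 'k alg_closure) \<Rightarrow> bool" where
  "embedding K \<phi> \<longleftrightarrow> (\<forall>c. \<phi> (to_ac c) = to_ac c) \<and>
     (\<forall>x\<in>K. \<forall>y\<in>K. \<phi> (x + y) = \<phi> x + \<phi> y \<and> \<phi> (x * y) = \<phi> x * \<phi> y)"

lemma subalg_base: "subalg (range to_ac)"
  unfolding subalg_def by (auto simp flip: to_ac_add to_ac_mult)

lemma subalg_to_ac [simp]: "subalg K \<Longrightarrow> to_ac c \<in> K"
  by (auto simp: subalg_def)

lemma subalg_0 [simp]: "subalg K \<Longrightarrow> 0 \<in> K"
  using subalg_to_ac[of K 0] by simp

lemma subalg_1 [simp]: "subalg K \<Longrightarrow> 1 \<in> K"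
  using subalg_to_ac[of K 1] by simp

lemma subalg_add: "subalg K \<Longrightarrow> x \<in> K \<Longrightarrow> y \<in> K \<Longrightarrow> x + y \<in> K"
  by (auto simp: subalg_def)

lemma subalg_mult: "subalg K \<Longrightarrow> x \<in> K \<Longrightarrow> y \<in> K \<Longrightarrow> x * y \<in> K"
  by (auto simp: subalg_def)

lemma subalg_uminus: "subalg K \<Longrightarrow> x \<in> K \<Longrightarrow> - x \<in> K"
  using subalg_mult[of K "to_ac (-1)" x] subalg_to_ac[of K "-1"] by simp

lemma subalg_diff: "subalg K \<Longrightarrow> x \<in> K \<Longrightarrow> y \<in> K \<Longrightarrow> x - y \<in> K"
  using subalg_add[of K x "- y"] subalg_uminus by auto

lemma subalg_power: "subalg K \<Longrightarrow> x \<in> K \<Longrightarrow> x ^ n \<in> K"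
  by (induction n) (auto simp: subalg_mult)

lemma subalg_sum: "subalg K \<Longrightarrow> (\<And>i. i \<in> I \<Longrightarrow> f i \<in> K) \<Longrightarrow> sum f I \<in> K"
  by (induction I rule: infinite_finite_induct) (auto simp: subalg_add)

lemma subalg_prod: "subalg K \<Longrightarrow> (\<And>i. i \<in> I \<Longrightarrow> f i \<in> K) \<Longrightarrow> prod f I \<in> K"
  by (induction I rule: infinite_finite_induct) (auto simp: subalg_mult)

lemma subalg_poly:
  assumes "subalg K" "coeffs_in K f" "x \<in> K"
  shows "poly f x \<in> K"
  using assms unfolding poly_altdef coeffs_in_def
  by (intro subalg_sum subalg_mult subalg_power) auto

lemma coeffs_in_to_ac: "subalg K \<Longrightarrow> coeffs_in K (map_poly to_ac f)"
  by (simp add: coeffs_in_def coeff_map_poly)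

text \<open>Algebraicity of the closure makes every subalgebra a field.\<close>

lemma subalg_inverse:
  assumes K: "subalg K" and x: "x \<in> K"
  shows "inverse x \<in> K"
proof (cases "x = 0")
  case False
  have "inverse x \<in> K" if "f \<noteq> 0" "poly (map_poly to_ac f) x = 0" for f
    using that
  proof (induction f)
    case (pCons c f)
    have eq: "to_ac c + x * poly (map_poly to_ac f) x = 0"
      using pCons.prems by (simp add: map_poly_pCons)
    \<comment> \<open>With zero constant term the factor \<open>x\<close> cancels and a shorter
      relation remains; otherwise the constant term exhibits the inverse as a polynomial in
      \<open>x\<close>.\<close>
    show ?case
    proof (cases "c = 0")
      case True
      with pCons eq False show ?thesis by auto
    next
      case c: False
      have "x * (- to_ac (inverse c) * poly (map_poly to_ac f) x) = 1"
        using eq c by (simp add: field_simps add_eq_0_iff)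
      then have "inverse x = - to_ac (inverse c) * poly (map_poly to_ac f) x"
        by (rule inverse_unique)
      also have "\<dots> \<in> K"
        using K x by (intro subalg_mult subalg_poly subalg_uminus coeffs_in_to_ac subalg_to_ac)
      finally show ?thesis .
    qed
  qed auto
  then show ?thesis using alg_closure_algebraic[of x] by metis
qed (use K in auto)

lemma subalg_divide: "subalg K \<Longrightarrow> x \<in> K \<Longrightarrow> y \<in> K \<Longrightarrow> x / y \<in> K"
  by (simp add: field_class.field_divide_inverse subalg_mult subalg_inverse)

lemma subalg_power_int: "subalg K \<Longrightarrow> x \<in> K \<Longrightarrow> x powi n \<in> K"
  by (simp add: power_int_def subalg_power subalg_inverse)

lemma coeffs_in_0: "0 \<in> K \<Longrightarrow> coeffs_in K 0"
  by (simp add: coeffs_in_def)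

lemma coeffs_in_pCons: "coeffs_in K (pCons c f) \<longleftrightarrow> c \<in> K \<and> coeffs_in K f"
  by (auto simp: coeffs_in_def coeff_pCons split: nat.splits)

lemma coeffs_in_add: "subalg K \<Longrightarrow> coeffs_in K f \<Longrightarrow> coeffs_in K g \<Longrightarrow> coeffs_in K (f + g)"
  by (simp add: coeffs_in_def subalg_add)

lemma coeffs_in_diff: "subalg K \<Longrightarrow> coeffs_in K f \<Longrightarrow> coeffs_in K g \<Longrightarrow> coeffs_in K (f - g)"
  by (simp add: coeffs_in_def subalg_diff)

lemma coeffs_in_mult: "subalg K \<Longrightarrow> coeffs_in K f \<Longrightarrow> coeffs_in K g \<Longrightarrow> coeffs_in K (f * g)"
  by (auto simp: coeffs_in_def coeff_mult intro!: subalg_sum subalg_mult)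

lemma coeffs_in_smult: "subalg K \<Longrightarrow> c \<in> K \<Longrightarrow> coeffs_in K f \<Longrightarrow> coeffs_in K (Polynomial.smult c f)"
  by (simp add: coeffs_in_def subalg_mult)

lemma coeffs_in_monom: "subalg K \<Longrightarrow> c \<in> K \<Longrightarrow> coeffs_in K (Polynomial.monom c n)"
  by (simp add: coeffs_in_def)

lemma adjoinI: "coeffs_in K f \<Longrightarrow> poly f z \<in> adjoin K z"
  by (auto simp: adjoin_def)

lemma adjoin_subset: "subalg K \<Longrightarrow> x \<in> K \<Longrightarrow> x \<in> adjoin K z"
  using adjoinI[of K "[:x:]" z] by (simp add: coeffs_in_pCons coeffs_in_0)

lemma adjoin_gen: "subalg K \<Longrightarrow> z \<in> adjoin K z"
  using adjoinI[of K "[:0, 1:]" z] by (simp add: coeffs_in_pCons coeffs_in_0)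

lemma subalg_adjoin: "subalg K \<Longrightarrow> subalg (adjoin K z)"
  unfolding subalg_def[of "adjoin K z"]
proof (intro conjI ballI)
  assume K: "subalg K"
  then show "range to_ac \<subseteq> adjoin K z"
    by (auto intro: adjoin_subset)
  fix x y assume "x \<in> adjoin K z" "y \<in> adjoin K z"
  then obtain f g where "coeffs_in K f" "coeffs_in K g" "x = poly f z" "y = poly g z"
    by (auto simp: adjoin_def)
  then show "x + y \<in> adjoin K z" "x * y \<in> adjoin K z"
    using adjoinI[of K "f + g" z] adjoinI[of K "f * g" z] K
    by (auto simp: coeffs_in_add coeffs_in_mult)
qed

lemma adjoin_least:
  assumes "subalg L" "K \<subseteq> L" "z \<in> L" shows "adjoin K z \<subseteq> L"
  using assms by (force simp: adjoin_def coeffs_in_def intro!: subalg_poly)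

text \<open>Long division one coefficient at a time, so that quotient and remainder visibly stay
  over \<open>K\<close>; as the divisor is monic, no inverse is taken.\<close>

lemma division_coeffs_in:
  fixes h :: "'k::field alg_closure poly"
  assumes K: "subalg K" and h: "coeffs_in K h" "lead_coeff h = 1" "Polynomial.degree h > 0"
    and f: "coeffs_in K f"
  shows "\<exists>q r. coeffs_in K q \<and> coeffs_in K r \<and> f = q * h + r \<and>
           Polynomial.degree r < Polynomial.degree h"
  using f
proof (induction f)
  case 0
  then show ?case using K h by (intro exI[of _ 0]) (auto simp: coeffs_in_0)
next
  case (pCons c f)
  then obtain q r where qr: "coeffs_in K q" "coeffs_in K r" "f = q * h + r"
    "Polynomial.degree r < Polynomial.degree h"
    by (auto simp: coeffs_in_pCons)
  define n where "n = Polynomial.degree h"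
  define r' where "r' = pCons c r - Polynomial.smult (poly.coeff (pCons c r) n) h"
  define q' where "q' = pCons 0 q + [:poly.coeff (pCons c r) n:]"
  have 1: "coeffs_in K (pCons c r)" "c \<in> K" using pCons.prems qr by (auto simp: coeffs_in_pCons)
  have 2: "poly.coeff (pCons c r) n \<in> K" using 1(1) by (simp add: coeffs_in_def)
  have "coeffs_in K q'" "coeffs_in K r'"
    unfolding q'_def r'_def using K h qr 1 2
    by (auto intro!: coeffs_in_add coeffs_in_diff coeffs_in_smult simp: coeffs_in_pCons coeffs_in_0)
  moreover have "pCons c f = q' * h + r'"
    by (simp add: q'_def r'_def qr(3) algebra_simps)
  moreover have "Polynomial.degree r' < n"
  proof -
    have "Polynomial.degree (pCons c r) \<le> n" using qr(4) n_def by (simp add: Suc_le_eq)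
    then have "Polynomial.degree r' \<le> n"
      unfolding r'_def n_def by (intro degree_diff_le) (auto simp: n_def intro: order.trans[OF degree_smult_le])
    moreover have "poly.coeff r' n = 0" using h(2) by (simp add: r'_def n_def)
    ultimately show ?thesis using h(3) n_def
      by (metis degree_0 leading_coeff_0_iff le_neq_implies_less)
  qed
  ultimately show ?case unfolding n_def by blast
qed

lemma prod_mset_power_const:
  fixes f :: "'b \<Rightarrow> 'a::comm_monoid_mult"
  assumes "\<And>x. x \<in># A \<Longrightarrow> f x ^ n = w"
  shows "(\<Prod>x\<in>#A. f x) ^ n = w ^ size A"
  using assms by (induction A) (simp_all add: power_mult_distrib)

section \<open>Roots of unity and Kummer theory inside the closure\<close>

locale root_of_unity =
  fixes p :: nat and \<zeta> :: "'k::field"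
  assumes prime_p: "Factorial_Ring.prime p"
    and char_p: "CHAR('k) \<noteq> p"
    and prim: "primitive_root_of_unity p \<zeta>"
begin

lemma of_nat_p [simp]: "(of_nat p :: 'k alg_closure) \<noteq> 0"
proof
  assume "(of_nat p :: 'k alg_closure) = 0"
  then have "CHAR('k) dvd p" by (simp add: of_nat_eq_0_iff_char_dvd)
  with prime_p[unfolded prime_nat_iff] have "CHAR('k) = 1 \<or> CHAR('k) = p" by blast
  then show False using char_p by simp
qed

abbreviation Z :: "'k alg_closure" where "Z \<equiv> to_ac \<zeta>"

lemma p_gt_1: "p > 1" and p_pos [simp]: "p > 0"
  using prime_p prime_gt_1_nat[of p] by auto

lemma zeta_p: "\<zeta> ^ p = 1"
  using prim by (simp add: primitive_root_of_unity_def)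

lemma Z_p [simp]: "Z ^ p = 1"
  using zeta_p by (simp flip: to_ac_power)

lemma zeta_nz [simp]: "\<zeta> \<noteq> 0"
  using zeta_p p_pos by (metis power_0_left zero_neq_one not_less0)

lemma zeta_mod: "\<zeta> ^ (n mod p) = \<zeta> ^ n"
proof -
  have "\<zeta> ^ n = \<zeta> ^ (p * (n div p) + n mod p)" by simp
  also have "\<dots> = \<zeta> ^ (n mod p)" by (simp only: power_add power_mult zeta_p) simp
  finally show ?thesis by simp
qed

lemma zeta_pow_eq_1_iff: "\<zeta> ^ n = 1 \<longleftrightarrow> p dvd n"
proof
  assume "\<zeta> ^ n = 1"
  then have "\<zeta> ^ (n mod p) = 1" by (simp add: zeta_mod)
  moreover have "n mod p < p" by simp
  ultimately have "n mod p = 0" using prim unfolding primitive_root_of_unity_def by (metis gr0I)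
  then show "p dvd n" by auto
qed (auto simp: power_mult zeta_p)

lemma Z_mod: "Z ^ (n mod p) = Z ^ n"
  using zeta_mod[of n] by (metis to_ac_power)

lemma Z_pow_eq_1_iff: "Z ^ n = 1 \<longleftrightarrow> p dvd n"
  using zeta_pow_eq_1_iff by (metis to_ac_power to_ac_eq_1_iff)

lemma zeta_inj: "inj_on (\<lambda>i. \<zeta> ^ i) {..<p}"
proof -
  have *: False if "\<zeta> ^ i = \<zeta> ^ j" "i < j" "j < p" for i j
  proof -
    have "\<zeta> ^ j = \<zeta> ^ i * \<zeta> ^ (j - i)" using that by (metis le_add_diff_inverse less_imp_le power_add)
    then have "\<zeta> ^ (j - i) = 1" using that by simp
    then show False using that by (auto simp: zeta_pow_eq_1_iff dest: dvd_imp_le)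
  qed
  show ?thesis
    by (rule inj_onI) (metis * lessThan_iff linorder_neqE_nat)
qed

lemma Z_inj: "inj_on (\<lambda>i. Z ^ i) {..<p}"
  using zeta_inj by (simp add: inj_on_def flip: to_ac_power)

lemma Z_pow_p: "(Z ^ i) ^ p = 1"
  by (metis Z_p mult.commute power_mult power_one)

text \<open>The p distinct powers of \<zeta> exhaust the roots that the degree of X^p - 1
  permits.\<close>

lemma root_of_unity_power:
  assumes "x ^ p = (1 :: 'k alg_closure)" obtains i where "i < p" "x = Z ^ i"
proof -
  let ?f = "Polynomial.monom 1 p - 1 :: 'k alg_closure poly"
  have f: "?f \<noteq> 0" using p_gt_1
    by (metis Polynomial.degree_1 degree_monom_eq eq_iff_diff_eq_0 less_numeral_extra(3) p_pos zero_neq_one)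
  have "Polynomial.degree ?f \<le> p"
    by (intro degree_diff_le) (auto simp: degree_monom_le)
  then have card: "card {x. poly ?f x = 0} \<le> p" and fin: "finite {x. poly ?f x = 0}"
    using card_poly_roots_bound[OF f] poly_roots_finite[OF f] by auto
  have sub: "(\<lambda>i. Z ^ i) ` {..<p} \<subseteq> {x. poly ?f x = 0}"
    by (auto simp: poly_monom Z_pow_p)
  have "(\<lambda>i. Z ^ i) ` {..<p} = {x. poly ?f x = 0}"
    using card_subset_eq[OF fin sub] card card_mono[OF fin sub] card_image[OF Z_inj] by simp
  moreover have "poly ?f x = 0" using assms by (simp add: poly_monom)
  ultimately show ?thesis using that by auto
qed

lemma root_ratio:
  assumes "x ^ p = (y :: 'k alg_closure) ^ p" obtains i where "i < p" "x = Z ^ i * y"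
proof (cases "y = 0")
  case True
  then show ?thesis using assms that[of 0] p_pos by (simp add: power_0_left)
next
  case False
  then have "(x / y) ^ p = 1" using assms by (simp add: power_divide)
  then obtain i where "i < p" "x / y = Z ^ i" using root_of_unity_power by blast
  then show ?thesis using that False by (metis nonzero_eq_divide_eq)
qed

lemma Z_sum: "(\<Sum>j<p. Z ^ (i * j)) = (if p dvd i then of_nat p else 0)"
proof (cases "p dvd i")
  case True
  then have "Z ^ (i * j) = 1" for j by (simp add: Z_pow_eq_1_iff)
  then show ?thesis using True by simp
next
  case False
  then have "Z ^ i \<noteq> 1" by (simp add: Z_pow_eq_1_iff)
  moreover have "(1 - Z ^ i) * (\<Sum>j<p. (Z ^ i) ^ j) = 1 - (Z ^ i) ^ p"
    by (metis one_diff_power_eq)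
  moreover have "(Z ^ i) ^ p = 1" by (metis Z_p mult.commute power_mult power_one)
  ultimately have "(\<Sum>j<p. (Z ^ i) ^ j) = 0" by auto
  then show ?thesis using False by (simp add: power_mult)
qed

text \<open>Irreducibility of X^p - z^p over \<open>K\<close>, in the form used throughout. A monic
  relation \<open>h\<close> of least degree d divides X^p - z^p, so its roots are z times powers of
  \<zeta> and its constant term is (-z)^d up to such a power. As d is prime to p, the elements
  (-z)^d and (-z)^p of \<open>K\<close> generate -z.\<close>

lemma kummer_degree:
  fixes z :: "'k alg_closure"
  assumes K: "subalg K" and zp: "z ^ p \<in> K" and z: "z \<notin> K"
    and f: "coeffs_in K f" "poly f z = 0" "Polynomial.degree f < p"
  shows "f = 0"
proof (rule ccontr)
  assume "f \<noteq> 0"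
  define P where "P g \<longleftrightarrow> g \<noteq> 0 \<and> coeffs_in K g \<and> poly g z = 0" for g
  have "P f" using \<open>f \<noteq> 0\<close> f by (simp add: P_def)
  then obtain g where g: "P g" and gmin: "\<And>h. P h \<Longrightarrow> Polynomial.degree g \<le> Polynomial.degree h"
    using ex_has_least_nat[of P f Polynomial.degree] by blast
  define h where "h = Polynomial.smult (inverse (lead_coeff g)) g"
  have h: "P h" "lead_coeff h = 1" "Polynomial.degree h = Polynomial.degree g"
    using g K by (auto simp: h_def P_def coeffs_in_def subalg_mult subalg_inverse)
  have hd: "Polynomial.degree h < p" using gmin[OF \<open>P f\<close>] h(3) f(3) by simp
  have hpos: "Polynomial.degree h > 0"
  proof (rule ccontr)
    assume "\<not> ?thesis"
    then have "Polynomial.degree h = 0" by simp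
    then obtain c where "h = [:c:]" by (rule degree_eq_zeroE)
    then show False using h(1) by (auto simp: P_def)
  qed
  define F where "F = Polynomial.monom 1 p - [:z ^ p:]"
  have "coeffs_in K F" unfolding F_def using K zp
    by (intro coeffs_in_diff coeffs_in_monom) (auto simp: coeffs_in_pCons coeffs_in_0)
  then obtain q r where qr: "coeffs_in K q" "coeffs_in K r" "F = q * h + r"
      "Polynomial.degree r < Polynomial.degree h"
    using division_coeffs_in[OF K _ h(2) hpos] h(1) unfolding P_def by blast
  have "poly F z = 0" by (simp add: F_def poly_monom)
  then have "poly r z = 0" using qr(3) h(1) by (simp add: P_def)
  then have "r = 0" using gmin[of r] qr h(3) by (auto simp: P_def)
  then have F: "F = q * h" using qr by simp
  obtain A where A: "size A = Polynomial.degree h" "h = Polynomial.smult (lead_coeff h) (\<Prod>x\<in>#A. [:-x, 1:])"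
    using alg_closed_imp_factorization[of h] h(1) P_def by blast
  have root: "x ^ p = z ^ p" if xA: "x \<in># A" for x
  proof -
    obtain B where "A = add_mset x B" using multi_member_split[OF xA] by blast
    then have "h = [:-x, 1:] * (\<Prod>x\<in>#B. [:-x, 1:])"
      using A(2) unfolding h(2) by simp
    then have "poly h x = 0" by simp
    then have "poly F x = 0" by (simp add: F)
    then show ?thesis by (simp add: F_def poly_monom)
  qed
  define d where "d = Polynomial.degree h"
  \<comment> \<open>\<open>c\<close> is the constant coefficient of \<open>h\<close>; using -x and
    -z in place of x and z avoids keeping track of signs.\<close>
  define c where "c = (\<Prod>x\<in>#A. - x)"
  have "h = (\<Prod>x\<in>#A. [:-x, 1:])" using A(2) unfolding h(2) by simp
  then have "c = poly h 0"
    unfolding c_def by (simp add: poly_prod_mset image_mset.compositionality o_def)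
  then have cK: "c \<in> K" using h(1) by (simp add: P_def coeffs_in_def poly_0_coeff_0)
  have "(- x) ^ p = (- z) ^ p" if "x \<in># A" for x
    using root[OF that] by (subst (1 2) power_minus) simp
  then have "c ^ p = ((- z) ^ p) ^ d"
    unfolding c_def d_def A(1)[symmetric] by (rule prod_mset_power_const)
  also have "\<dots> = ((- z) ^ d) ^ p"
    by (simp add: mult.commute flip: power_mult)
  finally have cd: "c ^ p = ((- z) ^ d) ^ p" .
  then obtain i where "c = Z ^ i * (- z) ^ d" using root_ratio by blast
  then have "(- z) ^ d = c / Z ^ i" by simp
  then have 1: "(- z) ^ d \<in> K" using K cK by (simp add: subalg_divide flip: to_ac_power)
  have 2: "(- z) ^ p \<in> K"
    using K zp by (simp add: power_minus[of z] subalg_mult subalg_power subalg_uminus)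
  have "coprime d p"
    using hd hpos prime_p unfolding d_def
    by (intro prime_imp_coprime[THEN coprime_commute[THEN iffD1]]) (auto dest: dvd_imp_le)
  then have "coprime (int d) (int p)" by simp
  then obtain u v where uv: "u * int d + v * int p = 1"
    using bezout_int[of "int d" "int p"] by auto
  have znz: "- z \<noteq> 0" using z K by auto
  have "- z = (- z) powi (int d * u + int p * v)" using uv by (simp add: mult.commute)
  also have "\<dots> = ((- z) ^ d) powi u * ((- z) ^ p) powi v"
    using znz by (subst power_int_add) (simp_all add: power_int_mult power_int_of_nat)
  finally have "- z = ((- z) ^ d) powi u * ((- z) ^ p) powi v" .
  moreover have "((- z) ^ d) powi u * ((- z) ^ p) powi v \<in> K"
    using K 1 2 by (intro subalg_mult subalg_power_int)
  ultimately have "- z \<in> K" by (rule ssubst)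
  then show False using z subalg_uminus[OF K, of "- z"] by simp
qed

end

section \<open>Embeddings over the base field\<close>

context
  fixes K :: "'k::field alg_closure set" and \<phi> :: "'k alg_closure \<Rightarrow> 'k alg_closure"
  assumes K: "subalg K" and emb: "embedding K \<phi>"
begin

lemma embedding_to_ac [simp]: "\<phi> (to_ac c) = to_ac c"
  using emb by (simp add: embedding_def)

lemma embedding_0: "\<phi> 0 = 0" and embedding_1: "\<phi> 1 = 1"
  using embedding_to_ac[of 0] embedding_to_ac[of 1] by simp_all

lemma embedding_add: "x \<in> K \<Longrightarrow> y \<in> K \<Longrightarrow> \<phi> (x + y) = \<phi> x + \<phi> y"
  using emb by (simp add: embedding_def)

lemma embedding_mult: "x \<in> K \<Longrightarrow> y \<in> K \<Longrightarrow> \<phi> (x * y) = \<phi> x * \<phi> y"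
  using emb by (simp add: embedding_def)

lemma embedding_diff: "x \<in> K \<Longrightarrow> y \<in> K \<Longrightarrow> \<phi> (x - y) = \<phi> x - \<phi> y"
  using embedding_add[of "x - y" y] K by (simp add: subalg_diff)

lemma embedding_power: "x \<in> K \<Longrightarrow> \<phi> (x ^ n) = \<phi> x ^ n"
  by (induction n) (simp_all add: embedding_1 embedding_mult subalg_power K)

lemma embedding_prod: "(\<And>i. i \<in> I \<Longrightarrow> f i \<in> K) \<Longrightarrow> \<phi> (prod f I) = (\<Prod>i\<in>I. \<phi> (f i))"
  by (induction I rule: infinite_finite_induct)
    (simp_all add: embedding_1 embedding_mult subalg_prod K)

lemma embedding_sum: "(\<And>i. i \<in> I \<Longrightarrow> f i \<in> K) \<Longrightarrow> \<phi> (sum f I) = (\<Sum>i\<in>I. \<phi> (f i))"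
  by (induction I rule: infinite_finite_induct)
    (simp_all add: embedding_0 embedding_add subalg_sum K)

lemma embedding_inverse: "x \<in> K \<Longrightarrow> \<phi> (inverse x) = inverse (\<phi> x)"
proof (cases "x = 0")
  assume x: "x \<in> K" "x \<noteq> 0"
  have "\<phi> x * \<phi> (inverse x) = 1"
    using embedding_mult[of x "inverse x"] x K embedding_1 by (simp add: subalg_inverse)
  then show ?thesis by (rule inverse_unique[symmetric])
qed (simp add: embedding_0)

lemma embedding_divide: "x \<in> K \<Longrightarrow> y \<in> K \<Longrightarrow> \<phi> (x / y) = \<phi> x / \<phi> y"
  by (simp add: field_class.field_divide_inverse embedding_mult embedding_inverse subalg_inverse K)

lemma embedding_eq_0_iff: "x \<in> K \<Longrightarrow> \<phi> x = 0 \<longleftrightarrow> x = 0"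
  by (metis K embedding_0 embedding_1 embedding_mult mult_zero_left right_inverse subalg_inverse zero_neq_one)

lemma embedding_inj_on: "inj_on \<phi> K"
  by (rule inj_onI) (metis K embedding_diff embedding_eq_0_iff eq_iff_diff_eq_0 subalg_diff)

lemma map_poly_embedding_add:
  "coeffs_in K f \<Longrightarrow> coeffs_in K g \<Longrightarrow> map_poly \<phi> (f + g) = map_poly \<phi> f + map_poly \<phi> g"
  by (rule poly_eqI) (simp add: coeff_map_poly embedding_0 coeffs_in_def embedding_add)

lemma map_poly_embedding_diff:
  "coeffs_in K f \<Longrightarrow> coeffs_in K g \<Longrightarrow> map_poly \<phi> (f - g) = map_poly \<phi> f - map_poly \<phi> g"
  by (rule poly_eqI) (simp add: coeff_map_poly embedding_0 coeffs_in_def embedding_diff)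

lemma map_poly_embedding_mult:
  "coeffs_in K f \<Longrightarrow> coeffs_in K g \<Longrightarrow> map_poly \<phi> (f * g) = map_poly \<phi> f * map_poly \<phi> g"
  by (rule poly_eqI)
    (simp add: coeff_map_poly embedding_0 coeffs_in_def coeff_mult embedding_sum embedding_mult subalg_mult K)

lemma embedding_poly:
  assumes "coeffs_in K f" "z \<in> K"
  shows "\<phi> (poly f z) = poly (map_poly \<phi> f) (\<phi> z)"
  using assms(1)
  by (induction f)
    (use assms(2) in \<open>simp_all add: embedding_0 coeffs_in_pCons map_poly_pCons embedding_add embedding_mult K subalg_mult subalg_poly\<close>)

lemma embedding_poly_to_ac:
  "z \<in> K \<Longrightarrow> \<phi> (poly (map_poly to_ac f) z) = poly (map_poly to_ac f) (\<phi> z)"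
  by (subst embedding_poly) (simp_all add: coeffs_in_to_ac K map_poly_map_poly embedding_0 o_def)

end

lemma embedding_subset: "embedding L \<phi> \<Longrightarrow> K \<subseteq> L \<Longrightarrow> embedding K \<phi>"
  by (auto simp: embedding_def)

lemma embedding_comp:
  "embedding K \<phi> \<Longrightarrow> \<phi> ` K \<subseteq> L \<Longrightarrow> embedding L \<psi> \<Longrightarrow> embedding K (\<psi> \<circ> \<phi>)"
  by (auto simp: embedding_def image_subset_iff)

lemma embedding_id: "embedding K id" "embedding K (\<lambda>x. x)"
  by (auto simp: embedding_def)

lemma embedding_funpow:
  assumes "embedding K \<phi>" "\<phi> ` K \<subseteq> K"
  shows "embedding K (\<phi> ^^ n)" "(\<phi> ^^ n) ` K \<subseteq> K"
proof -
  have "embedding K (\<phi> ^^ n) \<and> (\<phi> ^^ n) ` K \<subseteq> K"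
  proof (induction n)
    case 0 show ?case by (simp add: embedding_id)
  next
    case (Suc n)
    then have "embedding K (\<phi> \<circ> (\<phi> ^^ n))" using assms(1) by (intro embedding_comp) auto
    then show ?case using Suc assms(2) by (auto simp: image_subset_iff o_def)
  qed
  then show "embedding K (\<phi> ^^ n)" "(\<phi> ^^ n) ` K \<subseteq> K" by auto
qed

text \<open>
  If \<open>\<phi> w = c u w\<close> with \<open>u\<close> fixed by \<open>\<phi>\<close>, then iterating gives \<open>\<phi>\<^sup>n w\<close> as \<open>u\<^sup>n w\<close> times a partial norm of \<open>c\<close>.
\<close>

lemma embedding_cocycle:
  assumes K: "subalg K" and \<phi>: "embedding K \<phi>" "\<phi> ` K \<subseteq> K"
    and K': "c \<in> K" "u \<in> K" "w \<in> K" and u: "\<phi> u = u" and w: "\<phi> w = c * u * w"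
  shows "(\<phi> ^^ n) w = (\<Prod>i<n. (\<phi> ^^ i) c) * u ^ n * w"
proof (induction n)
  case (Suc n)
  have c: "(\<phi> ^^ i) c \<in> K" for i using embedding_funpow(2)[OF \<phi>] K' by blast
  have "(\<phi> ^^ Suc n) w = \<phi> ((\<Prod>i<n. (\<phi> ^^ i) c) * u ^ n * w)" by (simp add: Suc)
  also have "\<dots> = (\<Prod>i<n. (\<phi> ^^ Suc i) c) * u ^ n * (c * u * w)"
    using K K' c by (simp add: embedding_mult[OF K \<phi>(1)] embedding_prod[OF K \<phi>(1)]
        embedding_power[OF K \<phi>(1)] subalg_mult subalg_prod subalg_power u w)
  also have "\<dots> = (\<Prod>i<Suc n. (\<phi> ^^ i) c) * u ^ Suc n * w"
    by (simp add: prod.lessThan_Suc_shift mult_ac del: prod.lessThan_Suc)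
  finally show ?case .
qed simp

lemma adjoin_superset: "subalg K \<Longrightarrow> K \<subseteq> adjoin K z"
  using adjoin_subset by blast

lemma embedding_adjoin_eq:
  assumes K: "subalg K" and \<phi>: "embedding (adjoin K z) \<phi>" and \<psi>: "embedding (adjoin K z) \<psi>"
    and eq: "\<And>x. x \<in> K \<Longrightarrow> \<phi> x = \<psi> x" "\<phi> z = \<psi> z" and x: "x \<in> adjoin K z"
  shows "\<phi> x = \<psi> x"
proof -
  obtain f where f: "coeffs_in K f" "x = poly f z" using x by (auto simp: adjoin_def)
  have f': "coeffs_in (adjoin K z) f" using f(1) adjoin_subset[OF K] by (auto simp: coeffs_in_def)
  note S = subalg_adjoin[OF K, of z]
  have "map_poly \<phi> f = map_poly \<psi> f"
    using f(1) eq by (intro poly_eqI) (simp add: coeff_map_poly coeffs_in_def embedding_0[OF S \<phi>] embedding_0[OF S \<psi>])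
  then show ?thesis
    using embedding_poly[OF S \<phi> f' adjoin_gen[OF K]] embedding_poly[OF S \<psi> f' adjoin_gen[OF K]] f(2) eq(2)
    by simp
qed

lemma embedding_adjoin_image:
  assumes K: "subalg K" and \<phi>: "embedding (adjoin K z) \<phi>"
    and L: "subalg L" "\<phi> ` K \<subseteq> L" "\<phi> z \<in> L"
  shows "\<phi> ` adjoin K z \<subseteq> L"
proof (rule image_subsetI)
  fix x assume "x \<in> adjoin K z"
  then obtain f where f: "coeffs_in K f" "x = poly f z" by (auto simp: adjoin_def)
  have f': "coeffs_in (adjoin K z) f" using f(1) adjoin_subset[OF K] by (auto simp: coeffs_in_def)
  note S = subalg_adjoin[OF K, of z]
  have "coeffs_in L (map_poly \<phi> f)"
    using f(1) L(2) by (auto simp: coeffs_in_def coeff_map_poly embedding_0[OF S \<phi>])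
  then show "\<phi> x \<in> L"
    unfolding f(2) embedding_poly[OF S \<phi> f' adjoin_gen[OF K]] using L by (intro subalg_poly)
qed

context root_of_unity
begin

text \<open>Replacing z by z' in polynomial expressions is well defined: by
  \<open>kummer_degree\<close> a polynomial over \<open>K\<close> that vanishes at z is a multiple
  of X^p - z^p, and applying \<phi> to its coefficients gives a polynomial that vanishes at
  z'.\<close>

lemma embedding_extend:
  fixes z :: "'k alg_closure"
  assumes K: "subalg K" and \<phi>: "embedding K \<phi>"
    and zp: "z ^ p \<in> K" and z: "z \<notin> K" and z': "z' ^ p = \<phi> (z ^ p)"
  shows "\<exists>\<psi>. embedding (adjoin K z) \<psi> \<and> (\<forall>x\<in>K. \<psi> x = \<phi> x) \<and> \<psi> z = z'"
proof -
  define F where "F = Polynomial.monom 1 p - [:z ^ p:]"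
  have F: "coeffs_in K F" unfolding F_def using K zp
    by (intro coeffs_in_diff coeffs_in_monom) (auto simp: coeffs_in_pCons coeffs_in_0)
  have dF: "Polynomial.degree F = p"
    using degree_add_eq_left[of "[:- (z ^ p):]" "Polynomial.monom 1 p"] p_pos
    by (simp add: F_def degree_monom_eq diff_conv_add_uminus del: add_uminus_conv_diff)
  have lF: "lead_coeff F = 1" unfolding dF using p_pos by (simp add: F_def coeff_pCons split: nat.splits)
  have 0: "poly (map_poly \<phi> f) z' = 0" if f: "coeffs_in K f" "poly f z = 0" for f
  proof -
    obtain q r where qr: "coeffs_in K q" "coeffs_in K r" "f = q * F + r" "Polynomial.degree r < p"
      using division_coeffs_in[OF K F lF _ f(1)] p_pos unfolding dF by blast
    have "poly r z = 0" using f(2) qr(3) by (simp add: F_def poly_monom)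
    then have "r = 0" using kummer_degree[OF K zp z] qr by blast
    then have "map_poly \<phi> f = map_poly \<phi> q * map_poly \<phi> F"
      using map_poly_embedding_mult[OF K \<phi>] qr F by simp
    moreover have "map_poly \<phi> F = Polynomial.monom 1 p - [:\<phi> (z ^ p):]"
      unfolding F_def using K zp
      by (subst map_poly_embedding_diff[OF K \<phi>])
        (auto simp: coeffs_in_pCons coeffs_in_0 coeffs_in_monom map_poly_monom map_poly_pCons embedding_0[OF K \<phi>] embedding_1[OF K \<phi>])
    ultimately show ?thesis by (simp add: poly_monom z')
  qed
  \<comment> \<open>A representing polynomial is chosen arbitrarily; the fact \<open>0\<close> makes
    the value independent of the choice.\<close>
  define ch where "ch x = (SOME f. coeffs_in K f \<and> poly f z = x)" for x
  define \<psi> where "\<psi> x = poly (map_poly \<phi> (ch x)) z'" for x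
  have \<psi>: "\<psi> (poly f z) = poly (map_poly \<phi> f) z'" if f: "coeffs_in K f" for f
  proof -
    have c: "coeffs_in K (ch (poly f z)) \<and> poly (ch (poly f z)) z = poly f z"
      unfolding ch_def by (rule someI[of _ f]) (simp add: f)
    then have "poly (map_poly \<phi> (ch (poly f z) - f)) z' = 0"
      using f K by (intro 0) (auto intro: coeffs_in_diff)
    then show ?thesis unfolding \<psi>_def using map_poly_embedding_diff[OF K \<phi>] c f by simp
  qed
  have \<psi>K: "\<psi> x = \<phi> x" if "x \<in> K" for x
    using \<psi>[of "[:x:]"] that K
    by (simp add: coeffs_in_pCons coeffs_in_0 map_poly_pCons embedding_0[OF K \<phi>])
  have "\<psi> z = z'"
    using \<psi>[of "[:0, 1:]"] K
    by (simp add: coeffs_in_pCons coeffs_in_0 map_poly_pCons embedding_0[OF K \<phi>] embedding_1[OF K \<phi>])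
  moreover have "embedding (adjoin K z) \<psi>"
    unfolding embedding_def
  proof (intro conjI ballI allI)
    show "\<psi> (to_ac c) = to_ac c" for c using \<psi>K[of "to_ac c"] K \<phi> by (simp add: embedding_def)
    fix x y assume "x \<in> adjoin K z" "y \<in> adjoin K z"
    then obtain f g where fg: "coeffs_in K f" "coeffs_in K g" "x = poly f z" "y = poly g z"
      by (auto simp: adjoin_def)
    show "\<psi> (x + y) = \<psi> x + \<psi> y"
      using \<psi>[of "f + g"] fg K \<psi>[of f] \<psi>[of g] by (simp add: coeffs_in_add map_poly_embedding_add[OF K \<phi>])
    show "\<psi> (x * y) = \<psi> x * \<psi> y"
      using \<psi>[of "f * g"] fg K \<psi>[of f] \<psi>[of g] by (simp add: coeffs_in_mult map_poly_embedding_mult[OF K \<phi>])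
  qed
  ultimately show ?thesis using \<psi>K by blast
qed

text \<open>A fixed element f(z) equals every f(Z^j z) and, p being invertible, their mean.
  Averaging annihilates the terms of f whose exponent is not a multiple of p, and the others are
  powers of z^p times elements of \<open>K\<close>.\<close>

lemma kummer_fixed:
  assumes K: "subalg K" and \<phi>: "embedding (adjoin K z) \<phi>"
    and id: "\<And>x. x \<in> K \<Longrightarrow> \<phi> x = x" and \<phi>z: "\<phi> z = Z * z" and zp: "z ^ p \<in> K"
    and x: "x \<in> adjoin K z" "\<phi> x = x"
  shows "x \<in> K"
proof -
  note S = subalg_adjoin[OF K, of z]
  obtain f where f: "coeffs_in K f" "x = poly f z" using x by (auto simp: adjoin_def)
  have f': "coeffs_in (adjoin K z) f" using f(1) adjoin_subset[OF K] by (auto simp: coeffs_in_def)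
  have mf: "map_poly \<phi> f = f"
    using f(1) by (intro poly_eqI) (simp add: coeff_map_poly coeffs_in_def embedding_0[OF S \<phi>] id)
  have xj: "x = poly f (Z ^ j * z)" for j
  proof (induction j)
    case (Suc j)
    have Zj: "Z ^ j \<in> adjoin K z" using S by (intro subalg_power subalg_to_ac)
    have "\<phi> x = poly f (\<phi> (Z ^ j * z))"
      unfolding Suc using embedding_poly[OF S \<phi> f', of "Z ^ j * z"] mf S Zj adjoin_gen[OF K]
      by (simp add: subalg_mult)
    also have "\<phi> (Z ^ j * z) = Z ^ Suc j * z"
      using embedding_mult[OF S \<phi> Zj adjoin_gen[OF K]] embedding_to_ac[OF S \<phi>, of "\<zeta> ^ j"]
      by (simp add: \<phi>z)
    finally show ?case using x(2) by simp
  qed (simp add: f)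
  have "of_nat p * x = (\<Sum>j<p. poly f (Z ^ j * z))" by (simp flip: xj)
  also have "\<dots> = (\<Sum>j<p. \<Sum>i\<le>Polynomial.degree f. poly.coeff f i * z ^ i * Z ^ (i * j))"
    by (simp add: poly_altdef power_mult_distrib mult_ac flip: power_mult)
  also have "\<dots> = (\<Sum>i\<le>Polynomial.degree f. poly.coeff f i * z ^ i * (\<Sum>j<p. Z ^ (i * j)))"
    by (subst sum.swap) (simp add: sum_distrib_left)
  also have "\<dots> \<in> K"
  proof (intro subalg_sum[OF K])
    fix i
    show "poly.coeff f i * z ^ i * (\<Sum>j<p. Z ^ (i * j)) \<in> K"
    proof (cases "p dvd i")
      case True
      then obtain m where "i = p * m" by auto
      then have "z ^ i \<in> K" using zp K by (simp add: power_mult subalg_power)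
      then show ?thesis
        using f(1) K by (auto simp: Z_sum coeffs_in_def intro!: subalg_mult)
          (metis subalg_to_ac to_ac_of_nat)
    qed (use K in \<open>auto simp: Z_sum\<close>)
  qed
  finally have "of_nat p * x / of_nat p \<in> K"
    using K by (intro subalg_divide) (auto simp flip: to_ac_of_nat)
  then show ?thesis by simp
qed

end

section \<open>Split cyclic algebras and norms\<close>

text \<open>Gaussian elimination, one equation per step. It serves as the dimension argument of the
  development: more vectors than coordinates are dependent.\<close>

lemma underdetermined_system:
  fixes M :: "'i \<Rightarrow> 'j \<Rightarrow> 'a::field"
  assumes "finite J" "finite I" "card J < card I"
  shows "\<exists>c. (\<exists>i\<in>I. c i \<noteq> 0) \<and> (\<forall>j\<in>J. (\<Sum>i\<in>I. c i * M i j) = 0)"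
  using assms
proof (induction J arbitrary: I M rule: finite_induct)
  case empty
  then have "I \<noteq> {}" by auto
  then show ?case by (intro exI[of _ "\<lambda>_. 1"]) auto
next
  case (insert j0 J)
  show ?case
  proof (cases "\<forall>i\<in>I. M i j0 = 0")
    case True
    have "card J < card I" using insert by simp
    from insert.IH[OF insert.prems(1) this, of M] True show ?thesis by auto
  next
    case False
    then obtain i0 where i0: "i0 \<in> I" "M i0 j0 \<noteq> 0" by auto
    define I' where "I' = I - {i0}"
    have fin: "finite I'" and I: "I = insert i0 I'" "i0 \<notin> I'" using insert.prems i0 by (auto simp: I'_def)
    have "card J < card I'" using insert I fin by simp
    then obtain c where c: "\<exists>i\<in>I'. c i \<noteq> 0"
      "\<And>j. j \<in> J \<Longrightarrow> (\<Sum>i\<in>I'. c i * (M i j - M i j0 / M i0 j0 * M i0 j)) = 0"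
      using insert.IH[OF fin, of "\<lambda>i j. M i j - M i j0 / M i0 j0 * M i0 j"] by auto
    \<comment> \<open>The solution of the reduced system is completed at the pivot \<open>i0\<close>
      so that the eliminated equation holds as well.\<close>
    define d where "d = c(i0 := - (\<Sum>i\<in>I'. c i * M i j0) / M i0 j0)"
    have sumd: "(\<Sum>i\<in>I. d i * M i j) = d i0 * M i0 j + (\<Sum>i\<in>I'. c i * M i j)" for j
    proof -
      have "(\<Sum>i\<in>I'. d i * M i j) = (\<Sum>i\<in>I'. c i * M i j)"
        using I by (intro sum.cong) (auto simp: d_def)
      then show ?thesis using I fin by simp
    qed
    have "(\<Sum>i\<in>I. d i * M i j0) = 0" unfolding sumd using i0 by (simp add: d_def)
    moreover have "(\<Sum>i\<in>I. d i * M i j) = 0" if "j \<in> J" for j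
      using c(2)[OF that] unfolding sumd
      by (simp add: d_def algebra_simps sum_subtractf sum_distrib_left sum_distrib_right sum_divide_distrib)
    moreover have "\<exists>i\<in>I. d i \<noteq> 0" using c(1) I by (auto simp: d_def)
    ultimately show ?thesis by (intro exI[of _ d]) auto
  qed
qed

text \<open>The polynomial \<open>f(X) f(cX) \<dots> f(c\<^sup>n\<^sup>-\<^sup>1X)\<close>, which becomes the norm of \<open>f\<close> when \<open>X\<close> is a radical.\<close>

definition twisted_prod :: "'a::field \<Rightarrow> 'a poly \<Rightarrow> nat \<Rightarrow> 'a poly" where
  "twisted_prod c f n = (\<Prod>i<n. f \<circ>\<^sub>p [:0, c ^ i:])"

lemma twisted_prod_Suc: "twisted_prod c f (Suc n) = twisted_prod c f n * (f \<circ>\<^sub>p [:0, c ^ n:])"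
  by (simp add: twisted_prod_def)

text \<open>This recursion fits a new factor arriving from the left, as in
  \<open>twist_power_right\<close>; \<open>twisted_prod_Suc\<close> fits one from the right.\<close>

lemma twisted_prod_Suc': "twisted_prod c f (Suc n) = (twisted_prod c f n \<circ>\<^sub>p [:0, c:]) * f"
proof -
  have "(f \<circ>\<^sub>p [:0, c ^ i:]) \<circ>\<^sub>p [:0, c:] = f \<circ>\<^sub>p [:0, c ^ Suc i:]" for i
    by (simp add: pcompose_assoc pcompose_pCons mult.commute flip: pcompose_assoc)
  then show ?thesis
    unfolding twisted_prod_def
    by (simp add: prod.lessThan_Suc_shift pcompose_prod mult.commute del: prod.lessThan_Suc power_Suc)
qed

lemma poly_map_to_ac_mult:
  "poly (map_poly to_ac (f * g)) z = poly (map_poly to_ac f) z * poly (map_poly to_ac g) z"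
proof -
  have "map_poly to_ac (f * g) = map_poly to_ac f * map_poly to_ac g"
    by (rule poly_eqI) (simp add: coeff_map_poly coeff_mult to_ac_sum)
  then show ?thesis by simp
qed

lemma poly_map_to_ac_diff:
  "poly (map_poly to_ac (f - g)) z = poly (map_poly to_ac f) z - poly (map_poly to_ac g) z"
proof -
  have "map_poly to_ac (f - g) = map_poly to_ac f - map_poly to_ac g"
    by (rule poly_eqI) (simp add: coeff_map_poly)
  then show ?thesis by simp
qed

lemma poly_map_to_ac_twist:
  "poly (map_poly to_ac (f \<circ>\<^sub>p [:0, c:])) z = poly (map_poly to_ac f) (to_ac c * z)"
proof (induction f)
  case (pCons a f)
  have "map_poly to_ac (pCons a f \<circ>\<^sub>p [:0, c:]) =
      [:to_ac a:] + map_poly to_ac ([:0, c:] * (f \<circ>\<^sub>p [:0, c:]))"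
    by (rule poly_eqI) (simp add: pcompose_pCons coeff_map_poly coeff_pCons split: nat.splits)
  then show ?case
    by (simp only: poly_add poly_map_to_ac_mult pCons.IH) (simp add: map_poly_pCons mult_ac)
qed simp

lemma poly_twisted_prod:
  "poly (map_poly to_ac (twisted_prod c f n)) z =
     (\<Prod>i<n. poly (map_poly to_ac f) (to_ac c ^ i * z))"
  by (induction n)
    (simp_all add: twisted_prod_Suc poly_map_to_ac_mult poly_map_to_ac_twist, simp add: twisted_prod_def)

context root_of_unity
begin

text \<open>The remainder of h modulo X^p - a has degree below p and vanishes at z, so it is zero by
  \<open>kummer_degree\<close>. Identities in the field k(z) pass in this way to every algebra
  element whose p-th power is a.\<close>

lemma dvd_of_root:
  assumes a: "\<And>c. c ^ p \<noteq> (a :: 'k)" and z: "z ^ p = to_ac a" and h: "poly (map_poly to_ac h) z = 0"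
  shows "(Polynomial.monom 1 p - [:a:]) dvd h"
proof -
  define F where "F = Polynomial.monom 1 p - [:a:]"
  have dF: "Polynomial.degree F = p"
    using degree_add_eq_left[of "[:- a:]" "Polynomial.monom 1 p"] p_pos
    by (simp add: F_def degree_monom_eq diff_conv_add_uminus del: add_uminus_conv_diff)
  have "poly (map_poly to_ac F) z = 0"
  proof -
    have "map_poly to_ac F = Polynomial.monom 1 p - [:to_ac a:]"
      by (rule poly_eqI) (auto simp: F_def coeff_map_poly coeff_pCons split: nat.splits)
    then show ?thesis by (simp add: poly_monom z)
  qed
  moreover have "map_poly to_ac h = map_poly to_ac (h div F) * map_poly to_ac F + map_poly to_ac (h mod F)"
  proof -
    have "map_poly to_ac (f + g) = map_poly to_ac f + map_poly to_ac g"
      "map_poly to_ac (f * g) = map_poly to_ac f * map_poly to_ac g" for f g :: "'k poly"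
      by (rule poly_eqI; simp add: coeff_map_poly coeff_mult to_ac_sum)+
    then show ?thesis by (metis div_mult_mod_eq)
  qed
  ultimately have "poly (map_poly to_ac (h mod F)) z = 0" using h by simp
  moreover have "Polynomial.degree (map_poly to_ac (h mod F)) < p"
  proof -
    have "Polynomial.degree (h mod F) < p"
      using degree_mod_less[of F h] p_pos dF by (metis degree_0 not_gr_zero)
    then show ?thesis by (subst degree_map_poly) auto
  qed
  moreover have "z \<notin> range to_ac"
    using a z by (auto simp flip: to_ac_power)
  ultimately have "map_poly to_ac (h mod F) = 0"
    using z subalg_base by (intro kummer_degree[of "range to_ac" z]) (auto simp: coeffs_in_def coeff_map_poly)
  then have "h mod F = 0" by (intro poly_eqI) (metis coeff_map_poly to_ac_0 to_ac_eq_0_iff Polynomial.coeff_0)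
  then show ?thesis unfolding F_def by auto
qed

text \<open>The inverse of f(z) lies in the field k(z) and is therefore a polynomial value;
  \<open>dvd_of_root\<close> turns the identity at z into a congruence.\<close>

lemma inverse_mod_binomial:
  assumes a: "\<And>c. c ^ p \<noteq> (a :: 'k)" and f: "f \<noteq> 0" "Polynomial.degree f < p"
  shows "\<exists>g. (Polynomial.monom 1 p - [:a:]) dvd (f * g - 1)"
proof -
  obtain z :: "'k alg_closure" where z: "z ^ p = to_ac a"
    using nth_root_exists[of p "to_ac a"] p_pos by auto
  let ?R = "range (to_ac :: 'k \<Rightarrow> 'k alg_closure)"
  have nz: "z \<notin> ?R" using a z by (auto simp flip: to_ac_power)
  have m: "map_poly to_ac (f * g - 1) = map_poly to_ac f * map_poly to_ac g - 1" for g :: "'k poly"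
    by (rule poly_eqI) (simp add: coeff_map_poly coeff_mult to_ac_sum coeff_1)
  have "map_poly to_ac f \<noteq> (0 :: 'k alg_closure poly)"
    using f(1) by (metis coeff_map_poly to_ac_0 to_ac_eq_0_iff Polynomial.coeff_0 poly_eqI)
  moreover have dg: "Polynomial.degree (map_poly to_ac f :: 'k alg_closure poly) = Polynomial.degree f"
    by (rule degree_map_poly) simp
  ultimately have fz: "poly (map_poly to_ac f) z \<noteq> 0"
    using kummer_degree[OF subalg_base, of z "map_poly to_ac f"] z nz f(2) dg
    by (auto simp: coeffs_in_def coeff_map_poly)
  have "poly (map_poly to_ac f) z \<in> adjoin ?R z"
    by (intro adjoinI coeffs_in_to_ac subalg_base)
  then have "inverse (poly (map_poly to_ac f) z) \<in> adjoin ?R z"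
    by (intro subalg_inverse subalg_adjoin subalg_base)
  then obtain g' where g': "coeffs_in ?R g'" "inverse (poly (map_poly to_ac f) z) = poly g' z"
    by (auto simp: adjoin_def)
  define g where "g = map_poly of_ac g'"
  have "map_poly to_ac g = g'"
    using g'(1) by (intro poly_eqI) (auto simp: g_def coeff_map_poly coeffs_in_def to_ac_of_ac)
  then have "poly (map_poly to_ac (f * g - 1)) z = 0"
    using g'(2) fz by (simp add: m flip: g'(2))
  with dvd_of_root[OF a z] show ?thesis by blast
qed

end

section \<open>Algebras over k and polynomials in one of their elements\<close>

locale k_algebra = ring A for A :: "('k::field, 'b) module" (structure) +
  assumes smult_closed [simp, intro]: "x \<in> carrier A \<Longrightarrow> c \<odot> x \<in> carrier A"
    and smult_mult_left: "x \<in> carrier A \<Longrightarrow> y \<in> carrier A \<Longrightarrow> (c \<odot> x) \<otimes> y = c \<odot> (x \<otimes> y)"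
    and smult_mult_right: "x \<in> carrier A \<Longrightarrow> y \<in> carrier A \<Longrightarrow> x \<otimes> (c \<odot> y) = c \<odot> (x \<otimes> y)"
    and smult_add_left: "x \<in> carrier A \<Longrightarrow> (c + d) \<odot> x = c \<odot> x \<oplus> d \<odot> x"
    and smult_add_right: "x \<in> carrier A \<Longrightarrow> y \<in> carrier A \<Longrightarrow> c \<odot> (x \<oplus> y) = c \<odot> x \<oplus> c \<odot> y"
    and smult_smult: "x \<in> carrier A \<Longrightarrow> c \<odot> (d \<odot> x) = (c * d) \<odot> x"
    and smult_one [simp]: "x \<in> carrier A \<Longrightarrow> 1 \<odot> x = x"
begin

lemma smult_zero_left [simp]: "x \<in> carrier A \<Longrightarrow> 0 \<odot> x = \<zero>"
  using smult_add_left[of x 0 0] by simp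

lemma smult_zero_right [simp]: "c \<odot> \<zero> = \<zero>"
  using smult_add_right[of \<zero> \<zero> c] by simp

lemma smult_eq_zero: "x \<in> carrier A \<Longrightarrow> c \<odot> x = \<zero> \<Longrightarrow> c = 0 \<or> x = \<zero>"
  using smult_smult[of x "inverse c" c] by (cases "c = 0") auto

lemma smult_cancel: "x \<in> carrier A \<Longrightarrow> x \<noteq> \<zero> \<Longrightarrow> c \<odot> x = d \<odot> x \<Longrightarrow> c = d"
proof -
  assume x: "x \<in> carrier A" "x \<noteq> \<zero>" "c \<odot> x = d \<odot> x"
  have "(c - d) \<odot> x \<oplus> d \<odot> x = \<zero> \<oplus> d \<odot> x" using x by (simp flip: smult_add_left)
  then have "(c - d) \<odot> x = \<zero>" using x by (subst (asm) add.r_cancel) auto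
  then show "c = d" using smult_eq_zero x by force
qed

definition eval_poly :: "'b \<Rightarrow> 'k poly \<Rightarrow> 'b" where
  "eval_poly y f = fold_coeffs (\<lambda>c x. c \<odot> \<one> \<oplus> y \<otimes> x) f \<zero>"

context
  fixes y assumes y [simp]: "y \<in> carrier A"
begin

lemma eval_poly_0 [simp]: "eval_poly y 0 = \<zero>"
  by (simp add: eval_poly_def)

lemma eval_poly_pCons: "eval_poly y (pCons c f) = c \<odot> \<one> \<oplus> y \<otimes> eval_poly y f"
  by (cases "c = 0 \<and> f = 0") (auto simp: eval_poly_def fold_coeffs_pCons_eq)

lemma eval_poly_closed [simp, intro]: "eval_poly y f \<in> carrier A"
  by (induction f) (auto simp: eval_poly_pCons)

lemma eval_poly_1 [simp]: "eval_poly y 1 = \<one>"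
  unfolding one_pCons by (simp add: eval_poly_pCons)

lemma eval_poly_add: "eval_poly y (f + g) = eval_poly y f \<oplus> eval_poly y g"
proof (induction f arbitrary: g)
  case (pCons c f)
  obtain d g' where g: "g = pCons d g'" by (cases g) auto
  show ?case unfolding g by (simp add: eval_poly_pCons pCons smult_add_left r_distr a_ac)
qed simp

lemma eval_poly_smult: "eval_poly y (Polynomial.smult c f) = c \<odot> eval_poly y f"
  by (induction f) (auto simp: eval_poly_pCons smult_add_right smult_smult smult_mult_right)

lemma eval_poly_mult: "eval_poly y (f * g) = eval_poly y f \<otimes> eval_poly y g"
proof (induction f)
  case (pCons c f)
  have "eval_poly y (pCons c f * g) = c \<odot> eval_poly y g \<oplus> y \<otimes> (eval_poly y f \<otimes> eval_poly y g)"
    by (simp add: mult_pCons_left eval_poly_add eval_poly_smult eval_poly_pCons pCons)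
  also have "\<dots> = eval_poly y (pCons c f) \<otimes> eval_poly y g"
    by (simp add: eval_poly_pCons l_distr smult_mult_left m_assoc)
  finally show ?case .
qed simp

lemma eval_poly_commute: "eval_poly y f \<otimes> eval_poly y g = eval_poly y g \<otimes> eval_poly y f"
  by (metis eval_poly_mult mult.commute)

lemma eval_poly_monom: "eval_poly y (Polynomial.monom c n) = c \<odot> (y [^] n)"
proof (induction n)
  case (Suc n)
  have "y \<otimes> y [^] n = y [^] Suc n" by (rule nat_pow_Suc2[symmetric]) simp
  with Suc show ?case by (simp add: monom_Suc eval_poly_pCons smult_mult_right)
qed (simp add: monom_0 eval_poly_pCons)

lemma eval_poly_const: "eval_poly y [:c:] = c \<odot> \<one>"
  by (simp add: eval_poly_pCons)

text \<open>Values at y factor through k[X] / (X^n - a), which for n = p is a copy of k(z) when a is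
  not a p-th power.\<close>

lemma eval_poly_dvd:
  assumes "y [^] n = a \<odot> \<one>" "(Polynomial.monom 1 n - [:a:]) dvd (f - g)"
  shows "eval_poly y f = eval_poly y g"
proof -
  obtain q where "f - g = (Polynomial.monom 1 n - [:a:]) * q" using assms(2) by auto
  then have f: "f = (Polynomial.monom 1 n + [:- a:]) * q + g" by (simp add: algebra_simps)
  have "a \<odot> \<one> \<oplus> (- a) \<odot> \<one> = \<zero>" by (simp flip: smult_add_left)
  then have "eval_poly y (Polynomial.monom 1 n + [:- a:]) = \<zero>"
    by (simp add: eval_poly_add eval_poly_monom eval_poly_const assms(1))
  then show ?thesis unfolding f by (simp only: eval_poly_add eval_poly_mult) simp
qed

lemma eval_poly_twist:
  assumes x: "x \<in> carrier A" and xy: "x \<otimes> y = c \<odot> (y \<otimes> x)"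
  shows "x \<otimes> eval_poly y f = eval_poly y (f \<circ>\<^sub>p [:0, c:]) \<otimes> x"
proof (induction f)
  case (pCons d f)
  have "x \<otimes> eval_poly y (pCons d f) = d \<odot> x \<oplus> (x \<otimes> y) \<otimes> eval_poly y f"
    using x by (simp add: eval_poly_pCons r_distr smult_mult_right m_assoc)
  also have "(x \<otimes> y) \<otimes> eval_poly y f = c \<odot> (y \<otimes> (x \<otimes> eval_poly y f))"
    using x by (simp add: xy smult_mult_left m_assoc)
  also have "d \<odot> x \<oplus> \<dots> = eval_poly y (pCons d f \<circ>\<^sub>p [:0, c:]) \<otimes> x"
    unfolding pCons using x
    by (simp add: pcompose_pCons eval_poly_add eval_poly_mult eval_poly_pCons eval_poly_smult
        l_distr smult_mult_left smult_mult_right m_assoc)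
  finally show ?case .
qed (use x in simp)

end

text \<open>Only products with r are controlled: x acts on r as f(y) does. Moving a further x past a
  polynomial in y replaces X by c X, so the iterates collect the conjugates of f.\<close>

lemma twist_power_right:
  assumes x: "x \<in> carrier A" "y \<in> carrier A" "r \<in> carrier A" and xy: "x \<otimes> y = c \<odot> (y \<otimes> x)"
    and xr: "x \<otimes> r = eval_poly y f \<otimes> r"
  shows "x [^] (n::nat) \<otimes> r = eval_poly y (twisted_prod c f n) \<otimes> r"
proof (induction n)
  case 0
  then show ?case using x by (simp add: twisted_prod_def)
next
  case (Suc n)
  have "x [^] Suc n \<otimes> r = x \<otimes> (x [^] n \<otimes> r)"
    using x by (metis m_assoc nat_pow_Suc2 nat_pow_closed)
  also have "\<dots> = (x \<otimes> eval_poly y (twisted_prod c f n)) \<otimes> r" using x by (simp add: Suc m_assoc)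
  also have "\<dots> = eval_poly y (twisted_prod c f n \<circ>\<^sub>p [:0, c:]) \<otimes> (x \<otimes> r)"
    using x by (simp add: eval_poly_twist[OF x(2) x(1) xy] m_assoc)
  also have "\<dots> = eval_poly y (twisted_prod c f (Suc n)) \<otimes> r"
    using x by (simp add: xr twisted_prod_Suc' eval_poly_mult m_assoc)
  finally show ?case .
qed

text \<open>Used with n = p to build matrices: the p-th power of f(y) x is the norm of f(y) times
  the p-th power of x.\<close>

lemma twist_power_left:
  assumes x: "x \<in> carrier A" "y \<in> carrier A" and xy: "x \<otimes> y = c \<odot> (y \<otimes> x)"
  shows "(eval_poly y f \<otimes> x) [^] (n::nat) = eval_poly y (twisted_prod c f n) \<otimes> x [^] n"
proof (induction n)
  case 0
  then show ?case using x by (simp add: twisted_prod_def)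
next
  case (Suc n)
  have xn: "x [^] n \<otimes> y = (c ^ n) \<odot> (y \<otimes> x [^] n)" for n
  proof (induction n)
    case (Suc n)
    have "x [^] Suc n \<otimes> y = x [^] n \<otimes> (x \<otimes> y)" using x by (simp add: m_assoc)
    also have "\<dots> = c \<odot> ((x [^] n \<otimes> y) \<otimes> x)" using x by (simp add: xy smult_mult_right m_assoc)
    also have "\<dots> = (c ^ Suc n) \<odot> (y \<otimes> x [^] Suc n)"
      unfolding Suc using x by (simp add: smult_mult_left smult_smult m_assoc)
    finally show ?case .
  qed (use x in simp)
  have "(eval_poly y f \<otimes> x) [^] Suc n =
      eval_poly y (twisted_prod c f n) \<otimes> (x [^] n \<otimes> eval_poly y f) \<otimes> x"
    using x by (simp add: Suc m_assoc)
  also have "x [^] n \<otimes> eval_poly y f = eval_poly y (f \<circ>\<^sub>p [:0, c ^ n:]) \<otimes> x [^] n"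
    using x by (intro eval_poly_twist xn) auto
  finally show ?case
    using x by (simp add: twisted_prod_Suc eval_poly_mult m_assoc)
qed

end

lemma (in k_algebra) finsum_coordinate:
  fixes co :: "'b \<Rightarrow> 'c::comm_monoid_add"
  assumes "\<And>x y. x \<in> carrier A \<Longrightarrow> y \<in> carrier A \<Longrightarrow> co (x \<oplus> y) = co x + co y"
    and "co \<zero> = 0" and "finite S" and "F \<in> S \<rightarrow> carrier A"
  shows "co (\<Oplus>i\<in>S. F i) = (\<Sum>i\<in>S. co (F i))"
  using assms(3,4) by (induction S rule: finite_induct) (auto simp: assms(1,2) Pi_iff)

lemma (in k_algebra) eval_poly_sum_monom:
  assumes "y \<in> carrier A"
  shows "eval_poly y (\<Sum>i<n. Polynomial.monom (c i) i) = (\<Oplus>i\<in>{..<n}. c i \<odot> (y [^] i))"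
  using assms by (induction n)
    (simp_all add: eval_poly_add eval_poly_monom lessThan_Suc a_comm finsum_closed Pi_iff)

lemma coeff_sum_monom:
  "poly.coeff (\<Sum>i<n. Polynomial.monom (c i) i) j = (if j < n then c j else 0)"
  by (simp add: coeff_sum if_distrib sum.delta' cong: if_cong)

lemma degree_sum_monom: "n > 0 \<Longrightarrow> Polynomial.degree (\<Sum>i<n. Polynomial.monom (c i) i) < n"
  by (rule le_less_trans[OF degree_le[of "n - 1"]]) (auto simp: coeff_sum_monom)

context root_of_unity
begin

text \<open>
  Over a split algebra, \<open>r\<close> is a rank one element and \<open>A r\<close> is one-dimensional over the field
  generated by \<open>y\<close>: otherwise the \<open>p (p + 1)\<close> elements \<open>y\<^sup>s r y\<^sup>j\<close> and \<open>x r y\<^sup>j\<close> would be independent.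
  So \<open>x r = f(y) r\<close>, and iterating gives \<open>b\<close> as the norm of \<open>f(y)\<close>.
\<close>

lemma norm_of_rank_one:
  fixes A :: "('k, 'b) module" (structure) and co :: "'b \<Rightarrow> 'u \<Rightarrow> 'k"
  assumes A: "k_algebra A" and x: "x \<in> carrier A" and y: "y \<in> carrier A"
    and xy: "x \<otimes> y = \<zeta> \<odot> (y \<otimes> x)" and yp: "y [^] p = a \<odot> \<one>" and xp: "x [^] p = b \<odot> \<one>"
    and a: "\<And>c. c ^ p \<noteq> a" and z: "z ^ p = to_ac a"
    and B: "finite B" "card B \<le> p * p"
    and co_add: "\<And>x y u. x \<in> carrier A \<Longrightarrow> y \<in> carrier A \<Longrightarrow> co (x \<oplus> y) u = co x u + co y u"
    and co_smult: "\<And>c x u. x \<in> carrier A \<Longrightarrow> co (c \<odot> x) u = c * co x u"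
    and co_inj: "\<And>x. x \<in> carrier A \<Longrightarrow> (\<And>u. u \<in> B \<Longrightarrow> co x u = 0) \<Longrightarrow> x = \<zero>"
    and r: "r \<in> carrier A" "r \<noteq> \<zero>" and rr: "r \<otimes> r = d \<odot> r" "d \<noteq> 0"
    and rank: "\<And>x. x \<in> carrier A \<Longrightarrow> \<exists>c. r \<otimes> x \<otimes> r = c \<odot> r"
  shows "\<exists>f. (\<Prod>i<p. poly (map_poly to_ac f) (Z ^ i * z)) = to_ac b"
proof -
  interpret k_algebra A by (rule A)
  let ?e = "eval_poly y"
  note [simp] = x y r(1)
  have inv: "\<exists>g. ?e f \<otimes> ?e g = \<one>" if "f \<noteq> 0" "Polynomial.degree f < p" for f
  proof -
    obtain g where g: "(Polynomial.monom 1 p - [:a:]) dvd (f * g - 1)"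
      using inverse_mod_binomial[OF a \<open>f \<noteq> 0\<close> \<open>Polynomial.degree f < p\<close>] by blast
    have "?e (f * g) = ?e 1" by (rule eval_poly_dvd[OF y yp g])
    then show ?thesis by (auto simp: eval_poly_mult)
  qed
  \<comment> \<open>Nonzero polynomials of degree below p have invertible values at y, so the
    elements y^s r with s < p are independent over k.\<close>
  have kill: "f = 0" if f: "Polynomial.degree f < p" and "?e f \<otimes> r = \<zero>" for f
  proof (rule ccontr)
    assume "f \<noteq> 0"
    then obtain g where "?e f \<otimes> ?e g = \<one>" using inv f by blast
    then have "?e g \<otimes> ?e f = \<one>" by (simp add: eval_poly_commute)
    then have "r = ?e g \<otimes> (?e f \<otimes> r)" by (simp flip: m_assoc)
    with that(2) r show False by simp
  qed
  \<comment> \<open>The rank one condition yields a functional with r v r = l(v) r.\<close>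
  define l where "l v = (SOME c. r \<otimes> v \<otimes> r = c \<odot> r)" for v
  have l: "r \<otimes> v \<otimes> r = l v \<odot> r" if "v \<in> carrier A" for v
    unfolding l_def by (rule someI_ex) (rule rank[OF that])
  have l1: "l \<one> = d" using l[of \<one>] rr smult_cancel[OF r] by simp
  have l0: "l \<zero> = 0" using l[of \<zero>] smult_cancel[OF r, of "l \<zero>" 0] by simp
  \<comment> \<open>The left factors are the powers of y below p and, at the extra index p, the
    element x. With p right factors this makes p (p + 1) elements, more than there are
    coordinates.\<close>
  define W where "W s = (if s < p then y [^] s else x)" for s :: nat
  have W [simp]: "W s \<in> carrier A" for s by (simp add: W_def)
  define E where "E = (\<lambda>(s, j). W s \<otimes> r \<otimes> y [^] (j::nat))"
  have E [simp]: "E i \<in> carrier A" for i by (cases i) (simp add: E_def)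
  let ?I = "{..<Suc p} \<times> {..<p}"
  have "card B < card ?I" using B(2) p_pos by (simp add: card_cartesian_product del: p_pos)
  then obtain c where c: "\<exists>i\<in>?I. c i \<noteq> 0" "\<And>u. u \<in> B \<Longrightarrow> (\<Sum>i\<in>?I. c i * co (E i) u) = 0"
    using underdetermined_system[OF B(1), of ?I "\<lambda>i u. co (E i) u"] by auto
  define f where "f s = (\<Sum>j<p. Polynomial.monom (c (s, j)) j)" for s
  have co0: "co \<zero> u = 0" for u using co_smult[of \<zero> 0 u] by simp
  have co_sum: "co (\<Oplus>i\<in>S. F i) u = (\<Sum>i\<in>S. co (F i) u)"
    if "finite S" "F \<in> S \<rightarrow> carrier A" for S :: "nat set" and F u
    by (rule finsum_coordinate) (use that co_add co0 in auto)
  \<comment> \<open>The linear relation, collected by left factor: for fixed s the coefficients form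
    a polynomial in y to the right of r.\<close>
  define N where "N = (\<Oplus>s\<in>{..<Suc p}. W s \<otimes> r \<otimes> ?e (f s))"
  have "N = \<zero>"
  proof (rule co_inj)
    show "N \<in> carrier A" unfolding N_def by (intro finsum_closed) auto
    fix u assume u: "u \<in> B"
    have 1: "co (W s \<otimes> r \<otimes> ?e (f s)) u = (\<Sum>j<p. c (s, j) * co (E (s, j)) u)" for s
    proof -
      have "W s \<otimes> r \<otimes> ?e (f s) = (\<Oplus>j\<in>{..<p}. c (s, j) \<odot> E (s, j))"
        unfolding f_def eval_poly_sum_monom[OF y]
        by (subst finsum_rdistr) (auto intro!: finsum_cong' simp: E_def smult_mult_right)
      also have "co \<dots> u = (\<Sum>j<p. c (s, j) * co (E (s, j)) u)"
        by (subst co_sum) (auto simp: co_smult)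
      finally show ?thesis .
    qed
    have "co N u = (\<Sum>s<Suc p. \<Sum>j<p. c (s, j) * co (E (s, j)) u)"
      unfolding N_def by (subst co_sum) (auto simp: 1 simp del: sum.lessThan_Suc)
    also have "\<dots> = 0" using c(2)[OF u] by (simp add: sum.cartesian_product)
    finally show "co N u = 0" .
  qed
  \<comment> \<open>Multiplication on the right by v r turns each right factor into a scalar, which
    leaves a relation between the y^s r and x r.\<close>
  have rel: "?e (\<Sum>s<p. Polynomial.monom (l (?e (f s) \<otimes> v)) s) \<otimes> r \<oplus> l (?e (f p) \<otimes> v) \<odot> (x \<otimes> r) = \<zero>"
    if v [simp]: "v \<in> carrier A" for v
  proof -
    define m where "m s = l (?e (f s) \<otimes> v)" for s
    have "\<zero> = N \<otimes> (v \<otimes> r)" using \<open>N = \<zero>\<close> by simp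
    also have "\<dots> = (\<Oplus>s\<in>{..<Suc p}. m s \<odot> (W s \<otimes> r))"
      unfolding N_def
    proof (subst finsum_ldistr)
      show "(\<Oplus>s\<in>{..<Suc p}. W s \<otimes> r \<otimes> ?e (f s) \<otimes> (v \<otimes> r)) = (\<Oplus>s\<in>{..<Suc p}. m s \<odot> (W s \<otimes> r))"
      proof (rule finsum_cong')
        fix s
        have "W s \<otimes> r \<otimes> ?e (f s) \<otimes> (v \<otimes> r) = W s \<otimes> (r \<otimes> (?e (f s) \<otimes> v) \<otimes> r)"
          by (simp add: m_assoc)
        also have "\<dots> = m s \<odot> (W s \<otimes> r)" by (simp add: l m_def smult_mult_right)
        finally show "W s \<otimes> r \<otimes> ?e (f s) \<otimes> (v \<otimes> r) = m s \<odot> (W s \<otimes> r)" .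
      qed auto
    qed auto
    also have "\<dots> = (\<Oplus>s\<in>{..<p}. m s \<odot> (W s \<otimes> r)) \<oplus> m p \<odot> (x \<otimes> r)"
      by (simp add: lessThan_Suc W_def a_comm finsum_closed Pi_iff)
    also have "(\<Oplus>s\<in>{..<p}. m s \<odot> (W s \<otimes> r)) = (\<Oplus>s\<in>{..<p}. (m s \<odot> (y [^] s)) \<otimes> r)"
      by (rule finsum_cong') (auto simp: W_def smult_mult_left)
    also have "\<dots> = ?e (\<Sum>s<p. Polynomial.monom (m s) s) \<otimes> r"
      unfolding eval_poly_sum_monom[OF y] by (subst finsum_ldistr) auto
    finally show ?thesis unfolding m_def by simp
  qed
  have df: "Polynomial.degree (f s) < p" for s unfolding f_def by (rule degree_sum_monom) simp
  \<comment> \<open>If x did not occur, the inverse of some nonzero f_s(y), taken as v, would give a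
    relation between the y^s r with coefficient d at s, against \<open>kill\<close>.\<close>
  have "f p \<noteq> 0"
  proof
    assume fp: "f p = 0"
    obtain s j where sj: "s < Suc p" "j < p" "c (s, j) \<noteq> 0" using c(1) by auto
    then have "poly.coeff (f s) j \<noteq> 0" by (simp add: f_def coeff_sum_monom)
    then have fs: "f s \<noteq> 0" by auto
    with fp sj have "s < p" by (metis less_SucE)
    obtain g where g: "?e (f s) \<otimes> ?e g = \<one>" using inv fs df by blast
    define h where "h = (\<Sum>s<p. Polynomial.monom (l (?e (f s) \<otimes> ?e g)) s)"
    have "?e h \<otimes> r = \<zero>" using rel[of "?e g"] fp by (simp add: h_def l0)
    then have "h = 0" by (intro kill) (simp_all add: h_def degree_sum_monom)
    then have "poly.coeff h s = 0" by simp
    then show False using \<open>s < p\<close> g l1 rr(2) by (simp add: h_def coeff_sum_monom)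
  qed
  then obtain g where g: "?e (f p) \<otimes> ?e g = \<one>" using inv df by blast
  define h where "h = (\<Sum>s<p. Polynomial.monom (l (?e (f s) \<otimes> ?e g)) s)"
  \<comment> \<open>Now v is the inverse of f_p(y), which normalises the coefficient of x r to d;
    solving for x r produces \<open>k\<close>.\<close>
  have h: "?e h \<otimes> r \<oplus> d \<odot> (x \<otimes> r) = \<zero>" using rel[of "?e g"] g l1 by (simp add: h_def)
  define k where "k = Polynomial.smult (- inverse d) h"
  have "x \<otimes> r = ?e k \<otimes> r"
  proof -
    have "\<zero> = inverse d \<odot> (?e h \<otimes> r \<oplus> d \<odot> (x \<otimes> r))" by (simp add: h)
    also have "\<dots> = inverse d \<odot> (?e h \<otimes> r) \<oplus> x \<otimes> r"
      using rr(2) by (simp add: smult_add_right smult_smult)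
    finally have "x \<otimes> r \<oplus> inverse d \<odot> (?e h \<otimes> r) = \<zero>" by (simp add: a_comm)
    moreover have "?e k \<otimes> r = (- inverse d) \<odot> (?e h \<otimes> r)"
      unfolding k_def eval_poly_smult[OF y] by (simp add: smult_mult_left)
    then have "?e k \<otimes> r \<oplus> inverse d \<odot> (?e h \<otimes> r) = \<zero>"
      by (simp flip: smult_add_left)
    ultimately show ?thesis
      using add.r_cancel[of "x \<otimes> r" "inverse d \<odot> (?e h \<otimes> r)" "?e k \<otimes> r"] by simp
  qed
  then have "b \<odot> r = ?e (twisted_prod \<zeta> k p) \<otimes> r"
    using twist_power_right[OF x y r(1) xy, of k p] by (simp add: xp smult_mult_left)
  then have "?e (twisted_prod \<zeta> k p - [:b:]) \<otimes> r = \<zero>"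
  proof -
    assume eq: "b \<odot> r = ?e (twisted_prod \<zeta> k p) \<otimes> r"
    have "twisted_prod \<zeta> k p - [:b:] = twisted_prod \<zeta> k p + [:- b:]"
      by (rule poly_eqI) (simp add: coeff_pCons split: nat.splits)
    then have "?e (twisted_prod \<zeta> k p - [:b:]) \<otimes> r = ?e (twisted_prod \<zeta> k p + [:- b:]) \<otimes> r"
      by (simp only:)
    also have "\<dots> = ?e (twisted_prod \<zeta> k p) \<otimes> r \<oplus> (- b) \<odot> r"
      by (simp only: eval_poly_add[OF y] eval_poly_const[OF y]) (simp add: l_distr smult_mult_left)
    also have "\<dots> = \<zero>" unfolding eq[symmetric] by (simp flip: smult_add_left)
    finally show ?thesis .
  qed
  moreover define F where "F = Polynomial.monom 1 p - [:a:]"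
  \<comment> \<open>The norm of \<open>k\<close> and the constant b agree modulo X^p - a, since the
    remainder \<open>R\<close> has degree below p and R(y) r = 0. The congruence is then read at
    z.\<close>
  define R where "R = (twisted_prod \<zeta> k p - [:b:]) mod F"
  have dF: "Polynomial.degree F = p"
    using degree_add_eq_left[of "[:- a:]" "Polynomial.monom 1 p"] p_pos
    by (simp add: F_def degree_monom_eq diff_conv_add_uminus del: add_uminus_conv_diff)
  have dR: "Polynomial.degree R < p"
    using degree_mod_less[of F "twisted_prod \<zeta> k p - [:b:]"] p_pos dF unfolding R_def by (metis degree_0 not_gr_zero)
  have "?e (twisted_prod \<zeta> k p - [:b:]) = ?e R"
    using yp by (intro eval_poly_dvd[where n = p and a = a]) (auto simp: R_def F_def minus_mod_eq_mult_div)
  ultimately have "R = 0" using kill[OF dR] by simp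
  then obtain q where q: "twisted_prod \<zeta> k p - [:b:] = F * q"
    unfolding R_def by (auto simp: mod_eq_0_iff_dvd)
  have Fz: "poly (map_poly to_ac F) z = 0"
    unfolding F_def poly_map_to_ac_diff by (simp add: map_poly_monom map_poly_pCons poly_monom z)
  have "poly (map_poly to_ac (twisted_prod \<zeta> k p - [:b:])) z = 0"
    unfolding q poly_map_to_ac_mult Fz by simp
  then show ?thesis
    unfolding poly_map_to_ac_diff poly_twisted_prod by (intro exI[of _ k]) (simp add: map_poly_pCons)
qed

end

section \<open>Matrix algebras over k and Brauer triviality\<close>

lemma ring_base_algebra: "ring (base_algebra :: ('k::field, 'k) module)"
proof (rule ringI)
  show "abelian_group (base_algebra :: ('k, 'k) module)"
    by (rule abelian_groupI) (auto simp: base_algebra_def add.assoc add.commute intro: exI[of _ "- x" for x])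
  show "Group.monoid (base_algebra :: ('k, 'k) module)"
    by (rule monoidI) (auto simp: base_algebra_def mult.assoc)
qed (auto simp: base_algebra_def algebra_simps)

lemma finsum_base_algebra:
  assumes "finite S"
  shows "(\<Oplus>\<^bsub>base_algebra\<^esub>i\<in>S. F i) = (\<Sum>i\<in>S. F i :: 'k::field)"
proof -
  interpret ring "base_algebra :: ('k, 'k) module" by (rule ring_base_algebra)
  have [simp]: "carrier (base_algebra :: ('k, 'k) module) = UNIV" "\<zero>\<^bsub>base_algebra\<^esub> = (0 :: 'k)"
    "x \<oplus>\<^bsub>base_algebra\<^esub> y = x + y" for x y :: 'k by (simp_all add: base_algebra_def)
  show ?thesis using assms by induction simp_all
qed

abbreviation matrix_ring :: "nat \<Rightarrow> ('k::field, nat \<times> nat \<Rightarrow> 'k) module" where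
  "matrix_ring n \<equiv> matrix_algebra n base_algebra"

lemma matrix_ring_carrier: "carrier (matrix_ring n) = {..<n} \<times> {..<n} \<rightarrow>\<^sub>E UNIV"
  by (simp add: matrix_algebra_def base_algebra_def)

lemma matrix_ring_eqI:
  assumes "S \<in> carrier (matrix_ring n)" "T \<in> carrier (matrix_ring n)"
    and "\<And>i j. i < n \<Longrightarrow> j < n \<Longrightarrow> S (i, j) = T (i, j)"
  shows "S = T"
  using assms unfolding matrix_ring_carrier by (intro PiE_ext) auto

lemma matrix_ring_entries:
  assumes "i < n" "j < n"
  shows "(S \<otimes>\<^bsub>matrix_ring n\<^esub> T) (i, j) = (\<Sum>l<n. S (i, l) * T (l, j))"
    and "(S \<oplus>\<^bsub>matrix_ring n\<^esub> T) (i, j) = S (i, j) + T (i, j)"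
    and "(c \<odot>\<^bsub>matrix_ring n\<^esub> S) (i, j) = c * S (i, j)"
    and "\<one>\<^bsub>matrix_ring n\<^esub> (i, j) = (if i = j then 1 else 0)"
    and "\<zero>\<^bsub>matrix_ring n\<^esub> (i, j) = 0"
  using assms by (simp_all add: matrix_algebra_def finsum_base_algebra) (simp_all add: base_algebra_def)

lemma matrix_ring_closed:
  "S \<otimes>\<^bsub>matrix_ring n\<^esub> T \<in> carrier (matrix_ring n)" "S \<oplus>\<^bsub>matrix_ring n\<^esub> T \<in> carrier (matrix_ring n)"
  "c \<odot>\<^bsub>matrix_ring n\<^esub> S \<in> carrier (matrix_ring n)" "\<one>\<^bsub>matrix_ring n\<^esub> \<in> carrier (matrix_ring n)"
  "\<zero>\<^bsub>matrix_ring n\<^esub> \<in> carrier (matrix_ring n)"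
  unfolding matrix_ring_carrier by (simp_all add: matrix_algebra_def PiE_def)

lemma sum_times_delta:
  fixes f :: "nat \<Rightarrow> 'a::semiring_1"
  shows "(\<Sum>l<n. f l * (if l = k then 1 else 0)) = (if k < n then f k else 0)"
    and "(\<Sum>l<n. (if l = k then 1 else 0) * f l) = (if k < n then f k else 0)"
proof -
  have 1: "(\<Sum>l<n. f l * (if l = k then 1 else 0)) = (\<Sum>l<n. if l = k then f l else 0)"
    "(\<Sum>l<n. (if l = k then 1 else 0) * f l) = (\<Sum>l<n. if l = k then f l else 0)"
    by (rule sum.cong; simp)+
  show "(\<Sum>l<n. f l * (if l = k then 1 else 0)) = (if k < n then f k else 0)"
    "(\<Sum>l<n. (if l = k then 1 else 0) * f l) = (if k < n then f k else 0)" unfolding 1 by simp_all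
qed

lemma k_algebra_matrix_ring: "k_algebra (matrix_ring n :: ('k::field, _) module)"
proof -
  let ?M = "matrix_ring n :: ('k, _) module"
  note e = matrix_ring_entries
  have "ring ?M"
  proof (rule ringI)
    show "abelian_group ?M"
    proof (rule abelian_groupI)
      show "\<zero>\<^bsub>?M\<^esub> \<in> carrier ?M" by (rule matrix_ring_closed)
      fix S T U assume S: "S \<in> carrier ?M"
      show "S \<oplus>\<^bsub>?M\<^esub> T \<in> carrier ?M" by (rule matrix_ring_closed)
      show "\<zero>\<^bsub>?M\<^esub> \<oplus>\<^bsub>?M\<^esub> S = S"
        by (rule matrix_ring_eqI[of _ n]) (simp_all add: S matrix_ring_closed e)
      show "S \<oplus>\<^bsub>?M\<^esub> T \<oplus>\<^bsub>?M\<^esub> U = S \<oplus>\<^bsub>?M\<^esub> (T \<oplus>\<^bsub>?M\<^esub> U)"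
        by (rule matrix_ring_eqI[of _ n]) (simp_all add: matrix_ring_closed e)
      show "S \<oplus>\<^bsub>?M\<^esub> T = T \<oplus>\<^bsub>?M\<^esub> S"
        by (rule matrix_ring_eqI[of _ n]) (simp_all add: matrix_ring_closed e add.commute)
      have "((- 1) \<odot>\<^bsub>?M\<^esub> S) \<oplus>\<^bsub>?M\<^esub> S = \<zero>\<^bsub>?M\<^esub>"
        by (rule matrix_ring_eqI[of _ n]) (simp_all add: matrix_ring_closed e)
      then show "\<exists>T\<in>carrier ?M. T \<oplus>\<^bsub>?M\<^esub> S = \<zero>\<^bsub>?M\<^esub>" using matrix_ring_closed by blast
    qed
    show "Group.monoid ?M"
    proof (rule monoidI)
      fix S T U
      show "S \<otimes>\<^bsub>?M\<^esub> T \<otimes>\<^bsub>?M\<^esub> U = S \<otimes>\<^bsub>?M\<^esub> (T \<otimes>\<^bsub>?M\<^esub> U)"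
      proof (rule matrix_ring_eqI)
        fix i j assume ij: "i < n" "j < n"
        have "(S \<otimes>\<^bsub>?M\<^esub> T \<otimes>\<^bsub>?M\<^esub> U) (i, j) = (\<Sum>l<n. \<Sum>k<n. S (i, k) * T (k, l) * U (l, j))"
          using ij by (simp add: e sum_distrib_right)
        also have "\<dots> = (S \<otimes>\<^bsub>?M\<^esub> (T \<otimes>\<^bsub>?M\<^esub> U)) (i, j)"
          using ij by (subst sum.swap) (simp add: e sum_distrib_left mult.assoc)
        finally show "(S \<otimes>\<^bsub>?M\<^esub> T \<otimes>\<^bsub>?M\<^esub> U) (i, j) = (S \<otimes>\<^bsub>?M\<^esub> (T \<otimes>\<^bsub>?M\<^esub> U)) (i, j)" .
      qed (simp_all add: matrix_ring_closed)
      assume S: "S \<in> carrier ?M"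
      have d: "(\<Sum>l<n. (if i = l then 1 else 0) * S (l, j)) = S (i, j)"
        "(\<Sum>l<n. S (i, l) * (if l = j then 1 else 0)) = S (i, j)" if "i < n" "j < n" for i j
        using that by (simp_all add: sum_times_delta eq_commute[of i])
      show "\<one>\<^bsub>?M\<^esub> \<otimes>\<^bsub>?M\<^esub> S = S"
        by (rule matrix_ring_eqI[of _ n]) (use S d in \<open>simp_all add: matrix_ring_closed e\<close>)
      show "S \<otimes>\<^bsub>?M\<^esub> \<one>\<^bsub>?M\<^esub> = S"
        by (rule matrix_ring_eqI[of _ n]) (use S d in \<open>simp_all add: matrix_ring_closed e\<close>)
    qed (simp_all add: matrix_ring_closed)
    fix S T U
    show "(S \<oplus>\<^bsub>?M\<^esub> T) \<otimes>\<^bsub>?M\<^esub> U = S \<otimes>\<^bsub>?M\<^esub> U \<oplus>\<^bsub>?M\<^esub> T \<otimes>\<^bsub>?M\<^esub> U"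
      by (rule matrix_ring_eqI[of _ n]) (simp_all add: matrix_ring_closed e algebra_simps sum.distrib)
    show "U \<otimes>\<^bsub>?M\<^esub> (S \<oplus>\<^bsub>?M\<^esub> T) = U \<otimes>\<^bsub>?M\<^esub> S \<oplus>\<^bsub>?M\<^esub> U \<otimes>\<^bsub>?M\<^esub> T"
      by (rule matrix_ring_eqI[of _ n]) (simp_all add: matrix_ring_closed e algebra_simps sum.distrib)
  qed
  then interpret ring ?M .
  show ?thesis
  proof unfold_locales
    fix S T c d assume ST: "S \<in> carrier ?M"
    show "c \<odot>\<^bsub>?M\<^esub> S \<in> carrier ?M" by (rule matrix_ring_closed)
    show "c \<odot>\<^bsub>?M\<^esub> S \<otimes>\<^bsub>?M\<^esub> T = c \<odot>\<^bsub>?M\<^esub> (S \<otimes>\<^bsub>?M\<^esub> T)"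
      by (rule matrix_ring_eqI[of _ n]) (simp_all add: matrix_ring_closed e sum_distrib_left mult.assoc)
    show "S \<otimes>\<^bsub>?M\<^esub> (c \<odot>\<^bsub>?M\<^esub> T) = c \<odot>\<^bsub>?M\<^esub> (S \<otimes>\<^bsub>?M\<^esub> T)"
      by (rule matrix_ring_eqI[of _ n]) (simp_all add: matrix_ring_closed e sum_distrib_left mult.left_commute)
    show "(c + d) \<odot>\<^bsub>?M\<^esub> S = c \<odot>\<^bsub>?M\<^esub> S \<oplus>\<^bsub>?M\<^esub> d \<odot>\<^bsub>?M\<^esub> S"
      by (rule matrix_ring_eqI[of _ n]) (simp_all add: matrix_ring_closed e algebra_simps)
    show "c \<odot>\<^bsub>?M\<^esub> (S \<oplus>\<^bsub>?M\<^esub> T) = c \<odot>\<^bsub>?M\<^esub> S \<oplus>\<^bsub>?M\<^esub> c \<odot>\<^bsub>?M\<^esub> T"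
      by (rule matrix_ring_eqI[of _ n]) (simp_all add: matrix_ring_closed e algebra_simps)
    show "c \<odot>\<^bsub>?M\<^esub> (d \<odot>\<^bsub>?M\<^esub> S) = (c * d) \<odot>\<^bsub>?M\<^esub> S"
      by (rule matrix_ring_eqI[of _ n]) (simp_all add: matrix_ring_closed e)
    show "1 \<odot>\<^bsub>?M\<^esub> S = S"
      by (rule matrix_ring_eqI[of _ n]) (simp_all add: matrix_ring_closed e ST)
  qed
qed

text \<open>
  The preimage of a matrix unit under \<open>M\<^sub>m(A) \<cong> M\<^sub>n(k)\<close> is a primitive idempotent; a suitable
  diagonal entry of it is an element of rank one of \<open>A\<close>.
\<close>

lemma (in k_algebra) rank_one_of_brauer_trivial:
  assumes "brauer_trivial A"
  shows "\<exists>r d. r \<in> carrier A \<and> r \<noteq> \<zero> \<and> d \<noteq> 0 \<and> r \<otimes> r = d \<odot> r \<and>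
    (\<forall>x\<in>carrier A. \<exists>c. r \<otimes> x \<otimes> r = c \<odot> r)"
proof -
  obtain m n :: nat and h where mn: "m > 0" "n > 0"
    and h: "h \<in> ring_iso (matrix_algebra m A) (matrix_ring n)"
    and hsm: "\<And>c x. x \<in> carrier (matrix_algebra m A) \<Longrightarrow>
      h (c \<odot>\<^bsub>matrix_algebra m A\<^esub> x) = c \<odot>\<^bsub>matrix_ring n\<^esub> h x"
    using assms unfolding brauer_trivial_def brauer_equivalent_def algebra_isomorphic_def by blast
  let ?M = "matrix_algebra m A" and ?N = "matrix_ring n :: ('k, _) module"
  have hm: "h (S \<otimes>\<^bsub>?M\<^esub> T) = h S \<otimes>\<^bsub>?N\<^esub> h T" if "S \<in> carrier ?M" "T \<in> carrier ?M" for S T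
    using h that by (simp add: ring_iso_def ring_hom_def)
  have hb: "bij_betw h (carrier ?M) (carrier ?N)" using h by (simp add: ring_iso_def)
  then have hinj: "inj_on h (carrier ?M)" by (simp add: bij_betw_def)
  have hc: "h S \<in> carrier ?N" if "S \<in> carrier ?M" for S using hb that by (auto simp: bij_betw_def)
  let ?D = "{..<m} \<times> {..<m}"
  have cM: "carrier ?M = ?D \<rightarrow>\<^sub>E carrier A" by (simp add: matrix_algebra_def)
  have mult_entry: "(S \<otimes>\<^bsub>?M\<^esub> T) (i, j) = (\<Oplus>l\<in>{..<m}. S (i, l) \<otimes> T (l, j))" if "i < m" "j < m" for S T i j
    using that by (simp add: matrix_algebra_def)
  have smult_entry: "(c \<odot>\<^bsub>?M\<^esub> S) (i, j) = c \<odot> S (i, j)" if "i < m" "j < m" for S c i j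
    using that by (simp add: matrix_algebra_def)
  have entry [simp]: "S (i, j) \<in> carrier A" if "S \<in> carrier ?M" "i < m" "j < m" for S i j
    using that by (auto simp: cM)
  have mult_closed: "S \<otimes>\<^bsub>?M\<^esub> T \<in> carrier ?M" if "S \<in> carrier ?M" "T \<in> carrier ?M" for S T
    using that unfolding cM by (auto simp: matrix_algebra_def intro!: finsum_closed)
  have sm_closed: "c \<odot>\<^bsub>?M\<^esub> S \<in> carrier ?M" if "S \<in> carrier ?M" for c S
    using that unfolding cM by (auto simp: matrix_algebra_def)
  \<comment> \<open>The matrix unit at the corner (0, 0); \<open>ETE\<close> below says that it has
    rank one.\<close>
  define E :: "nat \<times> nat \<Rightarrow> 'k" where
    "E = (\<lambda>(i, j)\<in>{..<n} \<times> {..<n}. if i = 0 \<and> j = 0 then 1 else 0)"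
  have E: "E \<in> carrier ?N" by (simp add: matrix_ring_carrier E_def)
  have Ee: "E (i, j) = (if i = 0 \<and> j = 0 then 1 else 0)" if "i < n" "j < n" for i j
    using that by (simp add: E_def)
  have ETE: "E \<otimes>\<^bsub>?N\<^esub> (T \<otimes>\<^bsub>?N\<^esub> E) = T (0, 0) \<odot>\<^bsub>?N\<^esub> E" for T
  proof (rule matrix_ring_eqI)
    fix i j assume ij: "i < n" "j < n"
    have Ec: "E (l, j) = (if l = 0 then 1 else 0) * (if j = 0 then 1 else 0)"
      "E (i, l) = (if i = 0 then 1 else 0) * (if l = 0 then 1 else 0)" if "l < n" for l
      using that ij by (auto simp: Ee)
    have TE: "(T \<otimes>\<^bsub>?N\<^esub> E) (k, j) = T (k, 0) * (if j = 0 then 1 else 0)" if "k < n" for k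
      using ij that mn by (simp add: matrix_ring_entries(1) Ec sum_times_delta flip: mult.assoc sum_distrib_right)
    have "(E \<otimes>\<^bsub>?N\<^esub> (T \<otimes>\<^bsub>?N\<^esub> E)) (i, j) =
        (if i = 0 then 1 else 0) * (\<Sum>l<n. (if l = 0 then 1 else 0) * (T (l, 0) * (if j = 0 then 1 else 0)))"
      using ij by (simp only: matrix_ring_entries(1) sum_distrib_left) (auto intro!: sum.cong simp: TE Ec)
    also have "\<dots> = (if i = 0 then 1 else 0) * (T (0, 0) * (if j = 0 then 1 else 0))"
      using mn by (simp only: sum_times_delta) simp
    finally show "(E \<otimes>\<^bsub>?N\<^esub> (T \<otimes>\<^bsub>?N\<^esub> E)) (i, j) = (T (0, 0) \<odot>\<^bsub>?N\<^esub> E) (i, j)"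
      using ij mn by (simp add: matrix_ring_entries(3) Ee)
  qed (simp_all add: matrix_ring_closed)
  obtain \<epsilon> where \<epsilon>: "\<epsilon> \<in> carrier ?M" "h \<epsilon> = E"
    using hb E unfolding bij_betw_def by (metis imageE)
  have key: "\<exists>c. \<epsilon> \<otimes>\<^bsub>?M\<^esub> (S \<otimes>\<^bsub>?M\<^esub> \<epsilon>) = c \<odot>\<^bsub>?M\<^esub> \<epsilon>" if S: "S \<in> carrier ?M" for S
  proof -
    have "h (\<epsilon> \<otimes>\<^bsub>?M\<^esub> (S \<otimes>\<^bsub>?M\<^esub> \<epsilon>)) = h (h S (0, 0) \<odot>\<^bsub>?M\<^esub> \<epsilon>)"
      using S \<epsilon> by (simp add: hm mult_closed hsm ETE)
    then have "\<epsilon> \<otimes>\<^bsub>?M\<^esub> (S \<otimes>\<^bsub>?M\<^esub> \<epsilon>) = h S (0, 0) \<odot>\<^bsub>?M\<^esub> \<epsilon>"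
      by (rule inj_onD[OF hinj]) (intro mult_closed sm_closed S \<epsilon>)+
    then show ?thesis by (rule exI)
  qed
  have idem: "\<epsilon> \<otimes>\<^bsub>?M\<^esub> \<epsilon> = \<epsilon>"
  proof -
    have "E \<otimes>\<^bsub>?N\<^esub> E = E"
    proof (rule matrix_ring_eqI)
      fix i j assume ij: "i < n" "j < n"
      have Ec: "E (i, l) = (if i = 0 then 1 else 0) * (if l = 0 then 1 else 0)" if "l < n" for l
        using that ij by (auto simp: Ee)
      have "(E \<otimes>\<^bsub>?N\<^esub> E) (i, j) = (if i = 0 then 1 else 0) * (\<Sum>l<n. (if l = 0 then 1 else 0) * E (l, j))"
        using ij by (simp only: matrix_ring_entries(1) sum_distrib_left) (auto intro!: sum.cong simp: Ec)
      also have "\<dots> = E (i, j)" using mn ij by (simp only: sum_times_delta) (simp add: Ee)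
      finally show "(E \<otimes>\<^bsub>?N\<^esub> E) (i, j) = E (i, j)" .
    qed (simp_all add: E matrix_ring_closed)
    then have "h (\<epsilon> \<otimes>\<^bsub>?M\<^esub> \<epsilon>) = h \<epsilon>" using \<epsilon> by (simp add: hm)
    then show ?thesis by (rule inj_onD[OF hinj]) (intro mult_closed \<epsilon>)+
  qed
  define unit where "unit b c x = (\<lambda>(i, j)\<in>?D. if i = b \<and> j = c then x else \<zero>)" for b c x
  have unit_closed: "unit b c x \<in> carrier ?M" if "x \<in> carrier A" for b c x
    using that by (auto simp: cM unit_def)
  \<comment> \<open>The rank one identity is read off entrywise for a matrix whose only entry is x,
    at (b, c). The scalar \<kappa> is the same for all outer indices a and d, and this uniformity
    carries the rest of the argument.\<close>
  have sandwich: "\<exists>\<kappa>. \<forall>a<m. \<forall>d<m. \<epsilon> (a, b) \<otimes> (x \<otimes> \<epsilon> (c, d)) = \<kappa> \<odot> \<epsilon> (a, d)"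
    if x: "x \<in> carrier A" and bc: "b < m" "c < m" for x b c
  proof -
    obtain \<kappa> where \<kappa>: "\<epsilon> \<otimes>\<^bsub>?M\<^esub> (unit b c x \<otimes>\<^bsub>?M\<^esub> \<epsilon>) = \<kappa> \<odot>\<^bsub>?M\<^esub> \<epsilon>"
      using key[OF unit_closed[OF x]] by blast
    have "\<epsilon> (a, b) \<otimes> (x \<otimes> \<epsilon> (c, d)) = \<kappa> \<odot> \<epsilon> (a, d)" if ad: "a < m" "d < m" for a d
    proof -
      have u: "(unit b c x \<otimes>\<^bsub>?M\<^esub> \<epsilon>) (i, d) = (if b = i then x \<otimes> \<epsilon> (c, d) else \<zero>)" if i: "i < m" for i
      proof -
        have "(unit b c x \<otimes>\<^bsub>?M\<^esub> \<epsilon>) (i, d) =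
            (\<Oplus>l\<in>{..<m}. if c = l then (if b = i then x \<otimes> \<epsilon> (l, d) else \<zero>) else \<zero>)"
          unfolding mult_entry[OF i ad(2)] using i ad x \<epsilon>
          by (intro finsum_cong') (auto simp: unit_def)
        also have "\<dots> = (if b = i then x \<otimes> \<epsilon> (c, d) else \<zero>)"
          using bc ad x \<epsilon> by (intro add.finprod_singleton) auto
        finally show ?thesis .
      qed
      have "(\<epsilon> \<otimes>\<^bsub>?M\<^esub> (unit b c x \<otimes>\<^bsub>?M\<^esub> \<epsilon>)) (a, d) =
          (\<Oplus>l\<in>{..<m}. if b = l then \<epsilon> (a, l) \<otimes> (x \<otimes> \<epsilon> (c, d)) else \<zero>)"
        unfolding mult_entry[OF ad] using u ad x \<epsilon> bc
        by (intro finsum_cong') auto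
      also have "\<dots> = \<epsilon> (a, b) \<otimes> (x \<otimes> \<epsilon> (c, d))"
        using bc ad x \<epsilon> by (intro add.finprod_singleton) auto
      finally show ?thesis unfolding \<kappa> smult_entry[OF ad] by simp
    qed
    then show ?thesis by blast
  qed
  have "\<exists>a d. a < m \<and> d < m \<and> \<epsilon> (a, d) \<noteq> \<zero>"
  proof (rule ccontr)
    assume "\<not> ?thesis"
    then have z: "\<epsilon> (a, d) = \<zero>" if "a < m" "d < m" for a d using that by blast
    have "0 \<odot>\<^bsub>?M\<^esub> \<epsilon> = \<epsilon>"
    proof (rule PiE_ext[OF sm_closed[OF \<epsilon>(1), unfolded cM] \<epsilon>(1)[unfolded cM]])
      fix u assume "u \<in> ?D"
      then show "(0 \<odot>\<^bsub>?M\<^esub> \<epsilon>) u = \<epsilon> u" by (cases u) (simp add: smult_entry z)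
    qed
    then have "E = 0 \<odot>\<^bsub>?N\<^esub> E" using hsm[OF \<epsilon>(1), of 0] \<epsilon>(2) by simp
    then have "E (0, 0) = (0 \<odot>\<^bsub>?N\<^esub> E) (0, 0)" by (rule arg_cong)
    then show False using mn by (simp add: Ee matrix_ring_entries)
  qed
  then obtain a d where ad: "a < m" "d < m" "\<epsilon> (a, d) \<noteq> \<zero>" by blast
  \<comment> \<open>By idempotency the entry (a, d) is a sum of such products, so one of them is
    nonzero; its middle index b selects the diagonal entry.\<close>
  have "\<exists>b<m. \<epsilon> (a, b) \<otimes> \<epsilon> (b, d) \<noteq> \<zero>"
  proof (rule ccontr)
    assume "\<not> ?thesis"
    then have "(\<Oplus>l\<in>{..<m}. \<epsilon> (a, l) \<otimes> \<epsilon> (l, d)) = (\<Oplus>l\<in>{..<m}. \<zero>)"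
      by (intro finsum_cong') auto
    then show False using mult_entry[OF ad(1,2), of \<epsilon> \<epsilon>] ad(3) by (simp add: idem)
  qed
  then obtain b where b: "b < m" "\<epsilon> (a, b) \<otimes> \<epsilon> (b, d) \<noteq> \<zero>" by blast
  obtain \<kappa> where \<kappa>: "\<And>a d. a < m \<Longrightarrow> d < m \<Longrightarrow> \<epsilon> (a, b) \<otimes> (\<one> \<otimes> \<epsilon> (b, d)) = \<kappa> \<odot> \<epsilon> (a, d)"
    using sandwich[of \<one> b b] b by auto
  have "\<kappa> \<noteq> 0" using \<kappa>[OF ad(1,2)] b ad \<epsilon> by auto
  moreover have "\<epsilon> (b, b) \<otimes> \<epsilon> (b, b) = \<kappa> \<odot> \<epsilon> (b, b)" using \<kappa>[of b b] b \<epsilon> by simp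
  \<comment> \<open>By the uniformity of \<kappa>, the entry (a, b) times the entry (b, b) is
    \<kappa> times the entry (a, b), which is nonzero.\<close>
  moreover have "\<epsilon> (b, b) \<noteq> \<zero>"
  proof
    assume "\<epsilon> (b, b) = \<zero>"
    then have "\<kappa> \<odot> \<epsilon> (a, b) = \<zero>" using \<kappa>[of a b] b ad \<epsilon> by simp
    then have "\<epsilon> (a, b) = \<zero>" using smult_eq_zero[of "\<epsilon> (a, b)" \<kappa>] \<open>\<kappa> \<noteq> 0\<close> b ad \<epsilon> by simp
    then show False using b ad \<epsilon> by simp
  qed
  moreover have "\<exists>c. \<epsilon> (b, b) \<otimes> x \<otimes> \<epsilon> (b, b) = c \<odot> \<epsilon> (b, b)" if x: "x \<in> carrier A" for x
  proof -
    obtain c where "\<epsilon> (b, b) \<otimes> (x \<otimes> \<epsilon> (b, b)) = c \<odot> \<epsilon> (b, b)"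
      using sandwich[OF x b(1) b(1)] b(1) by blast
    then show ?thesis using x b \<epsilon> by (intro exI[of _ c]) (simp add: m_assoc)
  qed
  moreover have "\<epsilon> (b, b) \<in> carrier A" using b \<epsilon> by simp
  ultimately show ?thesis by blast
qed

context root_of_unity
begin

lemma root_of_unity_inverse: "root_of_unity p (inverse \<zeta>)"
proof
  show "primitive_root_of_unity p (inverse \<zeta>)"
    using prim by (simp add: primitive_root_of_unity_def power_inverse)
qed (rule prime_p, rule char_p)

text \<open>The conjugates are only listed in the opposite order. This allows the two generators of
  the cyclic algebra to change places, which replaces \<zeta> by its inverse.\<close>

lemma prod_inverse_roots:
  "(\<Prod>i<p. g (to_ac (inverse \<zeta>) ^ i * z)) = (\<Prod>i<p. g (Z ^ i * z) :: 'a::comm_monoid_mult)"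
proof (rule prod.reindex_bij_witness[of _ "\<lambda>i. (p - i) mod p" "\<lambda>i. (p - i) mod p"])
  fix i assume "i \<in> {..<p}"
  then have i: "i < p" by simp
  have "Z ^ i * Z ^ ((p - i) mod p) = 1" using i by (simp add: Z_mod flip: power_add)
  then have "inverse (Z ^ i) = Z ^ ((p - i) mod p)" by (rule inverse_unique)
  then show "g (Z ^ ((p - i) mod p) * z) = g (to_ac (inverse \<zeta>) ^ i * z)"
    by (simp add: power_inverse)
qed (use p_pos in \<open>auto simp: mod_if\<close>)

lemma k_algebra_cyclic:
  fixes a b :: 'k
  shows "k_algebra (cyclic_algebra p a b \<zeta>)"
proof -
  interpret ring "cyclic_algebra p a b \<zeta>" using p_gt_1 zeta_p by (rule cyclic_algebra_ring)
  show ?thesis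
    by unfold_locales
      (auto simp: cyclic_algebra_def fun_eq_iff sum_distrib_left algebra_simps intro!: sum.cong)
qed

lemma cyclic_algebra_eq_zeroI:
  assumes "x \<in> carrier (cyclic_algebra p a b \<zeta>)" "\<And>u. u \<in> {..<p} \<times> {..<p} \<Longrightarrow> x u = 0"
  shows "x = \<zero>\<^bsub>cyclic_algebra p a b \<zeta>\<^esub>"
proof
  fix u show "x u = \<zero>\<^bsub>cyclic_algebra p a b \<zeta>\<^esub> u"
    using assms by (cases u; cases "u \<in> {..<p} \<times> {..<p}") (simp_all add: cyclic_algebra_def)
qed

text \<open>Here y is \<open>cyclic_i2\<close>, whose p-th power is a, and x is
  \<open>cyclic_i1\<close>; the coefficients of an algebra element serve as its coordinates.\<close>

lemma norm_of_split_left: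
  fixes a b :: 'k
  assumes "brauer_trivial (cyclic_algebra p a b \<zeta>)" "\<And>c. c ^ p \<noteq> a" "z ^ p = to_ac a"
  shows "\<exists>f. (\<Prod>i<p. poly (map_poly to_ac f) (Z ^ i * z)) = to_ac b"
proof -
  let ?A = "cyclic_algebra p a b \<zeta>"
  interpret k_algebra ?A by (rule k_algebra_cyclic)
  obtain r d where "r \<in> carrier ?A" "r \<noteq> \<zero>\<^bsub>?A\<^esub>" "d \<noteq> 0" "r \<otimes>\<^bsub>?A\<^esub> r = d \<odot>\<^bsub>?A\<^esub> r"
    "\<And>x. x \<in> carrier ?A \<Longrightarrow> \<exists>c. r \<otimes>\<^bsub>?A\<^esub> x \<otimes>\<^bsub>?A\<^esub> r = c \<odot>\<^bsub>?A\<^esub> r"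
    using rank_one_of_brauer_trivial[OF assms(1)] by blast
  note r = this
  note rel = cyclic_algebra_relations[OF p_gt_1, where a = a and b = b and \<zeta> = \<zeta>]
  show ?thesis
    by (rule norm_of_rank_one[OF k_algebra_axioms rel(1,2,3,5,4) assms(2,3),
        where B = "{..<p} \<times> {..<p}" and co = "\<lambda>x. x" and r = r and d = d])
      (use r cyclic_algebra_eq_zeroI in \<open>auto simp: card_cartesian_product\<close>, auto simp: cyclic_algebra_def)
qed

text \<open>The generators exchange roles: y is now \<open>cyclic_i1\<close>, whose p-th power is b.
  Their commutation rule then involves \<open>inverse \<zeta>\<close>, and
  \<open>norm_of_rank_one\<close> is applied for that root of unity.\<close>

lemma norm_of_split_right:
  fixes a b :: 'k
  assumes "brauer_trivial (cyclic_algebra p a b \<zeta>)" "\<And>c. c ^ p \<noteq> b" "z ^ p = to_ac b"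
  shows "\<exists>f. (\<Prod>i<p. poly (map_poly to_ac f) (Z ^ i * z)) = to_ac a"
proof -
  let ?A = "cyclic_algebra p a b \<zeta>"
  interpret k_algebra ?A by (rule k_algebra_cyclic)
  interpret inv: root_of_unity p "inverse \<zeta>" by (rule root_of_unity_inverse)
  obtain r d where "r \<in> carrier ?A" "r \<noteq> \<zero>\<^bsub>?A\<^esub>" "d \<noteq> 0" "r \<otimes>\<^bsub>?A\<^esub> r = d \<odot>\<^bsub>?A\<^esub> r"
    "\<And>x. x \<in> carrier ?A \<Longrightarrow> \<exists>c. r \<otimes>\<^bsub>?A\<^esub> x \<otimes>\<^bsub>?A\<^esub> r = c \<odot>\<^bsub>?A\<^esub> r"
    using rank_one_of_brauer_trivial[OF assms(1)] by blast
  note r = this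
  note rel = cyclic_algebra_relations[OF p_gt_1, where a = a and b = b and \<zeta> = \<zeta>]
  have sw: "cyclic_i2 \<otimes>\<^bsub>?A\<^esub> cyclic_i1 = inverse \<zeta> \<odot>\<^bsub>?A\<^esub> (cyclic_i1 \<otimes>\<^bsub>?A\<^esub> cyclic_i2)"
    using rel(1,2) unfolding rel(3) by (simp add: smult_smult)
  have "\<exists>f. (\<Prod>i<p. poly (map_poly to_ac f) (to_ac (inverse \<zeta>) ^ i * z)) = to_ac a"
    by (rule inv.norm_of_rank_one[OF k_algebra_axioms rel(2,1) sw rel(4,5) assms(2,3),
        where B = "{..<p} \<times> {..<p}" and co = "\<lambda>x. x" and r = r and d = d])
      (use r cyclic_algebra_eq_zeroI in \<open>auto simp: card_cartesian_product\<close>, auto simp: cyclic_algebra_def)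
  then show ?thesis using prod_inverse_roots[of "poly (map_poly to_ac f)" for f] by metis
qed

end

section \<open>Matrices that satisfy the cyclic relations\<close>

lemma (in k_algebra) commute_powers:
  assumes [simp]: "x \<in> carrier A" "y \<in> carrier A" and xy: "x \<otimes> y = c \<odot> (y \<otimes> x)"
  shows "x [^] (m::nat) \<otimes> y [^] (n::nat) = (c ^ (m * n)) \<odot> (y [^] n \<otimes> x [^] m)"
proof -
  have 1: "x \<otimes> y [^] n = (c ^ n) \<odot> (y [^] n \<otimes> x)" for n :: nat
  proof (induction n)
    case (Suc n)
    have "x \<otimes> y [^] Suc n = (x \<otimes> y [^] n) \<otimes> y" by (simp add: m_assoc)
    also have "\<dots> = (c ^ n) \<odot> (y [^] n \<otimes> (x \<otimes> y))" by (simp add: Suc smult_mult_left m_assoc)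
    also have "\<dots> = (c ^ Suc n) \<odot> (y [^] Suc n \<otimes> x)"
      by (simp add: xy smult_mult_right smult_smult m_assoc mult.commute)
    finally show ?case .
  qed simp
  show ?thesis
  proof (induction m)
    case (Suc m)
    have "x [^] Suc m \<otimes> y [^] n = x [^] m \<otimes> (x \<otimes> y [^] n)" by (simp add: m_assoc)
    also have "\<dots> = (c ^ n) \<odot> ((x [^] m \<otimes> y [^] n) \<otimes> x)" by (simp add: 1 smult_mult_right m_assoc)
    also have "\<dots> = (c ^ (Suc m * n)) \<odot> (y [^] n \<otimes> x [^] Suc m)"
      by (simp add: Suc smult_mult_left smult_smult m_assoc power_add)
    finally show ?case .
  qed simp
qed

lemma (in k_algebra) power_reduce:
  assumes [simp]: "x \<in> carrier A" and xp: "x [^] p = a \<odot> \<one>"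
  shows "x [^] (n::nat) = (a ^ (n div p)) \<odot> (x [^] (n mod p))"
proof -
  have 1: "x [^] (p * q) = (a ^ q) \<odot> \<one>" for q
    by (induction q) (simp_all add: nat_pow_mult[symmetric] xp smult_mult_left smult_smult)
  have "x [^] n = x [^] (p * (n div p)) \<otimes> x [^] (n mod p)"
    by (simp add: nat_pow_mult)
  then show ?thesis by (simp add: 1 smult_mult_left)
qed

context root_of_unity
begin

lemma zeta_root_sum:
  assumes "\<omega> ^ p = (1 :: 'k)"
  shows "(\<Sum>i<p. \<omega> ^ i) = (if \<omega> = 1 then of_nat p else 0)"
proof (cases "\<omega> = 1")
  case False
  have "(1 - \<omega>) * (\<Sum>i<p. \<omega> ^ i) = 1 - \<omega> ^ p" by (metis one_diff_power_eq)
  then show ?thesis using False assms by simp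
qed simp

lemma of_nat_p_base [simp]: "(of_nat p :: 'k) \<noteq> 0"
  using of_nat_p by (metis to_ac_0 to_ac_of_nat)

context
  fixes U Y :: "nat \<times> nat \<Rightarrow> 'k" and a b :: 'k
  assumes U [simp]: "U \<in> carrier (matrix_ring p)" and Y [simp]: "Y \<in> carrier (matrix_ring p)"
    and XY: "U \<otimes>\<^bsub>matrix_ring p\<^esub> Y = \<zeta> \<odot>\<^bsub>matrix_ring p\<^esub> (Y \<otimes>\<^bsub>matrix_ring p\<^esub> U)"
    and Yp: "Y [^]\<^bsub>matrix_ring p\<^esub> p = a \<odot>\<^bsub>matrix_ring p\<^esub> \<one>\<^bsub>matrix_ring p\<^esub>"
    and Xp: "U [^]\<^bsub>matrix_ring p\<^esub> p = b \<odot>\<^bsub>matrix_ring p\<^esub> \<one>\<^bsub>matrix_ring p\<^esub>"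
    and a: "a \<noteq> 0" and b: "b \<noteq> 0"
begin

interpretation M: k_algebra "matrix_ring p :: ('k, nat \<times> nat \<Rightarrow> 'k) module"
  by (rule k_algebra_matrix_ring)

abbreviation (input) "M \<equiv> matrix_ring p :: ('k, nat \<times> nat \<Rightarrow> 'k) module"

definition mono :: "nat \<times> nat \<Rightarrow> nat \<times> nat \<Rightarrow> 'k" where
  "mono u = Y [^]\<^bsub>M\<^esub> fst u \<otimes>\<^bsub>M\<^esub> U [^]\<^bsub>M\<^esub> snd u"

text \<open>The linear extension of \<open>cyclic_i2\<close> \<mapsto> \<open>Y\<close>,
  \<open>cyclic_i1\<close> \<mapsto> \<open>U\<close> from the monomials in the generators; it turns
  out to be an isomorphism onto the matrix algebra.\<close>

definition comb :: "(nat \<times> nat \<Rightarrow> 'k) \<Rightarrow> nat \<times> nat \<Rightarrow> 'k" where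
  "comb f = (\<lambda>e\<in>{..<p} \<times> {..<p}. \<Sum>u\<in>{..<p} \<times> {..<p}. f u * mono u e)"

lemma mono_closed [simp]: "mono u \<in> carrier M"
  by (simp add: mono_def)

lemma mono_mult:
  "mono u \<otimes>\<^bsub>M\<^esub> mono v = cyclic_coeff p a b \<zeta> u v \<odot>\<^bsub>M\<^esub> mono (cyclic_index p u v)"
proof -
  obtain s r t q where uv: "u = (s, r)" "v = (t, q)" by (metis surj_pair)
  have "mono u \<otimes>\<^bsub>M\<^esub> mono v =
      Y [^]\<^bsub>M\<^esub> s \<otimes>\<^bsub>M\<^esub> (U [^]\<^bsub>M\<^esub> r \<otimes>\<^bsub>M\<^esub> Y [^]\<^bsub>M\<^esub> t) \<otimes>\<^bsub>M\<^esub> U [^]\<^bsub>M\<^esub> q"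
    by (simp add: mono_def uv M.m_assoc)
  also have "\<dots> = (\<zeta> ^ (r * t)) \<odot>\<^bsub>M\<^esub>
      ((Y [^]\<^bsub>M\<^esub> s \<otimes>\<^bsub>M\<^esub> Y [^]\<^bsub>M\<^esub> t) \<otimes>\<^bsub>M\<^esub> (U [^]\<^bsub>M\<^esub> r \<otimes>\<^bsub>M\<^esub> U [^]\<^bsub>M\<^esub> q))"
    by (simp add: M.commute_powers[OF U Y XY] M.smult_mult_left M.smult_mult_right M.m_assoc)
  also have "\<dots> = (\<zeta> ^ (r * t)) \<odot>\<^bsub>M\<^esub> (Y [^]\<^bsub>M\<^esub> (s + t) \<otimes>\<^bsub>M\<^esub> U [^]\<^bsub>M\<^esub> (r + q))"
    by (simp add: M.nat_pow_mult)
  also have "\<dots> = cyclic_coeff p a b \<zeta> u v \<odot>\<^bsub>M\<^esub> mono (cyclic_index p u v)"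
    unfolding M.power_reduce[OF Y Yp, of "s + t"] M.power_reduce[OF U Xp, of "r + q"]
    by (simp add: uv mono_def cyclic_coeff_def cyclic_index_def M.smult_mult_left M.smult_mult_right
        M.smult_smult mult_ac)
  finally show ?thesis .
qed

lemma mono_nonzero: "mono u \<noteq> \<zero>\<^bsub>M\<^esub>"
proof
  obtain s r where u: "u = (s, r)" by (cases u)
  \<comment> \<open>Complementary powers raise the exponents to multiples of p, where
    \<open>Y\<close> and \<open>U\<close> become scalars; the product is then a^s b^r, which is
    nonzero.\<close>
  define s' r' where "s' = s * (p - 1)" and "r' = r * (p - 1)"
  assume "mono u = \<zero>\<^bsub>M\<^esub>"
  then have "Y [^]\<^bsub>M\<^esub> s' \<otimes>\<^bsub>M\<^esub> mono u \<otimes>\<^bsub>M\<^esub> U [^]\<^bsub>M\<^esub> r' = \<zero>\<^bsub>M\<^esub>" by simp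
  moreover have "Y [^]\<^bsub>M\<^esub> s' \<otimes>\<^bsub>M\<^esub> mono u \<otimes>\<^bsub>M\<^esub> U [^]\<^bsub>M\<^esub> r' =
      (Y [^]\<^bsub>M\<^esub> s' \<otimes>\<^bsub>M\<^esub> Y [^]\<^bsub>M\<^esub> s) \<otimes>\<^bsub>M\<^esub> (U [^]\<^bsub>M\<^esub> r \<otimes>\<^bsub>M\<^esub> U [^]\<^bsub>M\<^esub> r')"
    by (simp add: mono_def u M.m_assoc)
  moreover have "s' + s = p * s" "r + r' = p * r"
    using p_gt_1 by (cases p; simp add: s'_def r'_def)+
  ultimately have "Y [^]\<^bsub>M\<^esub> (p * s) \<otimes>\<^bsub>M\<^esub> U [^]\<^bsub>M\<^esub> (p * r) = \<zero>\<^bsub>M\<^esub>"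
    by (simp add: M.nat_pow_mult)
  then have "(a ^ s * b ^ r) \<odot>\<^bsub>M\<^esub> \<one>\<^bsub>M\<^esub> = \<zero>\<^bsub>M\<^esub>"
    using M.power_reduce[OF Y Yp, of "p * s"] M.power_reduce[OF U Xp, of "p * r"] p_pos
    by (simp add: M.smult_mult_left M.smult_mult_right M.smult_smult mult.commute)
  then have "((a ^ s * b ^ r) \<odot>\<^bsub>M\<^esub> \<one>\<^bsub>M\<^esub>) (0, 0) = \<zero>\<^bsub>M\<^esub> (0, 0)" by (rule arg_cong)
  then show False using a b by (simp add: matrix_ring_entries)
qed

lemma comb_closed [simp]: "comb f \<in> carrier M"
  by (simp add: comb_def matrix_ring_carrier)

lemma comb_entry: "i < p \<Longrightarrow> j < p \<Longrightarrow> comb f (i, j) = (\<Sum>u\<in>{..<p} \<times> {..<p}. f u * mono u (i, j))"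
  by (simp add: comb_def)

lemma comb_left: "i < p \<Longrightarrow> j < p \<Longrightarrow>
  (T \<otimes>\<^bsub>M\<^esub> comb f) (i, j) = (\<Sum>u\<in>{..<p} \<times> {..<p}. f u * (T \<otimes>\<^bsub>M\<^esub> mono u) (i, j))"
  by (simp add: matrix_ring_entries comb_entry sum_distrib_left sum.swap[of _ _ "{..<p}"] mult_ac)

lemma comb_right: "i < p \<Longrightarrow> j < p \<Longrightarrow>
  (comb f \<otimes>\<^bsub>M\<^esub> T) (i, j) = (\<Sum>u\<in>{..<p} \<times> {..<p}. f u * (mono u \<otimes>\<^bsub>M\<^esub> T) (i, j))"
  by (simp add: matrix_ring_entries comb_entry sum_distrib_left sum_distrib_right sum.swap[of _ _ "{..<p}"] mult_ac)

text \<open>Conjugation by \<open>U\<close> multiplies the monomial with exponents (s, r) by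
  \<zeta>^s and thus acts diagonally on coefficients. \<open>U\<close> can be cancelled since its
  p-th power is the nonzero scalar b.\<close>

lemma comb_twist_fst:
  assumes "comb f = \<zero>\<^bsub>M\<^esub>" shows "comb (\<lambda>u. \<zeta> ^ fst u * f u) = \<zero>\<^bsub>M\<^esub>"
proof -
  let ?g = "\<lambda>u. \<zeta> ^ fst u * f u"
  have m: "U \<otimes>\<^bsub>M\<^esub> mono u = (\<zeta> ^ fst u) \<odot>\<^bsub>M\<^esub> (mono u \<otimes>\<^bsub>M\<^esub> U)" for u
  proof -
    have "U \<otimes>\<^bsub>M\<^esub> mono u = (U [^]\<^bsub>M\<^esub> (1::nat) \<otimes>\<^bsub>M\<^esub> Y [^]\<^bsub>M\<^esub> fst u) \<otimes>\<^bsub>M\<^esub> U [^]\<^bsub>M\<^esub> snd u"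
      by (simp add: mono_def M.m_assoc)
    also have "\<dots> = (\<zeta> ^ fst u) \<odot>\<^bsub>M\<^esub> (Y [^]\<^bsub>M\<^esub> fst u \<otimes>\<^bsub>M\<^esub> (U [^]\<^bsub>M\<^esub> (1::nat) \<otimes>\<^bsub>M\<^esub> U [^]\<^bsub>M\<^esub> snd u))"
      by (simp only: M.commute_powers[OF U Y XY]) (simp add: M.smult_mult_left M.m_assoc)
    also have "U [^]\<^bsub>M\<^esub> (1::nat) \<otimes>\<^bsub>M\<^esub> U [^]\<^bsub>M\<^esub> snd u = U [^]\<^bsub>M\<^esub> snd u \<otimes>\<^bsub>M\<^esub> U"
      using M.nat_pow_Suc2[OF U, of "snd u"] by simp
    finally show ?thesis by (simp add: mono_def M.m_assoc)
  qed
  have "U \<otimes>\<^bsub>M\<^esub> comb f = comb ?g \<otimes>\<^bsub>M\<^esub> U"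
    by (rule matrix_ring_eqI[of _ p])
      (simp_all add: matrix_ring_closed comb_left comb_right m matrix_ring_entries(3) mult_ac)
  then have "comb ?g \<otimes>\<^bsub>M\<^esub> U = \<zero>\<^bsub>M\<^esub>" using assms by simp
  then have "comb ?g \<otimes>\<^bsub>M\<^esub> U \<otimes>\<^bsub>M\<^esub> U [^]\<^bsub>M\<^esub> (p - 1) = \<zero>\<^bsub>M\<^esub>" by simp
  moreover have "U \<otimes>\<^bsub>M\<^esub> U [^]\<^bsub>M\<^esub> (p - 1) = b \<odot>\<^bsub>M\<^esub> \<one>\<^bsub>M\<^esub>"
    using M.nat_pow_Suc2[OF U, of "p - 1"] Xp p_pos by simp
  ultimately have "b \<odot>\<^bsub>M\<^esub> comb ?g = \<zero>\<^bsub>M\<^esub>" by (simp add: M.m_assoc M.smult_mult_right)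
  then show ?thesis using M.smult_eq_zero[OF comb_closed] b by blast
qed

lemma comb_twist_snd:
  assumes "comb f = \<zero>\<^bsub>M\<^esub>" shows "comb (\<lambda>u. \<zeta> ^ snd u * f u) = \<zero>\<^bsub>M\<^esub>"
proof -
  let ?g = "\<lambda>u. \<zeta> ^ snd u * f u"
  have m: "mono u \<otimes>\<^bsub>M\<^esub> Y = (\<zeta> ^ snd u) \<odot>\<^bsub>M\<^esub> (Y \<otimes>\<^bsub>M\<^esub> mono u)" for u
  proof -
    have "mono u \<otimes>\<^bsub>M\<^esub> Y = Y [^]\<^bsub>M\<^esub> fst u \<otimes>\<^bsub>M\<^esub> (U [^]\<^bsub>M\<^esub> snd u \<otimes>\<^bsub>M\<^esub> Y [^]\<^bsub>M\<^esub> (1::nat))"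
      by (simp add: mono_def M.m_assoc)
    also have "\<dots> = (\<zeta> ^ snd u) \<odot>\<^bsub>M\<^esub> ((Y [^]\<^bsub>M\<^esub> fst u \<otimes>\<^bsub>M\<^esub> Y [^]\<^bsub>M\<^esub> (1::nat)) \<otimes>\<^bsub>M\<^esub> U [^]\<^bsub>M\<^esub> snd u)"
      by (simp only: M.commute_powers[OF U Y XY]) (simp add: M.smult_mult_right M.m_assoc)
    also have "Y [^]\<^bsub>M\<^esub> fst u \<otimes>\<^bsub>M\<^esub> Y [^]\<^bsub>M\<^esub> (1::nat) = Y \<otimes>\<^bsub>M\<^esub> Y [^]\<^bsub>M\<^esub> fst u"
      using M.nat_pow_Suc2[OF Y, of "fst u"] by simp
    finally show ?thesis by (simp add: mono_def M.m_assoc)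
  qed
  have "comb f \<otimes>\<^bsub>M\<^esub> Y = Y \<otimes>\<^bsub>M\<^esub> comb ?g"
    by (rule matrix_ring_eqI[of _ p])
      (simp_all add: matrix_ring_closed comb_left comb_right m matrix_ring_entries(3) mult_ac)
  then have "Y \<otimes>\<^bsub>M\<^esub> comb ?g = \<zero>\<^bsub>M\<^esub>" using assms by simp
  then have "Y [^]\<^bsub>M\<^esub> (p - 1) \<otimes>\<^bsub>M\<^esub> (Y \<otimes>\<^bsub>M\<^esub> comb ?g) = \<zero>\<^bsub>M\<^esub>" by simp
  moreover have "Y [^]\<^bsub>M\<^esub> (p - 1) \<otimes>\<^bsub>M\<^esub> Y = a \<odot>\<^bsub>M\<^esub> \<one>\<^bsub>M\<^esub>"
    using M.nat_pow_Suc[of Y "p - 1"] Yp p_pos by simp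
  ultimately have "a \<odot>\<^bsub>M\<^esub> comb ?g = \<zero>\<^bsub>M\<^esub>" by (simp add: M.smult_mult_left flip: M.m_assoc)
  then show ?thesis using M.smult_eq_zero[OF comb_closed] a by blast
qed

text \<open>A spectral projection: the mean of the iterated twists, weighted by inverse powers of
  \<open>\<zeta> ^ c\<close>, keeps exactly the coefficients with eigenvalue
  \<open>\<zeta> ^ c\<close>.\<close>

lemma comb_project:
  assumes tw: "\<And>f. comb f = \<zero>\<^bsub>M\<^esub> \<Longrightarrow> comb (\<lambda>u. \<zeta> ^ \<pi> u * f u) = \<zero>\<^bsub>M\<^esub>"
    and f: "comb f = \<zero>\<^bsub>M\<^esub>" and c: "c < p" and \<pi>: "\<And>u. u \<in> {..<p} \<times> {..<p} \<Longrightarrow> \<pi> u < p"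
  shows "comb (\<lambda>u. if \<pi> u = c then f u else 0) = \<zero>\<^bsub>M\<^esub>"
proof -
  have it: "comb (\<lambda>u. (\<zeta> ^ \<pi> u) ^ n * f u) = \<zero>\<^bsub>M\<^esub>" for n
  proof (induction n)
    case (Suc n)
    from tw[OF Suc] show ?case by (simp add: mult_ac)
  qed (simp add: f)
  show ?thesis
  proof (rule matrix_ring_eqI[of _ p])
    fix i j assume ij: "i < p" "j < p"
    have 0: "(\<Sum>u\<in>{..<p} \<times> {..<p}. (\<zeta> ^ \<pi> u) ^ n * f u * mono u (i, j)) = 0" for n
      using it[of n] comb_entry[OF ij, of "\<lambda>u. (\<zeta> ^ \<pi> u) ^ n * f u"] ij by (simp add: matrix_ring_entries)
    have "(of_nat p :: 'k) * (\<Sum>u\<in>{..<p} \<times> {..<p}. (if \<pi> u = c then f u else 0) * mono u (i, j)) =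
        (\<Sum>u\<in>{..<p} \<times> {..<p}. (\<Sum>n<p. (\<zeta> ^ \<pi> u / \<zeta> ^ c) ^ n) * f u * mono u (i, j))"
      unfolding sum_distrib_left
    proof (rule sum.cong[OF HOL.refl])
      fix u :: "nat \<times> nat" assume u: "u \<in> {..<p} \<times> {..<p}"
      have "\<zeta> ^ \<pi> u / \<zeta> ^ c = 1 \<longleftrightarrow> \<pi> u = c"
        using inj_onD[OF zeta_inj, of "\<pi> u" c] \<pi>[OF u] c by auto
      moreover have "(\<zeta> ^ \<pi> u / \<zeta> ^ c) ^ p = 1"
        by (metis div_by_1 mult.commute power_divide power_mult power_one zeta_p)
      ultimately have "(\<Sum>n<p. (\<zeta> ^ \<pi> u / \<zeta> ^ c) ^ n) = (if \<pi> u = c then of_nat p else 0)"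
        using zeta_root_sum by simp
      then show "of_nat p * ((if \<pi> u = c then f u else 0) * mono u (i, j)) =
          (\<Sum>n<p. (\<zeta> ^ \<pi> u / \<zeta> ^ c) ^ n) * f u * mono u (i, j)" by simp
    qed
    also have "\<dots> = (\<Sum>n<p. inverse ((\<zeta> ^ c) ^ n) * (\<Sum>u\<in>{..<p} \<times> {..<p}. (\<zeta> ^ \<pi> u) ^ n * f u * mono u (i, j)))"
      unfolding sum_distrib_left sum_distrib_right
      by (subst sum.swap) (simp add: divide_inverse power_mult_distrib power_inverse mult_ac)
    also have "\<dots> = 0" by (simp only: 0) simp
    finally show "comb (\<lambda>u. if \<pi> u = c then f u else 0) (i, j) = \<zero>\<^bsub>M\<^esub> (i, j)"
      using ij by (simp add: comb_entry matrix_ring_entries)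
  qed (simp_all add: matrix_ring_closed)
qed

text \<open>The monomials are common eigenvectors of the conjugations by \<open>U\<close> and
  \<open>Y\<close>, with pairwise distinct pairs of eigenvalues. Projecting twice isolates a single
  term, and monomials are nonzero.\<close>

lemma comb_eq_zero:
  assumes f: "comb f = \<zero>\<^bsub>M\<^esub>" and u0: "u0 \<in> {..<p} \<times> {..<p}"
  shows "f u0 = 0"
proof -
  have "comb (\<lambda>u. if snd u = snd u0 then (if fst u = fst u0 then f u else 0) else 0) = \<zero>\<^bsub>M\<^esub>"
    by (intro comb_project comb_twist_fst comb_twist_snd f) (use u0 in auto)
  moreover have "(\<lambda>u. if snd u = snd u0 then (if fst u = fst u0 then f u else 0) else 0) =
      (\<lambda>u. if u = u0 then f u else 0)" by (auto simp: prod_eq_iff)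
  ultimately have 0: "comb (\<lambda>u. if u = u0 then f u else 0) = \<zero>\<^bsub>M\<^esub>" by simp
  have "f u0 \<odot>\<^bsub>M\<^esub> mono u0 = \<zero>\<^bsub>M\<^esub>"
  proof (rule matrix_ring_eqI[of _ p])
    fix i j assume ij: "i < p" "j < p"
    have "(\<Sum>u\<in>{..<p} \<times> {..<p}. if u = u0 then f u * mono u (i, j) else 0) = 0"
      using arg_cong[OF 0, of "\<lambda>N. N (i, j)"] ij
      by (simp add: comb_entry matrix_ring_entries if_distrib[of "\<lambda>c. c * _"] cong: if_cong)
    then show "(f u0 \<odot>\<^bsub>M\<^esub> mono u0) (i, j) = \<zero>\<^bsub>M\<^esub> (i, j)"
      using ij u0 by (simp add: matrix_ring_entries sum.delta)
  qed (simp_all add: matrix_ring_closed)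
  then show ?thesis using M.smult_eq_zero[OF mono_closed] mono_nonzero by blast
qed

lemma comb_surj:
  assumes T: "T \<in> carrier M" shows "\<exists>f\<in>carrier (cyclic_algebra p a b \<zeta>). comb f = T"
proof -
  let ?B = "{..<p} \<times> {..<p}"
  \<comment> \<open>The index \<open>None\<close> stands for T. With the monomials this makes one
    matrix more than there are entries, and by independence of the monomials T must occur in the
    resulting relation.\<close>
  define I where "I = insert None (Some ` ?B)"
  have "card I = Suc (card ?B)" unfolding I_def by (subst card_insert_disjoint) (auto simp: card_image)
  then obtain c where c: "\<exists>i\<in>I. c i \<noteq> 0"
    "\<And>e. e \<in> ?B \<Longrightarrow> (\<Sum>i\<in>I. c i * (case i of None \<Rightarrow> T e | Some u \<Rightarrow> mono u e)) = 0"
    using underdetermined_system[of ?B I "\<lambda>i e. case i of None \<Rightarrow> T e | Some u \<Rightarrow> mono u e"]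
    by (auto simp: I_def)
  have eq: "c None * T e + (\<Sum>u\<in>?B. c (Some u) * mono u e) = 0" if "e \<in> ?B" for e
    using c(2)[OF that] unfolding I_def by (subst (asm) sum.insert) (auto simp: sum.reindex)
  have "c None \<noteq> 0"
  proof
    assume n: "c None = 0"
    have "comb (c \<circ> Some) = \<zero>\<^bsub>M\<^esub>"
      by (rule matrix_ring_eqI[of _ p])
        (use eq n in \<open>auto simp: matrix_ring_closed comb_entry matrix_ring_entries\<close>)
    then have "c (Some u) = 0" if "u \<in> ?B" for u using comb_eq_zero[of "c \<circ> Some" u] that by simp
    then show False using c(1) n by (auto simp: I_def)
  qed
  define f where "f u = (if u \<in> ?B then - c (Some u) / c None else 0)" for u
  have "comb f = T"
  proof (rule matrix_ring_eqI[of _ p])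
    fix i j assume ij: "i < p" "j < p"
    have "comb f (i, j) = (\<Sum>u\<in>?B. - c (Some u) / c None * mono u (i, j))"
      unfolding comb_entry[OF ij] by (rule sum.cong) (simp_all add: f_def)
    also have "\<dots> = - (\<Sum>u\<in>?B. c (Some u) * mono u (i, j)) / c None"
      by (simp add: sum_negf sum_divide_distrib)
    also have "\<dots> = T (i, j)"
      using eq[of "(i, j)"] ij \<open>c None \<noteq> 0\<close> by (simp add: field_simps add_eq_0_iff)
    finally show "comb f (i, j) = T (i, j)" .
  qed (simp_all add: T)
  moreover have "f \<in> carrier (cyclic_algebra p a b \<zeta>)" by (simp add: cyclic_algebra_def f_def)
  ultimately show ?thesis by blast
qed

lemma comb_mult: "comb (f \<otimes>\<^bsub>cyclic_algebra p a b \<zeta>\<^esub> g) = comb f \<otimes>\<^bsub>M\<^esub> comb g"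
proof (rule matrix_ring_eqI[of _ p])
  let ?B = "{..<p} \<times> {..<p}"
  let ?C = "cyclic_coeff p a b \<zeta>" and ?I = "cyclic_index p"
  fix i j assume ij: "i < p" "j < p"
  have IB: "?I u v \<in> ?B" for u v using p_pos by (auto simp: cyclic_index_def split: prod.splits)
  have "comb (f \<otimes>\<^bsub>cyclic_algebra p a b \<zeta>\<^esub> g) (i, j) =
      (\<Sum>w\<in>?B. \<Sum>u\<in>?B. \<Sum>v\<in>?B. if ?I u v = w then ?C u v * f u * g v * mono w (i, j) else 0)"
    unfolding comb_entry[OF ij] by (simp add: cyclic_algebra_def sum_distrib_right if_distrib[of "\<lambda>c. c * _"] cong: if_cong)
  also have "\<dots> = (\<Sum>u\<in>?B. \<Sum>v\<in>?B. \<Sum>w\<in>?B. if ?I u v = w then ?C u v * f u * g v * mono w (i, j) else 0)"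
    by (rule HOL.trans[OF sum.swap], rule sum.cong[OF HOL.refl], rule sum.swap)
  also have "\<dots> = (\<Sum>u\<in>?B. \<Sum>v\<in>?B. ?C u v * f u * g v * mono (?I u v) (i, j))"
    using IB by (intro sum.cong HOL.refl) (simp add: sum.delta)
  also have "\<dots> = (\<Sum>u\<in>?B. f u * (\<Sum>v\<in>?B. g v * (mono u \<otimes>\<^bsub>M\<^esub> mono v) (i, j)))"
    unfolding mono_mult using ij by (simp add: matrix_ring_entries(3) sum_distrib_left mult_ac)
  also have "\<dots> = (comb f \<otimes>\<^bsub>M\<^esub> comb g) (i, j)"
    unfolding comb_right[OF ij] using ij by (simp add: comb_left)
  finally show "comb (f \<otimes>\<^bsub>cyclic_algebra p a b \<zeta>\<^esub> g) (i, j) = (comb f \<otimes>\<^bsub>M\<^esub> comb g) (i, j)" .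
qed (simp_all add: matrix_ring_closed)

lemma comb_add: "comb (\<lambda>u. f u + g u) = comb f \<oplus>\<^bsub>M\<^esub> comb g"
  by (rule matrix_ring_eqI[of _ p])
    (simp_all add: matrix_ring_closed comb_entry matrix_ring_entries algebra_simps sum.distrib)

lemma comb_smult: "comb (\<lambda>u. c * f u) = c \<odot>\<^bsub>M\<^esub> comb f"
  by (rule matrix_ring_eqI[of _ p])
    (simp_all add: matrix_ring_closed comb_entry matrix_ring_entries sum_distrib_left mult_ac)

lemma comb_one: "comb (\<lambda>u. if u = (0, 0) then 1 else 0) = \<one>\<^bsub>M\<^esub>"
proof (rule matrix_ring_eqI[of _ p])
  fix i j assume ij: "i < p" "j < p"
  have "comb (\<lambda>u. if u = (0, 0) then 1 else 0) (i, j) =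
      (\<Sum>u\<in>{..<p} \<times> {..<p}. if u = (0, 0) then mono u (i, j) else 0)"
    unfolding comb_entry[OF ij] by (rule sum.cong) auto
  also have "\<dots> = mono (0, 0) (i, j)" using p_pos by (simp add: sum.delta)
  finally show "comb (\<lambda>u. if u = (0, 0) then 1 else 0) (i, j) = \<one>\<^bsub>M\<^esub> (i, j)"
    by (simp add: mono_def)
qed (simp_all add: matrix_ring_closed)

text \<open>\<open>comb\<close> is multiplicative, injective by \<open>comb_eq_zero\<close> and
  surjective by \<open>comb_surj\<close>. Brauer equivalence compares matrix algebras, so the cyclic
  algebra enters through matrices of size 1.\<close>

lemma brauer_trivial_of_matrices: "brauer_trivial (cyclic_algebra p a b \<zeta>)"
proof -
  let ?A = "cyclic_algebra p a b \<zeta>"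
  let ?M1 = "matrix_algebra (Suc 0) ?A"
  interpret A: k_algebra ?A by (rule k_algebra_cyclic)
  define h where "h S = comb (S (0, 0))" for S :: "nat \<times> nat \<Rightarrow> nat \<times> nat \<Rightarrow> 'k"
  have D: "{..<Suc 0} \<times> {..<Suc 0} = {(0::nat, 0::nat)}" by auto
  have c1: "carrier ?M1 = {(0, 0)} \<rightarrow>\<^sub>E carrier ?A" by (simp add: matrix_algebra_def D lessThan_Suc)
  have S0: "S (0, 0) \<in> carrier ?A" if "S \<in> carrier ?M1" for S using that by (auto simp: c1)
  have m1: "(S \<otimes>\<^bsub>?M1\<^esub> T) (0, 0) = S (0, 0) \<otimes>\<^bsub>?A\<^esub> T (0, 0)"
    if "S \<in> carrier ?M1" "T \<in> carrier ?M1" for S T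
    using S0[OF that(1)] S0[OF that(2)] by (simp add: matrix_algebra_def lessThan_Suc)
  have h: "h \<in> ring_hom ?M1 M"
  proof (rule ring_hom_memI)
    fix S T assume ST: "S \<in> carrier ?M1" "T \<in> carrier ?M1"
    show "h S \<in> carrier M" by (simp add: h_def)
    show "h (S \<otimes>\<^bsub>?M1\<^esub> T) = h S \<otimes>\<^bsub>M\<^esub> h T" by (simp only: h_def m1[OF ST] comb_mult)
    show "h (S \<oplus>\<^bsub>?M1\<^esub> T) = h S \<oplus>\<^bsub>M\<^esub> h T"
      by (simp add: h_def matrix_algebra_def[of "Suc 0"] flip: comb_add) (simp add: cyclic_algebra_def)
  next
    show "h \<one>\<^bsub>?M1\<^esub> = \<one>\<^bsub>M\<^esub>"
      by (simp add: h_def matrix_algebra_def[of "Suc 0"] flip: comb_one) (simp add: cyclic_algebra_def)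
  qed
  have hs: "h (c \<odot>\<^bsub>?M1\<^esub> S) = c \<odot>\<^bsub>M\<^esub> h S" for c S
    by (simp add: h_def matrix_algebra_def[of "Suc 0"] flip: comb_smult) (simp add: cyclic_algebra_def)
  have "inj_on h (carrier ?M1)"
  proof (rule inj_onI)
    fix S T assume ST: "S \<in> carrier ?M1" "T \<in> carrier ?M1" "h S = h T"
    let ?d = "\<lambda>u. S (0, 0) u + (- 1) * T (0, 0) u"
    have "comb ?d = \<zero>\<^bsub>M\<^esub>"
      unfolding comb_add comb_smult using ST(3)
      by (intro matrix_ring_eqI[of _ p]) (simp_all add: h_def matrix_ring_closed matrix_ring_entries)
    then have "?d u = 0" if "u \<in> {..<p} \<times> {..<p}" for u using comb_eq_zero that by blast
    then have "S (0, 0) u = T (0, 0) u" for u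
      using S0[OF ST(1)] S0[OF ST(2)] by (cases "u \<in> {..<p} \<times> {..<p}"; cases u) (auto simp: cyclic_algebra_def)
    then have "S (0, 0) = T (0, 0)" by (rule ext)
    then show "S = T" using ST(1,2) unfolding c1 by (intro PiE_ext) auto
  qed
  moreover have "h ` carrier ?M1 = carrier M"
  proof (intro equalityI subsetI)
    fix T assume "T \<in> carrier M"
    then obtain f where f: "f \<in> carrier ?A" "comb f = T" using comb_surj by blast
    have "(\<lambda>e\<in>{(0, 0)}. f) \<in> carrier ?M1" using f by (auto simp: c1)
    moreover have "h (\<lambda>e\<in>{(0, 0)}. f) = T" using f by (simp add: h_def)
    ultimately show "T \<in> h ` carrier ?M1" by blast
  qed (auto simp: h_def)
  ultimately have "h \<in> ring_iso ?M1 M" using h by (simp add: ring_iso_def bij_betw_def)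
  then have "algebra_isomorphic ?M1 M" unfolding algebra_isomorphic_def using hs by blast
  then show ?thesis unfolding brauer_trivial_def brauer_equivalent_def
    using p_pos zero_less_Suc by blast
qed

end

text \<open>The companion matrix of \<open>X\<^sup>p - a\<close> and the diagonal matrix of the conjugation \<open>X \<mapsto> \<zeta> X\<close>.\<close>

lemma companion_diagonal:
  fixes a :: 'k
  obtains Y D where "Y \<in> carrier (matrix_ring p)" "D \<in> carrier (matrix_ring p)"
    "D \<otimes>\<^bsub>matrix_ring p\<^esub> Y = \<zeta> \<odot>\<^bsub>matrix_ring p\<^esub> (Y \<otimes>\<^bsub>matrix_ring p\<^esub> D)"
    "Y [^]\<^bsub>matrix_ring p\<^esub> p = a \<odot>\<^bsub>matrix_ring p\<^esub> \<one>\<^bsub>matrix_ring p\<^esub>"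
    "D [^]\<^bsub>matrix_ring p\<^esub> p = \<one>\<^bsub>matrix_ring p\<^esub>"
proof -
  let ?M = "matrix_ring p :: ('k, nat \<times> nat \<Rightarrow> 'k) module"
  interpret M: k_algebra ?M by (rule k_algebra_matrix_ring)
  \<comment> \<open>Column j stands for X^j: its only entry lies in row j + 1, and the last column
    wraps round to row 0 with the entry a.\<close>
  define Y :: "nat \<times> nat \<Rightarrow> 'k" where
    "Y = (\<lambda>(i, j)\<in>{..<p} \<times> {..<p}. (if Suc j = p then a else 1) * (if i = Suc j mod p then 1 else 0))"
  define D :: "nat \<times> nat \<Rightarrow> 'k" where
    "D = (\<lambda>(i, j)\<in>{..<p} \<times> {..<p}. \<zeta> ^ i * (if i = j then 1 else 0))"
  have Ye: "Y (i, j) = (if Suc j = p then a else 1) * (if i = Suc j mod p then 1 else 0)"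
    and De: "D (i, j) = \<zeta> ^ i * (if i = j then 1 else 0)" if "i < p" "j < p" for i j
    using that by (simp_all add: Y_def D_def)
  have YD: "Y \<in> carrier ?M" "D \<in> carrier ?M" by (auto simp: Y_def D_def matrix_ring_carrier)
  have "D \<otimes>\<^bsub>?M\<^esub> Y = \<zeta> \<odot>\<^bsub>?M\<^esub> (Y \<otimes>\<^bsub>?M\<^esub> D)"
  proof (rule matrix_ring_eqI[of _ p])
    fix i j assume ij: "i < p" "j < p"
    have "(D \<otimes>\<^bsub>?M\<^esub> Y) (i, j) = (\<Sum>l<p. (if l = i then 1 else 0) * (\<zeta> ^ i * Y (l, j)))"
      unfolding matrix_ring_entries(1)[OF ij] using ij by (intro sum.cong) (auto simp: De)
    also have "\<dots> = \<zeta> ^ i * Y (i, j)" unfolding sum_times_delta using ij by simp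
    finally have 1: "(D \<otimes>\<^bsub>?M\<^esub> Y) (i, j) = \<zeta> ^ i * Y (i, j)" .
    have "(Y \<otimes>\<^bsub>?M\<^esub> D) (i, j) = (\<Sum>l<p. Y (i, l) * \<zeta> ^ l * (if l = j then 1 else 0))"
      unfolding matrix_ring_entries(1)[OF ij] using ij by (intro sum.cong) (auto simp: De)
    also have "\<dots> = Y (i, j) * \<zeta> ^ j" unfolding sum_times_delta using ij by simp
    finally have 2: "(Y \<otimes>\<^bsub>?M\<^esub> D) (i, j) = Y (i, j) * \<zeta> ^ j" .
    have "\<zeta> ^ i * Y (i, j) = \<zeta> * (Y (i, j) * \<zeta> ^ j)"
      using zeta_mod[of "Suc j"] ij by (auto simp: Ye mult_ac)
    then show "(D \<otimes>\<^bsub>?M\<^esub> Y) (i, j) = (\<zeta> \<odot>\<^bsub>?M\<^esub> (Y \<otimes>\<^bsub>?M\<^esub> D)) (i, j)"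
      using ij by (simp add: matrix_ring_entries(3) 1 2)
  qed (simp_all add: matrix_ring_closed)
  moreover have Dn: "(D [^]\<^bsub>?M\<^esub> n) (i, j) = (\<zeta> ^ i) ^ n * (if i = j then 1 else 0)" if "i < p" "j < p" for n i j
    using that
  proof (induction n arbitrary: i j)
    case (Suc n)
    have "(D [^]\<^bsub>?M\<^esub> Suc n) (i, j) = (\<Sum>l<p. (D [^]\<^bsub>?M\<^esub> n) (i, l) * \<zeta> ^ l * (if l = j then 1 else 0))"
      using Suc.prems by (simp add: matrix_ring_entries(1) De mult.assoc)
    also have "\<dots> = (D [^]\<^bsub>?M\<^esub> n) (i, j) * \<zeta> ^ j" unfolding sum_times_delta using Suc.prems by simp
    also have "\<dots> = (\<zeta> ^ i) ^ Suc n * (if i = j then 1 else 0)" using Suc by simp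
    finally show ?case .
  qed (simp add: matrix_ring_entries)
  have "D [^]\<^bsub>?M\<^esub> p = \<one>\<^bsub>?M\<^esub>"
  proof (rule matrix_ring_eqI[of _ p])
    fix i j assume ij: "i < p" "j < p"
    have "(\<zeta> ^ i) ^ p = 1" by (metis mult.commute power_mult power_one zeta_p)
    then show "(D [^]\<^bsub>?M\<^esub> p) (i, j) = \<one>\<^bsub>?M\<^esub> (i, j)" using ij by (simp add: Dn matrix_ring_entries)
  qed (simp_all add: matrix_ring_closed YD)
  \<comment> \<open>Since n is at most p, the index j + n wraps round at most once, so a single
    factor a is enough.\<close>
  moreover have Yn: "(Y [^]\<^bsub>?M\<^esub> n) (i, j) =
      (if j + n < p then 1 else a) * (if i = (j + n) mod p then 1 else 0)" if "i < p" "j < p" "n \<le> p" for n i j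
    using that
  proof (induction n arbitrary: i j)
    case (Suc n)
    have "(Y [^]\<^bsub>?M\<^esub> Suc n) (i, j) =
        (\<Sum>l<p. (Y [^]\<^bsub>?M\<^esub> n) (i, l) * (if Suc j = p then a else 1) * (if l = Suc j mod p then 1 else 0))"
      using Suc.prems by (simp add: matrix_ring_entries(1) Ye mult.assoc)
    also have "\<dots> = (Y [^]\<^bsub>?M\<^esub> n) (i, Suc j mod p) * (if Suc j = p then a else 1)"
      unfolding sum_times_delta using p_pos by simp
    also have "(Y [^]\<^bsub>?M\<^esub> n) (i, Suc j mod p) =
        (if Suc j mod p + n < p then 1 else a) * (if i = (Suc j mod p + n) mod p then 1 else 0)"
      using Suc.prems by (intro Suc.IH) auto
    also have "\<dots> * (if Suc j = p then a else 1) =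
        (if j + Suc n < p then 1 else a) * (if i = (j + Suc n) mod p then 1 else 0)"
    proof (cases "Suc j = p")
      case True
      then have e: "j + Suc n = p + n" by simp
      have "(j + Suc n) mod p = n" "\<not> j + Suc n < p" unfolding e using Suc.prems by simp_all
      then show ?thesis using True Suc.prems by simp
    next
      case False
      then have "Suc j mod p = Suc j" using Suc.prems by simp
      then show ?thesis using False by simp
    qed
    finally show ?case .
  qed (simp add: matrix_ring_entries)
  have "Y [^]\<^bsub>?M\<^esub> p = a \<odot>\<^bsub>?M\<^esub> \<one>\<^bsub>?M\<^esub>"
    by (rule matrix_ring_eqI[of _ p]) (simp_all add: matrix_ring_closed YD Yn matrix_ring_entries)
  ultimately show ?thesis using that YD by blast
qed

text \<open>\<open>U\<close> = f(Y) D is a semilinear map with respect to the conjugation D; as the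
  p-th power of D is 1, that of \<open>U\<close> is the norm of f(Y), which is b.\<close>

lemma matrices_of_norm:
  fixes a b :: 'k
  assumes a: "\<And>c. c ^ p \<noteq> a" and z: "z ^ p = to_ac a"
    and f: "(\<Prod>i<p. poly (map_poly to_ac f) (Z ^ i * z)) = to_ac b"
  obtains U Y where "U \<in> carrier (matrix_ring p)" "Y \<in> carrier (matrix_ring p)"
    "U \<otimes>\<^bsub>matrix_ring p\<^esub> Y = \<zeta> \<odot>\<^bsub>matrix_ring p\<^esub> (Y \<otimes>\<^bsub>matrix_ring p\<^esub> U)"
    "Y [^]\<^bsub>matrix_ring p\<^esub> p = a \<odot>\<^bsub>matrix_ring p\<^esub> \<one>\<^bsub>matrix_ring p\<^esub>"
    "U [^]\<^bsub>matrix_ring p\<^esub> p = b \<odot>\<^bsub>matrix_ring p\<^esub> \<one>\<^bsub>matrix_ring p\<^esub>"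
proof -
  let ?M = "matrix_ring p :: ('k, nat \<times> nat \<Rightarrow> 'k) module"
  interpret M: k_algebra ?M by (rule k_algebra_matrix_ring)
  obtain Y D where YD: "Y \<in> carrier ?M" "D \<in> carrier ?M"
    "D \<otimes>\<^bsub>?M\<^esub> Y = \<zeta> \<odot>\<^bsub>?M\<^esub> (Y \<otimes>\<^bsub>?M\<^esub> D)" "Y [^]\<^bsub>?M\<^esub> p = a \<odot>\<^bsub>?M\<^esub> \<one>\<^bsub>?M\<^esub>" "D [^]\<^bsub>?M\<^esub> p = \<one>\<^bsub>?M\<^esub>"
    by (rule companion_diagonal)
  define U where "U = M.eval_poly Y f \<otimes>\<^bsub>?M\<^esub> D"
  have e: "M.eval_poly Y f \<in> carrier ?M" using YD(1) by (rule M.eval_poly_closed)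
  have yc: "Y \<otimes>\<^bsub>?M\<^esub> M.eval_poly Y f = M.eval_poly Y f \<otimes>\<^bsub>?M\<^esub> Y"
    using M.eval_poly_commute[OF YD(1), of "Polynomial.monom 1 1" f] YD(1) by (simp add: M.eval_poly_monom)
  have "U \<otimes>\<^bsub>?M\<^esub> Y = \<zeta> \<odot>\<^bsub>?M\<^esub> ((M.eval_poly Y f \<otimes>\<^bsub>?M\<^esub> Y) \<otimes>\<^bsub>?M\<^esub> D)"
    using YD e by (simp add: U_def M.m_assoc M.smult_mult_right)
  also have "\<dots> = \<zeta> \<odot>\<^bsub>?M\<^esub> (Y \<otimes>\<^bsub>?M\<^esub> U)"
    using YD e by (simp add: U_def M.m_assoc flip: yc)
  finally have XY: "U \<otimes>\<^bsub>?M\<^esub> Y = \<zeta> \<odot>\<^bsub>?M\<^esub> (Y \<otimes>\<^bsub>?M\<^esub> U)" .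
  have "poly (map_poly to_ac (twisted_prod \<zeta> f p - [:b:])) z = 0"
    unfolding poly_map_to_ac_diff poly_twisted_prod f by (simp add: map_poly_pCons)
  then have "(Polynomial.monom 1 p - [:a:]) dvd (twisted_prod \<zeta> f p - [:b:])"
    using dvd_of_root[OF a z] by blast
  then have "M.eval_poly Y (twisted_prod \<zeta> f p) = M.eval_poly Y [:b:]"
    by (rule M.eval_poly_dvd[OF YD(1,4)])
  then have "U [^]\<^bsub>?M\<^esub> p = b \<odot>\<^bsub>?M\<^esub> \<one>\<^bsub>?M\<^esub>"
    unfolding U_def M.twist_power_left[OF YD(2,1,3)] using YD by (simp add: M.eval_poly_const)
  then show ?thesis using that XY YD(1,4) e YD(2) unfolding U_def by blast
qed

lemma split_left_of_norm:
  fixes a b :: 'k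
  assumes a: "\<And>c. c ^ p \<noteq> a" and b: "b \<noteq> 0" and z: "z ^ p = to_ac a"
    and f: "(\<Prod>i<p. poly (map_poly to_ac f) (Z ^ i * z)) = to_ac b"
  shows "brauer_trivial (cyclic_algebra p a b \<zeta>)"
proof -
  have "a \<noteq> 0" using a[of 0] p_pos by (simp add: power_0_left)
  then show ?thesis
    using matrices_of_norm[OF a z f] brauer_trivial_of_matrices[OF _ _ _ _ _ _ b] by metis
qed

text \<open>The matrices are built from b and the inverse root of unity; exchanging them restores
  the commutation rule with \<zeta>.\<close>

lemma split_right_of_norm:
  fixes a b :: 'k
  assumes b: "\<And>c. c ^ p \<noteq> b" and a: "a \<noteq> 0" and z: "z ^ p = to_ac b"
    and f: "(\<Prod>i<p. poly (map_poly to_ac f) (Z ^ i * z)) = to_ac a"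
  shows "brauer_trivial (cyclic_algebra p a b \<zeta>)"
proof -
  have b0: "b \<noteq> 0" using b[of 0] p_pos by (simp add: power_0_left)
  let ?M = "matrix_ring p :: ('k, nat \<times> nat \<Rightarrow> 'k) module"
  interpret M: k_algebra ?M by (rule k_algebra_matrix_ring)
  interpret inv: root_of_unity p "inverse \<zeta>" by (rule root_of_unity_inverse)
  obtain U Y where XY: "U \<in> carrier ?M" "Y \<in> carrier ?M"
    "U \<otimes>\<^bsub>?M\<^esub> Y = inverse \<zeta> \<odot>\<^bsub>?M\<^esub> (Y \<otimes>\<^bsub>?M\<^esub> U)"
    "Y [^]\<^bsub>?M\<^esub> p = b \<odot>\<^bsub>?M\<^esub> \<one>\<^bsub>?M\<^esub>" "U [^]\<^bsub>?M\<^esub> p = a \<odot>\<^bsub>?M\<^esub> \<one>\<^bsub>?M\<^esub>"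
    by (rule inv.matrices_of_norm[OF b z, of f a]) (use f prod_inverse_roots[of "poly (map_poly to_ac f)" z] in auto)
  have "Y \<otimes>\<^bsub>?M\<^esub> U = \<zeta> \<odot>\<^bsub>?M\<^esub> (U \<otimes>\<^bsub>?M\<^esub> Y)"
    unfolding XY(3) using XY(1,2) by (simp add: M.smult_smult)
  from brauer_trivial_of_matrices[OF XY(2,1) this XY(5,4) a b0] show ?thesis .
qed

end

section \<open>From a Galois action to the parameters\<close>

text \<open>From the relation at x y subtract \<open>\<sigma> a y\<close> times the relation at x.
  The term of a cancels, the remaining coefficients
  \<open>c i * (\<sigma> i y - \<sigma> a y)\<close> vanish by induction, and y can be chosen to
  separate a from any given j.\<close>

lemma artin_independence:
  fixes \<sigma> :: "'i \<Rightarrow> 'a::monoid_mult \<Rightarrow> 'b::idom"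
  assumes "finite I" and M: "1 \<in> M" "\<And>x y. x \<in> M \<Longrightarrow> y \<in> M \<Longrightarrow> x * y \<in> M"
    and "\<And>i. i \<in> I \<Longrightarrow> \<sigma> i 1 = 1"
    and "\<And>i x y. i \<in> I \<Longrightarrow> x \<in> M \<Longrightarrow> y \<in> M \<Longrightarrow> \<sigma> i (x * y) = \<sigma> i x * \<sigma> i y"
    and "\<And>i j. i \<in> I \<Longrightarrow> j \<in> I \<Longrightarrow> i \<noteq> j \<Longrightarrow> \<exists>x\<in>M. \<sigma> i x \<noteq> \<sigma> j x"
    and "\<And>x. x \<in> M \<Longrightarrow> (\<Sum>i\<in>I. c i * \<sigma> i x) = 0" and "i \<in> I"
  shows "c i = 0"
  using assms(1,4-)
proof (induction I arbitrary: c i rule: finite_induct)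
  case (insert a I)
  have c0: "c j = 0" if j: "j \<in> I" for j
  proof -
    have "a \<noteq> j" using insert.hyps j by auto
    then obtain y where y: "y \<in> M" "\<sigma> a y \<noteq> \<sigma> j y" using insert.prems(3)[of a j] j by auto
    have "c j * (\<sigma> j y - \<sigma> a y) = 0"
    proof (rule insert.IH[where c = "\<lambda>i. c i * (\<sigma> i y - \<sigma> a y)"])
      fix x assume x: "x \<in> M"
      have "(\<Sum>i\<in>I. c i * (\<sigma> i y - \<sigma> a y) * \<sigma> i x) =
          (\<Sum>i\<in>I. c i * \<sigma> i (x * y)) - \<sigma> a y * (\<Sum>i\<in>I. c i * \<sigma> i x)"
        using insert.prems(2) x y by (simp add: sum_distrib_left algebra_simps sum_subtractf)
      also have "(\<Sum>i\<in>I. c i * \<sigma> i (x * y)) = - (c a * \<sigma> a (x * y))"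
        using insert.prems(4)[of "x * y"] insert.hyps M x y by (simp add: add_eq_0_iff)
      also have "(\<Sum>i\<in>I. c i * \<sigma> i x) = - (c a * \<sigma> a x)"
        using insert.prems(4)[of x] insert.hyps x by (simp add: add_eq_0_iff)
      finally show "(\<Sum>i\<in>I. c i * (\<sigma> i y - \<sigma> a y) * \<sigma> i x) = 0"
        using insert.prems(2) x y by simp
    qed (use insert.prems j in auto)
    then show ?thesis using y by simp
  qed
  then have "c a * \<sigma> a 1 = 0" using insert.prems(4)[of 1] insert.hyps M by simp
  then show ?case using insert.prems(1,5) c0 by auto
qed simp

lemma independent_not_power:
  assumes "independent_mod_powers p as" "i < length as" "p > 1"
  shows "c ^ p \<noteq> as ! i"
proof
  assume c: "c ^ p = as ! i"
  define e where "e j = (if j = i then 1 else 0 :: int)" for j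
  have nz: "as ! i \<noteq> 0" using assms by (simp add: independent_mod_powers_def)
  have "(\<Prod>j<length as. as ! j powi e j) = (\<Prod>j<length as. if j = i then as ! j else 1)"
    by (intro prod.cong) (auto simp: e_def)
  also have "\<dots> = c ^ p" using assms(2) c by (simp add: prod.delta)
  finally have "int p dvd e i"
    using assms nz c unfolding independent_mod_powers_def by (metis power_0_left less_not_refl not_one_less_zero)
  then show False using assms(3) by (simp add: e_def)
qed

text \<open>The elements of the group need not be maps, so the normal form model can act directly
  and its triples remain available for computation.\<close>

locale field_action = Group.group G for G :: "('g, 'm) monoid_scheme" (structure) +
  fixes M :: "'k::field alg_closure set" and act :: "'g \<Rightarrow> 'k alg_closure \<Rightarrow> 'k alg_closure"
  assumes M: "subalg M" and emb: "g \<in> carrier G \<Longrightarrow> embedding M (act g)"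
    and act_closed: "g \<in> carrier G \<Longrightarrow> x \<in> M \<Longrightarrow> act g x \<in> M"
    and act_mult: "g \<in> carrier G \<Longrightarrow> h \<in> carrier G \<Longrightarrow> x \<in> M \<Longrightarrow> act (g \<otimes> h) x = act g (act h x)"
    and faithful: "g \<in> carrier G \<Longrightarrow> h \<in> carrier G \<Longrightarrow> (\<And>x. x \<in> M \<Longrightarrow> act g x = act h x) \<Longrightarrow> g = h"
    and finite_G: "finite (carrier G)"
    and fixed: "x \<in> M \<Longrightarrow> (\<And>g. g \<in> carrier G \<Longrightarrow> act g x = x) \<Longrightarrow> x \<in> range to_ac"
begin

text \<open>The Lagrange resolvent of \<theta> for the character is an eigenvector, by reindexing
  its sum; independence of distinct automorphisms provides a \<theta> for which it does not
  vanish.\<close>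

lemma eigenvector:
  fixes \<psi> :: "'g \<Rightarrow> 'k"
  assumes S: "subgroup S G" and \<psi>: "\<And>g h. g \<in> S \<Longrightarrow> h \<in> S \<Longrightarrow> \<psi> (g \<otimes> h) = \<psi> g * \<psi> h"
    and nz: "\<And>g. g \<in> S \<Longrightarrow> \<psi> g \<noteq> 0"
  obtains w where "w \<in> M" "w \<noteq> 0" "\<And>g. g \<in> S \<Longrightarrow> act g w = to_ac (\<psi> g) * w"
proof -
  have SG: "S \<subseteq> carrier G" using S by (rule subgroup.subset)
  then have fin: "finite S" using finite_G finite_subset by blast
  have one: "\<one> \<in> S" using S by (rule subgroup.one_closed)
  have "\<exists>\<theta>\<in>M. (\<Sum>\<tau>\<in>S. to_ac (inverse (\<psi> \<tau>)) * act \<tau> \<theta>) \<noteq> 0"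
  proof (rule ccontr)
    assume "\<not> ?thesis"
    then have 0: "(\<Sum>\<tau>\<in>S. to_ac (inverse (\<psi> \<tau>)) * act \<tau> x) = 0" if "x \<in> M" for x using that by blast
    have "to_ac (inverse (\<psi> \<one>)) = (0 :: 'k alg_closure)"
    proof (rule artin_independence[OF fin, of M act "\<lambda>\<tau>. to_ac (inverse (\<psi> \<tau>))" \<one>])
      show "act i 1 = 1" if "i \<in> S" for i using embedding_1[OF M emb] that SG by auto
      show "act i (x * y) = act i x * act i y" if "i \<in> S" "x \<in> M" "y \<in> M" for i x y
        using embedding_mult[OF M emb] that SG by auto
      show "\<exists>x\<in>M. act i x \<noteq> act j x" if "i \<in> S" "j \<in> S" "i \<noteq> j" for i j
        using faithful[of i j] that SG by blast
    qed (use M 0 one in \<open>auto intro: subalg_mult\<close>)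
    then show False using nz[OF one] by simp
  qed
  then obtain \<theta> where \<theta>: "\<theta> \<in> M" "(\<Sum>\<tau>\<in>S. to_ac (inverse (\<psi> \<tau>)) * act \<tau> \<theta>) \<noteq> 0" by blast
  define w where "w = (\<Sum>\<tau>\<in>S. to_ac (inverse (\<psi> \<tau>)) * act \<tau> \<theta>)"
  have "w \<in> M" unfolding w_def using M \<theta> SG
    by (intro subalg_sum subalg_mult subalg_to_ac act_closed) auto
  moreover have "act g w = to_ac (\<psi> g) * w" if g: "g \<in> S" for g
  proof -
    have gG: "g \<in> carrier G" using g SG by blast
    have bij: "bij_betw (\<lambda>\<tau>. g \<otimes> \<tau>) S S"
      unfolding bij_betw_def
    proof
      show "inj_on (\<lambda>\<tau>. g \<otimes> \<tau>) S" using gG SG by (intro inj_onI) (auto simp: subset_iff)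
      show "(\<lambda>\<tau>. g \<otimes> \<tau>) ` S = S"
        using fin \<open>inj_on (\<lambda>\<tau>. g \<otimes> \<tau>) S\<close> g S
        by (intro endo_inj_surj) (auto intro: subgroup.m_closed)
    qed
    have "act g w = (\<Sum>\<tau>\<in>S. to_ac (inverse (\<psi> \<tau>)) * act (g \<otimes> \<tau>) \<theta>)"
      unfolding w_def
    proof (subst embedding_sum[OF M emb[OF gG]])
      show "to_ac (inverse (\<psi> \<tau>)) * act \<tau> \<theta> \<in> M" if "\<tau> \<in> S" for \<tau>
        using that M \<theta> SG by (intro subalg_mult subalg_to_ac act_closed) auto
      show "(\<Sum>\<tau>\<in>S. act g (to_ac (inverse (\<psi> \<tau>)) * act \<tau> \<theta>)) =
          (\<Sum>\<tau>\<in>S. to_ac (inverse (\<psi> \<tau>)) * act (g \<otimes> \<tau>) \<theta>)"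
      proof (rule sum.cong[OF HOL.refl])
        fix \<tau> assume "\<tau> \<in> S"
        then have "\<tau> \<in> carrier G" using SG by blast
        then show "act g (to_ac (inverse (\<psi> \<tau>)) * act \<tau> \<theta>) = to_ac (inverse (\<psi> \<tau>)) * act (g \<otimes> \<tau>) \<theta>"
          using embedding_mult[OF M emb[OF gG] subalg_to_ac[OF M]] embedding_to_ac[OF M emb[OF gG]] gG \<theta>
          by (simp only: act_closed act_mult)
      qed
    qed
    also have "\<dots> = (\<Sum>\<tau>\<in>S. to_ac (\<psi> g) * (to_ac (inverse (\<psi> (g \<otimes> \<tau>))) * act (g \<otimes> \<tau>) \<theta>))"
      using nz[OF g] by (intro sum.cong) (auto simp: \<psi>[OF g])
    also have "\<dots> = (\<Sum>\<tau>\<in>S. to_ac (\<psi> g) * (to_ac (inverse (\<psi> \<tau>)) * act \<tau> \<theta>))"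
      by (rule sum.reindex_bij_betw[OF bij])
    also have "\<dots> = to_ac (\<psi> g) * w" by (simp add: w_def sum_distrib_left)
    finally show ?thesis .
  qed
  ultimately show ?thesis using that \<theta>(2) w_def by blast
qed

lemma act_funpow: "g \<in> carrier G \<Longrightarrow> x \<in> M \<Longrightarrow> (act g ^^ n) x = act (g [^] n) x"
proof (induction n)
  case 0
  \<comment> \<open>The axioms make \<open>act \<one>\<close> idempotent on \<open>M\<close>; being
    injective, it is the identity.\<close>
  have "act \<one> x = x"
  proof -
    have "act \<one> (act \<one> x) = act \<one> x" using act_mult[of \<one> \<one> x] 0 by simp
    then show ?thesis
      using inj_onD[OF embedding_inj_on[OF M emb[of \<one>]], of "act \<one> x" x] act_closed[of \<one> x] 0 by simp
  qed
  then show ?case by simp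
next
  case (Suc n)
  then have "(act g ^^ Suc n) x = act (g \<otimes> g [^] n) x" by (simp add: act_mult)
  also have "g \<otimes> g [^] n = g [^] Suc n" using Suc by (metis nat_pow_Suc2)
  finally show ?case .
qed

lemma funpow_closed: "g \<in> carrier G \<Longrightarrow> x \<in> M \<Longrightarrow> (act g ^^ n) x \<in> M"
  by (induction n) (auto simp: act_closed)

lemma act_funpow_cocycle:
  assumes g: "g \<in> carrier G" and M': "c \<in> M" "u \<in> M" "w \<in> M"
    and gu: "act g u = u" and gw: "act g w = c * u * w"
  shows "(act g ^^ n) w = (\<Prod>i<n. (act g ^^ i) c) * u ^ n * w"
by (rule embedding_cocycle[OF M emb[OF g] _ M' gu gw]) (use g act_closed in auto)

end

locale radical_action = field_action G M act + root_of_unity p \<zeta>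
  for G :: "('g, 'm) monoid_scheme" (structure) and M :: "'k::field alg_closure set" and act
    and p :: nat and \<zeta> :: "'k::field"
begin

lemma Z_M: "Z \<in> M" by (rule subalg_to_ac[OF M])

lemma act_Z: "g \<in> carrier G \<Longrightarrow> x \<in> M \<Longrightarrow> act g (Z ^ i * x) = Z ^ i * act g x"
  using embedding_mult[OF M emb, of g "Z ^ i" x] embedding_to_ac[OF M emb, of g "\<zeta> ^ i"]
  by (simp add: subalg_power M)

text \<open>The fixed field of S is k(y). Normality of S, and generation of the group by S and g,
  are expressed in \<open>normal\<close> and \<open>gen\<close> through fixed elements. The Lagrange
  resolvents of x under g are elements of k times powers of y, and their sum is p x.\<close>

lemma fixed_of_subgroup:
  assumes g: "g \<in> carrier G" and y: "y \<in> M" "y \<noteq> 0" "act g y = Z * y" "\<And>h. h \<in> S \<Longrightarrow> act h y = y"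
    and S: "S \<subseteq> carrier G"
    and normal: "\<And>x h. x \<in> M \<Longrightarrow> (\<And>h. h \<in> S \<Longrightarrow> act h x = x) \<Longrightarrow> h \<in> S \<Longrightarrow> act h (act g x) = act g x"
    and gp: "g [^] p \<in> S"
    and gen: "\<And>x. x \<in> M \<Longrightarrow> (\<And>h. h \<in> S \<Longrightarrow> act h x = x) \<Longrightarrow> act g x = x \<Longrightarrow> x \<in> range to_ac"
    and x: "x \<in> M" "\<And>h. h \<in> S \<Longrightarrow> act h x = x"
  obtains f where "x = poly (map_poly to_ac f) y"
proof -
  have n: "(act g ^^ n) x \<in> M \<and> (\<forall>h\<in>S. act h ((act g ^^ n) x) = (act g ^^ n) x)" for n
    by (induction n) (use x normal act_closed[OF g] in auto)
  have xp: "(act g ^^ p) x = x" using act_funpow[OF g x(1)] x(2)[OF gp] by simp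
  \<comment> \<open>In the exponent p - 1 plays the part of -1, so g acts on \<open>c i\<close> by
    Z^i, as it does on y^i; the quotient is therefore fixed by g and by S.\<close>
  define c where "c i = (\<Sum>n<p. Z ^ (i * (p - 1) * n) * (act g ^^ n) x)" for i
  have "\<exists>\<kappa>. c i = to_ac \<kappa> * y ^ i" for i
  proof -
    have cM: "c i \<in> M" unfolding c_def using M n by (intro subalg_sum subalg_mult subalg_power Z_M) auto
    have fx: "act h (c i) = c i" if "h \<in> S" for h
    proof -
      have hG: "h \<in> carrier G" using that S by blast
      show ?thesis unfolding c_def using that n M
        by (subst embedding_sum[OF M emb[OF hG]]) (auto simp: act_Z hG intro!: subalg_mult subalg_power Z_M)
    qed
    have "act g (c i) = Z ^ i * c i"
    proof -
      have "act g (c i) = (\<Sum>n<p. Z ^ (i * (p - 1) * n) * (act g ^^ Suc n) x)"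
        unfolding c_def using n M
        by (subst embedding_sum[OF M emb[OF g]]) (auto simp: act_Z g intro!: subalg_mult subalg_power Z_M)
      also have "\<dots> = (\<Sum>n<p. Z ^ i * (Z ^ (i * (p - 1) * Suc n) * (act g ^^ Suc n) x))"
      proof (rule sum.cong[OF HOL.refl])
        fix n
        have "i + i * (p - 1) * Suc n = p * i + i * (p - 1) * n"
          using p_gt_1 by (cases p) (auto simp: algebra_simps)
        then have "Z ^ i * Z ^ (i * (p - 1) * Suc n) = Z ^ (i * (p - 1) * n)"
          by (simp only: power_add[symmetric]) (simp add: power_add power_mult)
        then show "Z ^ (i * (p - 1) * n) * (act g ^^ Suc n) x =
            Z ^ i * (Z ^ (i * (p - 1) * Suc n) * (act g ^^ Suc n) x)"
          by (metis mult.assoc)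
      qed
      also have "\<dots> = Z ^ i * (\<Sum>n<p. Z ^ (i * (p - 1) * Suc n) * (act g ^^ Suc n) x)"
        by (simp add: sum_distrib_left)
      also have "(\<Sum>n<p. Z ^ (i * (p - 1) * Suc n) * (act g ^^ Suc n) x) = c i"
      proof -
        let ?F = "\<lambda>n. Z ^ (i * (p - 1) * n) * (act g ^^ n) x"
        have "?F p = ?F 0" using Z_pow_eq_1_iff[of "i * (p - 1) * p"] xp by simp
        moreover have "(\<Sum>n<Suc p. ?F n) = ?F 0 + (\<Sum>n<p. ?F (Suc n))"
          by (simp add: sum.lessThan_Suc_shift del: sum.lessThan_Suc)
        ultimately show ?thesis unfolding c_def by simp
      qed
      finally show ?thesis .
    qed
    then have "act g (c i / y ^ i) = c i / y ^ i"
      using M y cM by (simp add: embedding_divide[OF M emb[OF g]] embedding_power[OF M emb[OF g]]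
          subalg_power power_mult_distrib)
    moreover have "act h (c i / y ^ i) = c i / y ^ i" if "h \<in> S" for h
      using M y cM fx that S
      by (subst embedding_divide[OF M emb]) (auto simp: embedding_power[OF M emb] subalg_power)
    ultimately have "c i / y ^ i \<in> range to_ac"
      using M y cM by (intro gen) (auto intro: subalg_divide subalg_power)
    then obtain \<kappa> where "c i / y ^ i = to_ac \<kappa>" by auto
    then show ?thesis using y(2) by (intro exI[of _ \<kappa>]) (simp add: field_simps)
  qed
  then obtain \<kappa> where \<kappa>: "\<And>i. c i = to_ac (\<kappa> i) * y ^ i" by metis
  \<comment> \<open>Orthogonality of the powers of \<zeta> leaves only the term n = 0.\<close>
  have "(\<Sum>i<p. c i) = (\<Sum>n<p. (\<Sum>i<p. Z ^ ((p - 1) * n * i)) * (act g ^^ n) x)"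
    unfolding c_def by (subst sum.swap) (simp add: sum_distrib_right sum_distrib_left mult_ac)
  also have "\<dots> = (\<Sum>n<p. if n = 0 then of_nat p * x else 0)"
  proof (rule sum.cong[OF HOL.refl])
    fix n assume "n \<in> {..<p}"
    then have "p dvd (p - 1) * n \<longleftrightarrow> n = 0"
      using prime_p p_gt_1 by (auto simp: prime_dvd_mult_iff dest: dvd_imp_le)
    then show "(\<Sum>i<p. Z ^ ((p - 1) * n * i)) * (act g ^^ n) x = (if n = 0 then of_nat p * x else 0)"
      unfolding Z_sum by simp
  qed
  also have "\<dots> = of_nat p * x" using p_pos by simp
  finally have px: "of_nat p * x = (\<Sum>i<p. c i)" ..
  define f where "f = (\<Sum>i<p. Polynomial.monom (\<kappa> i / of_nat p) i)"
  have mf: "map_poly to_ac f = (\<Sum>i<p. Polynomial.monom (to_ac (\<kappa> i / of_nat p)) i)"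
    by (rule poly_eqI) (simp add: f_def coeff_map_poly coeff_sum_monom)
  have "poly (map_poly to_ac f) y = (\<Sum>i<p. c i) / of_nat p"
    unfolding mf by (simp add: poly_sum poly_monom \<kappa> sum_divide_distrib)
  also have "\<dots> = x" by (simp flip: px)
  finally show ?thesis using that by metis
qed

lemma norm_of_fixed:
  assumes g: "g \<in> carrier G" and y: "y \<in> M" "act g y = Z * y"
  shows "(act g ^^ i) (poly (map_poly to_ac f) y) = poly (map_poly to_ac f) (Z ^ i * y)"
proof (induction i)
  case (Suc i)
  have "Z ^ i * y \<in> M" using M y Z_M by (intro subalg_mult subalg_power)
  then have "(act g ^^ Suc i) (poly (map_poly to_ac f) y) = poly (map_poly to_ac f) (act g (Z ^ i * y))"
    using Suc embedding_poly_to_ac[OF M emb[OF g]] by simp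
  also have "act g (Z ^ i * y) = Z ^ Suc i * y" using act_Z[OF g y(1)] y(2) by (simp add: mult_ac)
  finally show ?case .
qed simp

lemma Z_powi_eq_1_iff: "Z powi e = 1 \<longleftrightarrow> int p dvd e"
proof (cases "e \<ge> 0")
  case True
  then have "Z powi e = Z ^ nat e" by (simp add: power_int_def)
  then show ?thesis using True Z_pow_eq_1_iff[of "nat e"] by (metis int_dvd_int_iff int_nat_eq)
next
  case False
  then have "Z powi e = inverse (Z ^ nat (- e))" by (simp add: power_int_def power_inverse)
  then show ?thesis using False Z_pow_eq_1_iff[of "nat (- e)"]
    by (metis dvd_minus_iff int_dvd_int_iff inverse_eq_1_iff nat_0_le linorder_not_le neg_0_le_iff_le less_imp_le)
qed

end

lemma (in root_of_unity) zeta_power_mod_square: "\<zeta> ^ (n mod p\<^sup>2) = \<zeta> ^ n"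
proof -
  have "\<zeta> ^ (n mod p\<^sup>2) = \<zeta> ^ (n mod p\<^sup>2 mod p)" by (simp only: zeta_mod)
  also have "n mod p\<^sup>2 mod p = n mod p" by (simp add: power2_eq_square mod_mod_cancel)
  finally show ?thesis by (simp only: zeta_mod)
qed

lemma mult_mod_square_div:
  fixes p m :: nat
  assumes "p > 0"
  shows "(p * m mod p\<^sup>2) div p = m mod p" "p dvd p * m mod p\<^sup>2"
proof -
  have eq: "p * m mod p\<^sup>2 = p * (m mod p)" unfolding power2_eq_square by (rule mult_mod_right[symmetric])
  show "p dvd p * m mod p\<^sup>2" unfolding eq by (rule dvd_triv_left)
  show "(p * m mod p\<^sup>2) div p = m mod p" unfolding eq using assms by (rule nonzero_mult_div_cancel_left[OF gr_implies_not0])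
qed

lemma (in group) subgroup_of_finite:
  assumes "finite (carrier G)" "S \<subseteq> carrier G" "\<one> \<in> S" "\<And>x y. x \<in> S \<Longrightarrow> y \<in> S \<Longrightarrow> x \<otimes> y \<in> S"
  shows "subgroup S G"
proof (rule subgroupI)
  fix x assume x: "x \<in> S"
  have xn: "x [^] (n::nat) \<in> S" for n by (induction n) (use assms x in auto)
  have "inv x = x [^] (Coset.order G - 1)"
  proof (rule inv_equality)
    have "Coset.order G > 0" using assms(1) by (simp add: order_gt_0_iff_finite)
    then have "x [^] (Coset.order G - 1) \<otimes> x = x [^] Coset.order G"
      using nat_pow_Suc[of x "Coset.order G - 1"] by simp
    then show "x [^] (Coset.order G - 1) \<otimes> x = \<one>" using pow_order_eq_1 x assms(2) by auto
  qed (use x assms(2) in auto)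
  then show "inv x \<in> S" using xn by simp
qed (use assms in auto)

context root_of_unity
begin

abbreviation (input) "H \<equiv> triple_group p"

lemma subgroup_fst: "subgroup {g \<in> carrier H. p dvd fst g} H"
proof -
  interpret Group.group H by (rule group_triple_group) simp
  show ?thesis
    by (rule subgroup_of_finite)
      (auto simp: triple_carrier triple_one triple_mult power2_eq_square dvd_mod_iff dvd_mod)
qed

lemma subgroup_snd: "subgroup {g \<in> carrier H. p dvd fst (snd g)} H"
proof -
  interpret Group.group H by (rule group_triple_group) simp
  show ?thesis
    by (rule subgroup_of_finite)
      (auto simp: triple_carrier triple_one triple_mult power2_eq_square dvd_mod_iff dvd_mod)
qed

theorem parameters_of_action:
  fixes M :: "'k alg_closure set" and act
  assumes "field_action (triple_group p) M act"
  shows "\<exists>a\<^sub>1 a\<^sub>2 a\<^sub>3 :: 'k. independent_mod_powers p [a\<^sub>1, a\<^sub>2, a\<^sub>3] \<and>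
       brauer_trivial (cyclic_algebra p (inverse \<zeta> * a\<^sub>2) a\<^sub>3 \<zeta>) \<and>
       brauer_trivial (cyclic_algebra p a\<^sub>1 (\<zeta> * a\<^sub>3) \<zeta>)"
proof -
  interpret field_action H M act by (rule assms)
  interpret radical_action H M act p \<zeta> ..
  define x y z where "x = (Suc 0, 0 :: nat, 0 :: nat)" and "y = (0 :: nat, Suc 0, 0 :: nat)"
    and "z = (0 :: nat, 0 :: nat, Suc 0)"
  have p2: "p < p\<^sup>2" "1 < p\<^sup>2" using p_gt_1 by (auto simp: power2_eq_square intro: less_trans)
  have xyz [simp]: "x \<in> carrier H" "y \<in> carrier H" "z \<in> carrier H"
    using p_gt_1 p2 by (auto simp: x_def y_def z_def triple_carrier)
  have zp: "\<zeta> ^ (p * n) = 1" for n by (simp add: power_mult zeta_p)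
  have full: "subgroup (carrier H) H" by (rule subgroup_self)
  obtain t where t: "t \<in> M" "t \<noteq> 0" "\<And>g. g \<in> carrier H \<Longrightarrow> act g t = to_ac (\<zeta> ^ fst g) * t"
    by (rule eigenvector[OF full, of "\<lambda>g. \<zeta> ^ fst g"])
      (auto simp: triple_mult zeta_power_mod_square power_add zp mult.assoc)
  obtain s where s: "s \<in> M" "s \<noteq> 0" "\<And>g. g \<in> carrier H \<Longrightarrow> act g s = to_ac (\<zeta> ^ fst (snd g)) * s"
    by (rule eigenvector[OF full, of "\<lambda>g. \<zeta> ^ fst (snd g)"])
      (auto simp: triple_mult zeta_power_mod_square power_add zp mult.assoc)
  obtain u where u: "u \<in> M" "u \<noteq> 0" "\<And>g. g \<in> carrier H \<Longrightarrow> act g u = to_ac (\<zeta> ^ snd (snd g)) * u"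
    by (rule eigenvector[OF full, of "\<lambda>g. \<zeta> ^ snd (snd g)"])
      (auto simp: triple_mult zeta_mod power_add)
  have power_base: "\<exists>a. v ^ p = to_ac a"
    if v: "v \<in> M" "\<And>g. g \<in> carrier H \<Longrightarrow> act g v = to_ac (\<zeta> ^ e g) * v" for v and e :: "_ \<Rightarrow> nat"
  proof -
    have "v ^ p \<in> range to_ac"
    proof (rule fixed)
      fix g assume g: "g \<in> carrier H"
      have "act g (v ^ p) = (to_ac (\<zeta> ^ e g) * v) ^ p"
        using embedding_power[OF M emb[OF g] v(1)] v(2)[OF g] by simp
      then show "act g (v ^ p) = v ^ p" by (simp add: power_mult_distrib Z_pow_p)
    qed (use M v in \<open>auto intro: subalg_power\<close>)
    then show ?thesis by auto
  qed
  obtain a1 a2 a3 where a: "s ^ p = to_ac a1" "u ^ p = to_ac a2" "t ^ p = to_ac a3"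
    using power_base[OF s(1,3)] power_base[OF u(1,3)] power_base[OF t(1,3)] by blast
  have nz: "a1 \<noteq> 0" "a2 \<noteq> 0" "a3 \<noteq> 0"
    using a s(2) u(2) t(2) by (metis power_not_zero to_ac_0)+
  have ind: "independent_mod_powers p [a1, a2, a3]"
    unfolding independent_mod_powers_def
  proof (intro conjI allI impI)
    show "\<forall>a\<in>set [a1, a2, a3]. a \<noteq> 0" using nz by simp
    fix e :: "nat \<Rightarrow> int" and i
    assume "\<exists>c. c \<noteq> 0 \<and> (\<Prod>i<length [a1, a2, a3]. [a1, a2, a3] ! i powi e i) = c ^ p" and i: "i < length [a1, a2, a3]"
    then obtain c where c: "c \<noteq> 0" "a1 powi e 0 * a2 powi e 1 * a3 powi e 2 = c ^ p"
      by (auto simp: numeral_3_eq_3 numeral_2_eq_2 lessThan_Suc mult_ac)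
    \<comment> \<open>The relation makes v^p a p-th power in k, so v lies in k and is fixed by the
      group. Each of y, z and x scales exactly one of s, u and t, and so detects one exponent modulo
      p.\<close>
    define v where "v = s powi e 0 * u powi e 1 * t powi e 2"
    have hom: "to_ac (b powi n) = to_ac b powi n" for b :: 'k and n
      by (simp add: power_int_def)
    have pw: "(w powi n) ^ p = (w ^ p) powi n" for w :: "'k alg_closure" and n
      by (metis power_int_mult mult.commute power_int_of_nat)
    have "v ^ p = to_ac c ^ p"
      unfolding v_def power_mult_distrib pw a by (simp flip: c(2) to_ac_power hom)
    then obtain m where "v = Z ^ m * to_ac c" by (rule root_ratio)
    then have v: "v = to_ac (\<zeta> ^ m * c)" by simp
    have "v \<noteq> 0" using s u t by (simp add: v_def)
    have ep: "act g (w powi n) = act g w powi n" if "g \<in> carrier H" "w \<in> M" for g w n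
      using embedding_power[OF M emb[OF that(1)]] embedding_inverse[OF M emb[OF that(1)]] that M
      by (simp add: power_int_def subalg_inverse)
    have gv: "act g v = act g s powi e 0 * act g u powi e 1 * act g t powi e 2" if "g \<in> carrier H" for g
      unfolding v_def using M s u t that
      by (simp add: embedding_mult[OF M emb[OF that]] ep subalg_mult subalg_power_int)
    have fixv: "act g v = v" if "g \<in> carrier H" for g
      unfolding v by (rule embedding_to_ac[OF M emb[OF that]])
    have "Z powi e 0 * v = v" using fixv[of y] gv[of y] s(2,3) u(2,3) t(2,3)
      by (simp add: y_def[symmetric]) (simp add: y_def v_def power_int_mult_distrib)
    then have "int p dvd e 0" using \<open>v \<noteq> 0\<close> by (simp flip: Z_powi_eq_1_iff)
    moreover have "Z powi e 1 * v = v" using fixv[of z] gv[of z] s(2,3) u(2,3) t(2,3)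
      by (simp add: z_def[symmetric]) (simp add: z_def v_def power_int_mult_distrib mult_ac)
    then have "int p dvd e 1" using \<open>v \<noteq> 0\<close> by (simp flip: Z_powi_eq_1_iff)
    moreover have "Z powi e 2 * v = v" using fixv[of x] gv[of x] s(2,3) u(2,3) t(2,3)
      by (simp add: x_def[symmetric]) (simp add: x_def v_def power_int_mult_distrib mult_ac)
    then have "int p dvd e 2" using \<open>v \<noteq> 0\<close> by (simp flip: Z_powi_eq_1_iff)
    moreover have "i = 0 \<or> i = 1 \<or> i = 2" using i by (simp add: less_Suc_eq numeral_2_eq_2)
    ultimately show "int p dvd e i" by auto
  qed
  have npow: "c ^ p \<noteq> a1" "c ^ p \<noteq> a3" for c
    using independent_not_power[OF ind, of 0 c] independent_not_power[OF ind, of 2 c] p_gt_1 by auto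
  define A where "A = {g \<in> carrier H. p dvd fst g}"
  define B where "B = {g \<in> carrier H. p dvd fst (snd g)}"
  have A: "subgroup A H" and B: "subgroup B H"
    unfolding A_def B_def by (rule subgroup_fst, rule subgroup_snd)
  have AG: "A \<subseteq> carrier H" and BG: "B \<subseteq> carrier H" by (auto simp: A_def B_def)
  have Ae: "\<exists>m j k. g = (p * m, j, k)" if "g \<in> A" for g
    using that by (cases g) (auto simp: A_def dvd_def)
  have Be: "\<exists>i m k. g = (i, p * m, k)" if "g \<in> B" for g
    using that by (cases g) (auto simp: B_def dvd_def)
  have xp: "x [^]\<^bsub>H\<^esub> p = (p, 0, 0)" and yp: "y [^]\<^bsub>H\<^esub> p = (0, p, 0)"
    using p2 by (simp_all add: x_def y_def triple_powers)

  obtain w where w: "w \<in> M" "w \<noteq> 0" "\<And>g. g \<in> A \<Longrightarrow> act g w = to_ac (\<zeta> ^ (fst g div p)) * w"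
  proof (rule eigenvector[OF A, of "\<lambda>g. \<zeta> ^ (fst g div p)"])
    fix g h assume "g \<in> A" "h \<in> A"
    then obtain m j k m' j' k' where gh: "g = (p * m, j, k)" "h = (p * m', j', k')"
      using Ae by meson
    \<comment> \<open>The cross term is divisible by \<open>p\<^sup>2\<close>, so m modulo p is
      additive on \<open>A\<close>.\<close>
    have "p * m + p * m' + p * k * (p * m') = p * (m + m' + k * (p * m'))" by (simp add: algebra_simps)
    then show "\<zeta> ^ (fst (g \<otimes>\<^bsub>H\<^esub> h) div p) = \<zeta> ^ (fst g div p) * \<zeta> ^ (fst h div p)"
      by (simp only: gh triple_mult fst_conv mult_mod_square_div[OF p_pos] zeta_mod)
        (simp add: power_add zp mult.left_commute[of k])
  qed auto
  define c where "c = act x w / (u * w)"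
  have actM: "act x w \<in> M" by (simp add: act_closed w)
  have cM: "c \<in> M" unfolding c_def using M actM u w by (intro subalg_divide subalg_mult)
  have xw: "act x w = c * u * w" using u(2) w(2) by (simp add: c_def)
  have xu: "act x u = u" using u(3)[of x] xyz by (simp add: x_def)
  have cA: "act g c = c" if g: "g \<in> A" for g
  proof -
    obtain m j k where gg: "g = (p * m, j, k)" and gc: "g \<in> carrier H" using g Ae AG by blast
    \<comment> \<open>\<open>g'\<close> is the conjugate of g by x. Its exponent m + k in place of m
      is offset by the factor \<zeta>^k with which g acts on u.\<close>
    define g' where "g' = ((p * (m + k)) mod p\<^sup>2, (j + p * j) mod p\<^sup>2, k)"
    have g'A: "g' \<in> A" using gc mult_mod_square_div(2)[OF p_pos, of "m + k"] p_pos
      by (auto simp: A_def g'_def gg triple_carrier)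
    have comm: "g \<otimes>\<^bsub>H\<^esub> x = x \<otimes>\<^bsub>H\<^esub> g'"
      using gc by (simp add: gg x_def g'_def triple_mult triple_carrier mod_simps algebra_simps)
    have "act g (act x w) = act x (act g' w)"
      using act_mult[of g x w] act_mult[of x g' w] gc g'A AG w xyz comm by auto
    also have "\<dots> = act x (to_ac (\<zeta> ^ (m + k)) * w)"
      unfolding w(3)[OF g'A] by (simp add: g'_def mult_mod_square_div[OF p_pos] zeta_mod)
    also have "\<dots> = to_ac (\<zeta> ^ (m + k)) * act x w"
      using embedding_mult[OF M emb[OF xyz(1)], of "to_ac (\<zeta> ^ (m + k))" w] M w
        embedding_to_ac[OF M emb[OF xyz(1)], of "\<zeta> ^ (m + k)"] by (simp del: to_ac_power)
    finally have 1: "act g (act x w) = to_ac (\<zeta> ^ (m + k)) * act x w" .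
    have 2: "act g (u * w) = to_ac (\<zeta> ^ (m + k)) * (u * w)"
      using embedding_mult[OF M emb[OF gc] u(1) w(1)] u(3)[OF gc] w(3)[OF g] p_pos
      by (simp add: gg power_add mult_ac)
    show ?thesis unfolding c_def
      using embedding_divide[OF M emb[OF gc] actM subalg_mult[OF M u(1) w(1)]] 1 2 by simp
  qed
  have cprod: "(\<Prod>i<p. (act x ^^ i) c) * to_ac a2 = Z"
  proof -
    \<comment> \<open>The p-th power of x lies in \<open>A\<close>, where the character has the
      value \<zeta>; comparison with the iterated cocycle gives the norm of c.\<close>
    have "(act x ^^ p) w = act (p, 0, 0) w" using act_funpow[OF xyz(1) w(1)] by (simp add: xp)
    also have "\<dots> = Z * w" using w(3)[of "(p, 0, 0)"] p2 p_gt_1 by (simp add: A_def triple_carrier)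
    finally have "(\<Prod>i<p. (act x ^^ i) c) * u ^ p * w = Z * w"
      using act_funpow_cocycle[OF xyz(1) cM u(1) w(1) xu xw, of p] by simp
    then show ?thesis using w(2) by (simp add: a)
  qed
  have xt: "act x t = Z * t" using t(3)[of x] xyz by (simp add: x_def)
  have At: "act g t = t" if "g \<in> A" for g
  proof -
    from that obtain m where "fst g = p * m" by (auto simp: A_def)
    then show ?thesis using t(3)[of g] that AG by (auto simp: power_mult)
  qed
  \<comment> \<open>The inverse of c is expanded in t, since it is the inverse whose norm is the
    slot \<open>inverse \<zeta> * a2\<close>.\<close>
  obtain f where f: "inverse c = poly (map_poly to_ac f) t"
  proof (rule fixed_of_subgroup[OF xyz(1) t(1,2) xt At AG])
    show "x [^]\<^bsub>H\<^esub> p \<in> A" using p2 p_gt_1 by (simp add: xp A_def triple_carrier)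
    show "inverse c \<in> M" using M cM by (rule subalg_inverse)
    show "act h (inverse c) = inverse c" if "h \<in> A" for h
      using embedding_inverse[OF M emb, of h c] that AG cM cA[OF that] by auto
  next
    fix v g assume v: "v \<in> M" "\<And>h. h \<in> A \<Longrightarrow> act h v = v" and g: "g \<in> A"
    obtain m j k where gg: "g = (p * m, j, k)" and gc: "g \<in> carrier H" using g Ae AG by blast
    define g' where "g' = ((p * (m + k)) mod p\<^sup>2, (j + p * j) mod p\<^sup>2, k)"
    have g'A: "g' \<in> A" using gc mult_mod_square_div(2)[OF p_pos, of "m + k"] p_pos
      by (auto simp: A_def g'_def gg triple_carrier)
    have comm: "g \<otimes>\<^bsub>H\<^esub> x = x \<otimes>\<^bsub>H\<^esub> g'"
      using gc by (simp add: gg x_def g'_def triple_mult triple_carrier mod_simps algebra_simps)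
    show "act g (act x v) = act x v"
      using act_mult[of g x v] act_mult[of x g' v] gc g'A AG v xyz comm by auto
  next
    fix v assume v: "v \<in> M" "\<And>h. h \<in> A \<Longrightarrow> act h v = v" "act x v = v"
    show "v \<in> range to_ac"
    proof (rule fixed[OF v(1)])
      fix g assume g: "g \<in> carrier H"
      obtain i j k where gg: "g = (i, j, k)" "i < p\<^sup>2" "j < p\<^sup>2" "k < p" using g by (auto simp: triple_carrier)
      have "(act x ^^ i) v = v" by (induction i) (use v in auto)
      moreover have "g = x [^]\<^bsub>H\<^esub> i \<otimes>\<^bsub>H\<^esub> (0, j, k)" using gg by (simp add: x_def triple_powers triple_mult)
      moreover have "(0, j, k) \<in> A" using gg p_pos by (auto simp: A_def triple_carrier)
      ultimately show "act g v = v"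
        using act_mult[of "x [^]\<^bsub>H\<^esub> i" "(0, j, k)" v] v act_funpow[of x v i] AG by auto
    qed
  qed
  have "(\<Prod>i<p. poly (map_poly to_ac f) (Z ^ i * t)) = (\<Prod>i<p. (act x ^^ i) (inverse c))"
    unfolding f by (simp add: norm_of_fixed[OF xyz(1) t(1) xt])
  also have "\<dots> = inverse (\<Prod>i<p. (act x ^^ i) c)"
  proof -
    have "(act x ^^ i) (inverse c) = inverse ((act x ^^ i) c)" for i
      by (induction i)
        (simp_all add: embedding_inverse[OF M emb[OF xyz(1)] funpow_closed[OF xyz(1) cM]])
    then show ?thesis using prod_inversef[of "\<lambda>i. (act x ^^ i) c" "{..<p}"] by (simp add: o_def)
  qed
  also have "\<dots> = to_ac (inverse \<zeta> * a2)"
  proof -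
    have "(\<Prod>i<p. (act x ^^ i) c) = Z / to_ac a2" using cprod nz by (simp add: field_simps)
    then show ?thesis by (simp add: field_simps)
  qed
  finally have 1: "brauer_trivial (cyclic_algebra p (inverse \<zeta> * a2) a3 \<zeta>)"
    using npow(2) nz a(3) by (intro split_right_of_norm[of a3 "inverse \<zeta> * a2" t f]) auto

  obtain v where v: "v \<in> M" "v \<noteq> 0" "\<And>g. g \<in> B \<Longrightarrow> act g v = to_ac (\<zeta> ^ (fst (snd g) div p)) * v"
  proof (rule eigenvector[OF B, of "\<lambda>g. \<zeta> ^ (fst (snd g) div p)"])
    fix g h assume "g \<in> B" "h \<in> B"
    then obtain m i k m' i' k' where gh: "g = (i, p * m, k)" "h = (i', p * m', k')"
      using Be by meson
    have "p * m + p * m' + p * (p * m) * i' = p * (m + m' + p * (m * i'))" by (simp add: algebra_simps)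
    then show "\<zeta> ^ (fst (snd (g \<otimes>\<^bsub>H\<^esub> h)) div p) = \<zeta> ^ (fst (snd g) div p) * \<zeta> ^ (fst (snd h) div p)"
      by (simp only: gh triple_mult fst_conv snd_conv mult_mod_square_div[OF p_pos] zeta_mod)
        (simp add: power_add zp)
  qed auto
  \<comment> \<open>Here t multiplies: conjugation by y lowers the exponent of the character by the
    first coordinate of g, whereas conjugation by x raised it by the third.\<close>
  define d where "d = act y v * t / v"
  have actM': "act y v \<in> M" by (simp add: act_closed v)
  have dM: "d \<in> M" unfolding d_def using M actM' t v by (intro subalg_divide subalg_mult)
  have yv: "act y v = d * inverse t * v" using t(2) v(2) by (simp add: d_def)
  have yt: "act y (inverse t) = inverse t"
    using t(3)[of y] xyz embedding_inverse[OF M emb[OF xyz(2)] t(1)] by (simp add: y_def)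
  have move: "\<exists>g'\<in>B. g \<otimes>\<^bsub>H\<^esub> y = y \<otimes>\<^bsub>H\<^esub> g' \<and>
      \<zeta> ^ (fst (snd g') div p) * \<zeta> ^ fst g = \<zeta> ^ (fst (snd g) div p)" if g: "g \<in> B" for g
  proof -
    obtain i m k where gg: "g = (i, p * m, k)" and gc: "g \<in> carrier H" using g Be BG by blast
    \<comment> \<open>The factor p - 1 represents -1, so the exponent becomes m - i modulo
      p.\<close>
    define g' where "g' = (i, (p * (m + (p - 1) * i)) mod p\<^sup>2, k)"
    have "g' \<in> B" using gc mult_mod_square_div(2)[OF p_pos, of "m + (p - 1) * i"] p_pos
      by (auto simp: B_def g'_def gg triple_carrier)
    moreover have "g \<otimes>\<^bsub>H\<^esub> y = y \<otimes>\<^bsub>H\<^esub> g'"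
    proof -
      have "Suc (p * (m + (p - 1) * i) + p * i) = Suc (p * m) + p\<^sup>2 * i"
        using p_gt_1 by (cases p) (auto simp: algebra_simps power2_eq_square)
      then have "Suc (p * (m + (p - 1) * i) + p * i) mod p\<^sup>2 = Suc (p * m) mod p\<^sup>2"
        by (simp only: mod_mult_self2)
      moreover have "Suc ((p * (m + (p - 1) * i)) mod p\<^sup>2 + p * i) mod p\<^sup>2 = Suc (p * (m + (p - 1) * i) + p * i) mod p\<^sup>2"
        by (metis add_Suc mod_Suc_eq mod_add_left_eq)
      ultimately show ?thesis
        using gc by (simp add: gg y_def g'_def triple_mult triple_carrier)
    qed
    moreover have "\<zeta> ^ (m + (p - 1) * i) * \<zeta> ^ i = \<zeta> ^ m"
    proof -
      have "m + (p - 1) * i + i = m + p * i" using p_gt_1 by (cases p) auto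
      then show ?thesis by (simp only: power_add[symmetric]) (simp add: power_add zp)
    qed
    ultimately show ?thesis
      using p_pos by (intro bexI[of _ g']) (simp_all add: gg g'_def mult_mod_square_div[OF p_pos] zeta_mod)
  qed
  have dB: "act g d = d" if g: "g \<in> B" for g
  proof -
    have gc: "g \<in> carrier H" using g BG by blast
    obtain g' where g': "g' \<in> B" "g \<otimes>\<^bsub>H\<^esub> y = y \<otimes>\<^bsub>H\<^esub> g'"
      "\<zeta> ^ (fst (snd g') div p) * \<zeta> ^ fst g = \<zeta> ^ (fst (snd g) div p)" using move[OF g] by blast
    define l where "l = \<zeta> ^ (fst (snd g') div p)"
    have "act g (act y v) = act y (act g' v)"
      using act_mult[of g y v] act_mult[of y g' v] gc g' BG v xyz by auto
    also have "\<dots> = to_ac l * act y v"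
      unfolding v(3)[OF g'(1)] l_def[symmetric]
      using embedding_mult[OF M emb[OF xyz(2)], of "to_ac l" v] M v
        embedding_to_ac[OF M emb[OF xyz(2)], of l] by simp
    finally have "act g (act y v * t) = to_ac (l * \<zeta> ^ fst g) * (act y v * t)"
      using embedding_mult[OF M emb[OF gc] actM' t(1)] t(3)[OF gc] by (simp add: mult_ac)
    moreover have "l * \<zeta> ^ fst g = \<zeta> ^ (fst (snd g) div p)" unfolding l_def by (rule g'(3))
    ultimately show ?thesis unfolding d_def
      using embedding_divide[OF M emb[OF gc] subalg_mult[OF M actM' t(1)] v(1)] v(3)[OF g] by simp
  qed
  have dprod: "(\<Prod>i<p. (act y ^^ i) d) = to_ac (\<zeta> * a3)"
  proof -
    have tM: "inverse t \<in> M" using M t(1) by (rule subalg_inverse)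
    have "(act y ^^ p) v = act (0, p, 0) v" using act_funpow[OF xyz(2) v(1)] by (simp add: yp)
    also have "\<dots> = Z * v" using v(3)[of "(0, p, 0)"] p2 p_gt_1 by (simp add: B_def triple_carrier)
    finally have "(\<Prod>i<p. (act y ^^ i) d) * inverse t ^ p * v = Z * v"
      using act_funpow_cocycle[OF xyz(2) dM tM v(1) yt yv, of p] by simp
    then show ?thesis using v(2) nz by (simp add: a power_inverse field_simps)
  qed
  have ys: "act y s = Z * s" using s(3)[of y] xyz by (simp add: y_def)
  have Bs: "act g s = s" if "g \<in> B" for g
  proof -
    from that obtain m where "fst (snd g) = p * m" by (auto simp: B_def)
    then show ?thesis using s(3)[of g] that BG by (auto simp: power_mult)
  qed
  obtain f' where f': "d = poly (map_poly to_ac f') s"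
  proof (rule fixed_of_subgroup[OF xyz(2) s(1,2) ys Bs BG])
    show "y [^]\<^bsub>H\<^esub> p \<in> B" using p2 p_gt_1 by (simp add: yp B_def triple_carrier)
    show "d \<in> M" by (rule dM)
    show "act h d = d" if "h \<in> B" for h using that by (rule dB)
  next
    fix l g assume l: "l \<in> M" "\<And>h. h \<in> B \<Longrightarrow> act h l = l" and g: "g \<in> B"
    then obtain g' where g': "g' \<in> B" "g \<otimes>\<^bsub>H\<^esub> y = y \<otimes>\<^bsub>H\<^esub> g'" using move by blast
    moreover have "g \<in> carrier H" "g' \<in> carrier H" using g g'(1) BG by blast+
    ultimately show "act g (act y l) = act y l"
      using act_mult[of g y l] act_mult[of y g' l] l(1) l(2)[of g'] by simp
  next
    fix l assume l: "l \<in> M" "\<And>h. h \<in> B \<Longrightarrow> act h l = l" "act y l = l"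
    show "l \<in> range to_ac"
    proof (rule fixed[OF l(1)])
      fix g assume g: "g \<in> carrier H"
      obtain i j k where gg: "g = (i, j, k)" "i < p\<^sup>2" "j < p\<^sup>2" "k < p" using g by (auto simp: triple_carrier)
      have "(act y ^^ j) l = l" by (induction j) (use l in auto)
      moreover have "g = (i, 0, k) \<otimes>\<^bsub>H\<^esub> y [^]\<^bsub>H\<^esub> j" using gg by (simp add: y_def triple_powers triple_mult)
      moreover have "(i, 0, k) \<in> B" using gg p_pos by (auto simp: B_def triple_carrier)
      ultimately show "act g l = l"
        using act_mult[of "(i, 0, k)" "y [^]\<^bsub>H\<^esub> j" l] l act_funpow[of y l j] BG by auto
    qed
  qed
  have "(\<Prod>i<p. poly (map_poly to_ac f') (Z ^ i * s)) = to_ac (\<zeta> * a3)"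
    unfolding dprod[symmetric] f' by (simp add: norm_of_fixed[OF xyz(2) s(1) ys])
  then have 2: "brauer_trivial (cyclic_algebra p a1 (\<zeta> * a3) \<zeta>)"
    using npow(1) nz a(1) by (intro split_left_of_norm[of a1 "\<zeta> * a3" s f']) auto
  from ind 1 2 show ?thesis by blast
qed

end

section \<open>Galois groups of subfields as acting groups\<close>

lemma ring_of_type_algebra_simps [simp]:
  "carrier (ring_of_type_algebra :: 'a::field ring) = UNIV"
  "x \<otimes>\<^bsub>ring_of_type_algebra\<^esub> y = (x * y :: 'a)" "x \<oplus>\<^bsub>ring_of_type_algebra\<^esub> y = x + y"
  "\<one>\<^bsub>ring_of_type_algebra\<^esub> = (1 :: 'a)" "\<zero>\<^bsub>ring_of_type_algebra\<^esub> = (0 :: 'a)"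
  by (simp_all add: ring_of_type_algebra_def)

text \<open>Inverses come from algebraicity, negatives from multiplication by -1 in k.\<close>

lemma extension_field_iff_subalg: "extension_field M \<longleftrightarrow> subalg M"
proof
  let ?R = "ring_of_type_algebra :: 'a alg_closure ring"
  interpret R: Ring.field ?R by (rule field_from_type_algebra)
  show "subalg M" if "extension_field M"
    using that subringE(6,7)[OF subfieldE(1)[of M ?R]] unfolding extension_field_def subalg_def by auto
  show "extension_field M" if M: "subalg M"
  proof -
    have "subring M ?R"
    proof (rule R.subringI)
      fix x assume x: "x \<in> M"
      have "\<ominus>\<^bsub>?R\<^esub> x = - x" by (rule R.minus_equality) auto
      then show "\<ominus>\<^bsub>?R\<^esub> x \<in> M" using x M by (simp add: subalg_uminus)
    qed (use M in \<open>auto intro: subalg_add subalg_mult\<close>)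
    moreover have "inv\<^bsub>?R\<^esub> x \<in> M" if x: "x \<in> M - {\<zero>\<^bsub>?R\<^esub>}" for x
    proof -
      have "inv\<^bsub>?R\<^esub> x = inverse x" using x by (intro R.comm_inv_char) auto
      then show ?thesis using x M by (simp add: subalg_inverse)
    qed
    ultimately have "subfield M ?R" by (rule R.subfieldI')
    then show ?thesis using M by (auto simp: extension_field_def subalg_def)
  qed
qed

text \<open>Elements of the Galois group are extensional, so an embedding has to be restricted to
  \<open>M\<close> before it can belong to the group.\<close>

lemma galois_group_carrier:
  assumes M: "subalg M"
  shows "\<sigma> \<in> carrier (galois_group M) \<longleftrightarrow> \<sigma> \<in> extensional M \<and> bij_betw \<sigma> M M \<and> embedding M \<sigma>"
  using M embedding_1[OF M, of \<sigma>]
  by (auto simp: galois_group_def Bij_def subfield_ring_def ring_hom_def embedding_def bij_betw_def)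

lemma galois_group_mult:
  assumes "subalg M" "\<sigma> \<in> carrier (galois_group M)" "\<tau> \<in> carrier (galois_group M)"
  shows "\<sigma> \<otimes>\<^bsub>galois_group M\<^esub> \<tau> = compose M \<sigma> \<tau>"
  using assms by (simp add: galois_group_def BijGroup_def)

lemma galois_group_one: "\<one>\<^bsub>galois_group M\<^esub> = (\<lambda>x\<in>M. x)"
  by (simp add: galois_group_def BijGroup_def)

lemma group_galois_group:
  assumes M: "subalg M"
  shows "Group.group (galois_group M)"
proof (rule groupI)
  let ?G = "galois_group M"
  note c = galois_group_carrier[OF M] and m = galois_group_mult[OF M]
  show mc: "\<sigma> \<otimes>\<^bsub>?G\<^esub> \<tau> \<in> carrier ?G" if st: "\<sigma> \<in> carrier ?G" "\<tau> \<in> carrier ?G" for \<sigma> \<tau>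
  proof -
    have im: "\<tau> ` M \<subseteq> M" using st by (auto simp: c bij_betw_def)
    have "embedding M (\<sigma> \<circ> \<tau>)" using st im by (intro embedding_comp) (auto simp: c)
    then have "embedding M (compose M \<sigma> \<tau>)"
      using M by (auto simp: embedding_def compose_def subalg_add subalg_mult)
    moreover have "bij_betw (\<lambda>x. \<sigma> (\<tau> x)) M M"
      using st bij_betw_trans[of \<tau> M M \<sigma> M] by (simp add: c o_def)
    ultimately show ?thesis unfolding m[OF st] by (auto simp: c compose_def)
  qed
  show "\<one>\<^bsub>?G\<^esub> \<in> carrier ?G"
    using M by (auto simp: c galois_group_one embedding_def subalg_add subalg_mult bij_betw_def inj_on_def)
  show "\<sigma> \<otimes>\<^bsub>?G\<^esub> \<tau> \<otimes>\<^bsub>?G\<^esub> \<rho> = \<sigma> \<otimes>\<^bsub>?G\<^esub> (\<tau> \<otimes>\<^bsub>?G\<^esub> \<rho>)"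
    if "\<sigma> \<in> carrier ?G" "\<tau> \<in> carrier ?G" "\<rho> \<in> carrier ?G" for \<sigma> \<tau> \<rho>
  proof -
    have "\<rho> x \<in> M" if "x \<in> M" for x using \<open>\<rho> \<in> carrier ?G\<close> that by (auto simp: c bij_betw_def)
    then show ?thesis using that mc by (auto simp: m compose_def fun_eq_iff)
  qed
  show "\<one>\<^bsub>?G\<^esub> \<otimes>\<^bsub>?G\<^esub> \<sigma> = \<sigma>" if s: "\<sigma> \<in> carrier ?G" for \<sigma>
  proof -
    have "\<sigma> x \<in> M" if "x \<in> M" for x using s that by (auto simp: c bij_betw_def)
    then show ?thesis using s \<open>\<one>\<^bsub>?G\<^esub> \<in> carrier ?G\<close>
      by (auto simp: m compose_def fun_eq_iff galois_group_one c extensional_def)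
  qed
  show "\<exists>\<tau>\<in>carrier ?G. \<tau> \<otimes>\<^bsub>?G\<^esub> \<sigma> = \<one>\<^bsub>?G\<^esub>" if s: "\<sigma> \<in> carrier ?G" for \<sigma>
  proof -
    have b: "bij_betw \<sigma> M M" and e: "embedding M \<sigma>" using s by (auto simp: c)
    have sM: "\<sigma> x \<in> M" if "x \<in> M" for x using b that by (auto simp: bij_betw_def)
    define \<tau> where "\<tau> = restrict (inv_into M \<sigma>) M"
    have \<tau>\<sigma>: "\<tau> (\<sigma> x) = x" if "x \<in> M" for x
      using that sM b by (simp add: \<tau>_def bij_betw_def)
    have \<tau>M: "\<tau> x \<in> M" "\<sigma> (\<tau> x) = x" if "x \<in> M" for x
      using b that by (auto simp: \<tau>_def bij_betw_def inv_into_into f_inv_into_f)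
    have "embedding M \<tau>"
      unfolding embedding_def
    proof (intro conjI allI ballI)
      show "\<tau> (to_ac k) = to_ac k" for k
        using \<tau>\<sigma>[OF subalg_to_ac[OF M], of k] embedding_to_ac[OF M e] by simp
      fix x y assume xy: "x \<in> M" "y \<in> M"
      show "\<tau> (x + y) = \<tau> x + \<tau> y"
        using \<tau>\<sigma>[of "\<tau> x + \<tau> y"] xy \<tau>M M embedding_add[OF M e] by (simp add: subalg_add)
      show "\<tau> (x * y) = \<tau> x * \<tau> y"
        using \<tau>\<sigma>[of "\<tau> x * \<tau> y"] xy \<tau>M M embedding_mult[OF M e] by (simp add: subalg_mult)
    qed
    moreover have "bij_betw \<tau> M M"
      by (rule bij_betwI[of _ _ _ \<sigma>]) (use \<tau>\<sigma> \<tau>M sM in auto)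
    ultimately have tc: "\<tau> \<in> carrier ?G" by (auto simp: c \<tau>_def)
    have "\<tau> \<otimes>\<^bsub>?G\<^esub> \<sigma> = \<one>\<^bsub>?G\<^esub>"
      unfolding m[OF tc s] galois_group_one using \<tau>\<sigma> by (auto simp: compose_def)
    with tc show ?thesis by blast
  qed
qed

text \<open>Through the isomorphism the elements of \<open>G\<close> become names for the
  automorphisms.\<close>

lemma field_action_of_iso:
  assumes M: "galois_extension M" and h: "h \<in> Group.iso G (galois_group M)"
    and G: "Group.group G" and fin: "finite (carrier G)"
  shows "field_action G M h"
proof -
  interpret Group.group G by (rule G)
  have sM: "subalg M" using M by (simp add: galois_extension_def extension_field_iff_subalg)
  note c = galois_group_carrier[OF sM]
  have hc: "h g \<in> carrier (galois_group M)" if "g \<in> carrier G" for g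
    using h that by (auto simp: Group.iso_def hom_def)
  have him: "h ` carrier G = carrier (galois_group M)" and hinj: "inj_on h (carrier G)"
    using h by (auto simp: Group.iso_def bij_betw_def)
  show ?thesis
  proof
    show "subalg M" by (rule sM)
    show "embedding M (h g)" if "g \<in> carrier G" for g using hc[OF that] by (simp add: c)
    show "h g x \<in> M" if "g \<in> carrier G" "x \<in> M" for g x
      using hc[OF that(1)] that(2) by (auto simp: c bij_betw_def)
    show "h (g \<otimes>\<^bsub>G\<^esub> k) x = h g (h k x)" if "g \<in> carrier G" "k \<in> carrier G" "x \<in> M" for g k x
      using h that hc by (auto simp: Group.iso_def hom_def galois_group_mult[OF sM] compose_def)
    show "g = k" if "g \<in> carrier G" "k \<in> carrier G" "\<And>x. x \<in> M \<Longrightarrow> h g x = h k x" for g k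
    proof -
      have "h g = h k" using hc[OF that(1)] hc[OF that(2)] that(3)
        unfolding c by (intro extensionalityI[of _ M]) auto
      then show ?thesis using inj_onD[OF hinj] that by blast
    qed
    show "finite (carrier G)" by (rule fin)
    show "x \<in> range to_ac" if x: "x \<in> M" "\<And>g. g \<in> carrier G \<Longrightarrow> h g x = x" for x
    proof -
      have "\<sigma> x = x" if s: "\<sigma> \<in> carrier (galois_group M)" for \<sigma>
        using x(2) s unfolding him[symmetric] by (elim imageE) simp
      then show ?thesis using M x(1) unfolding galois_extension_def by blast
    qed
  qed
qed

theorem (in root_of_unity) parameters_of_realizable:
  assumes "galois_realizable TYPE('k) (phi4_221a p)"
  shows "\<exists>a\<^sub>1 a\<^sub>2 a\<^sub>3 :: 'k. independent_mod_powers p [a\<^sub>1, a\<^sub>2, a\<^sub>3] \<and>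
       brauer_trivial (cyclic_algebra p (inverse \<zeta> * a\<^sub>2) a\<^sub>3 \<zeta>) \<and>
       brauer_trivial (cyclic_algebra p a\<^sub>1 (\<zeta> * a\<^sub>3) \<zeta>)"
proof -
  obtain M :: "'k alg_closure set" where M: "galois_extension M" "galois_group M \<cong> phi4_221a p"
    using assms unfolding galois_realizable_def by blast
  have "subalg M" using M(1) by (simp add: galois_extension_def extension_field_iff_subalg)
  then have "Group.group (galois_group M)" by (rule group_galois_group)
  from Group.group.iso_sym[OF this M(2)] have "phi4_221a p \<cong> galois_group M" .
  with phi4_221a_iso_triple_group[OF p_gt_1] have "triple_group p \<cong> galois_group M"
    by (rule Group.iso_trans)
  then obtain h where h: "h \<in> Group.iso (triple_group p) (galois_group M)"
    unfolding is_iso_def by blast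
  have "field_action (triple_group p) M h"
    using M(1) h group_triple_group[OF p_pos] by (rule field_action_of_iso) (simp add: triple_carrier)
  then show ?thesis by (rule parameters_of_action)
qed

section \<open>Hilbert 90 and the radical tower\<close>

context root_of_unity
begin

lemma p_neq_0 [simp]: "p \<noteq> 0"
  using p_gt_1 by simp

abbreviation (input) "K\<^sub>0 \<equiv> range (to_ac :: 'k \<Rightarrow> 'k alg_closure)"

lemma embedding_Z_mult:
  "subalg K \<Longrightarrow> embedding K \<phi> \<Longrightarrow> x \<in> K \<Longrightarrow> \<phi> (Z ^ i * x) = Z ^ i * \<phi> x"
  using embedding_mult[of K \<phi> "Z ^ i" x] embedding_to_ac[of K \<phi> "\<zeta> ^ i"] by (simp add: subalg_power)

lemma funpow_root:
  assumes "subalg K" "embedding K \<phi>" "x \<in> K" "\<phi> x = Z ^ i * x"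
  shows "(\<phi> ^^ n) x = Z ^ (i * n) * x"
proof (induction n)
  case (Suc n)
  have "(\<phi> ^^ Suc n) x = Z ^ (i * n) * (Z ^ i * x)"
    using assms embedding_Z_mult[OF assms(1,2,3), of "i * n"] by (simp add: Suc)
  then show ?case by (simp add: power_add mult_ac)
qed simp

lemma funpow_p_id:
  assumes "subalg K" "embedding K \<phi>" "x \<in> K" "\<phi> x = Z ^ i * x"
  shows "(\<phi> ^^ p) x = x"
  using funpow_root[OF assms, of p] by (simp add: power_mult Z_pow_p)

text \<open>If y^p is fixed, y is scaled by some Z^r, exactly as z^r is; the quotient is fixed and
  \<open>kummer_fixed\<close> applies. Repeated use strips radicals from a multiplicative relation
  one by one.\<close>

lemma kummer_quotient:
  assumes K: "subalg K" and \<phi>: "embedding (adjoin K z) \<phi>"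
    and id: "\<And>x. x \<in> K \<Longrightarrow> \<phi> x = x" and z: "\<phi> z = Z * z" "z ^ p \<in> K" "z \<noteq> 0"
    and y: "y \<in> adjoin K z" "\<phi> (y ^ p) = y ^ p"
  obtains r where "y / z ^ r \<in> K"
proof -
  note S = subalg_adjoin[OF K, of z] and zL = adjoin_gen[OF K, of z]
  have "(\<phi> y) ^ p = y ^ p" using y embedding_power[OF S \<phi>] by simp
  then obtain r where r: "\<phi> y = Z ^ r * y" by (rule root_ratio)
  have fixed: "\<phi> (y / z ^ r) = y / z ^ r"
    using y zL S r z by (simp add: embedding_divide[OF S \<phi>] embedding_power[OF S \<phi>] subalg_power
        power_mult_distrib)
  have "y / z ^ r \<in> adjoin K z" using y(1) zL S by (intro subalg_divide subalg_power)
  from kummer_fixed[OF K \<phi> id z(1,2) this fixed] show ?thesis by (rule that)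
qed

text \<open>Hilbert 90 for a radical extension of the base field; \<open>\<eta> i\<close> is the \<open>i\<close>-th conjugate of \<open>\<eta> 0\<close>.\<close>

lemma hilbert90:
  assumes z: "z \<noteq> 0" and \<eta>: "\<And>i. \<eta> i \<in> adjoin K\<^sub>0 z" "(\<Prod>i<p. \<eta> i) = 1"
    and conj: "\<And>\<phi> i. embedding (adjoin K\<^sub>0 z) \<phi> \<Longrightarrow> \<phi> z = Z * z \<Longrightarrow> \<phi> (\<eta> i) = \<eta> (Suc i)"
  obtains w where "w \<in> adjoin K\<^sub>0 z" "w \<noteq> 0"
    "\<And>\<phi>. embedding (adjoin K\<^sub>0 z) \<phi> \<Longrightarrow> \<phi> z = Z * z \<Longrightarrow> \<phi> w = \<eta> 0 * w"
proof -
  let ?L = "adjoin K\<^sub>0 z"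
  have S: "subalg ?L" by (intro subalg_adjoin subalg_base)
  have zL: "z \<in> ?L" by (intro adjoin_gen subalg_base)
  \<comment> \<open>\<open>b n\<close> is a partial product of the conjugates, and
    \<open>w j\<close> the resolvent of z^j that it defines.\<close>
  define b where "b n = (\<Prod>i<n. \<eta> i)" for n
  define w where "w j = (\<Sum>n<p. b n * (Z ^ n * z) ^ j)" for j
  have bL: "b n \<in> ?L" for n unfolding b_def using S \<eta>(1) by (intro subalg_prod)
  have gL: "(Z ^ n * z) ^ j \<in> ?L" for n j
    using S zL by (intro subalg_power subalg_mult subalg_to_ac)
  have "\<exists>j<p. w j \<noteq> 0"
  proof (rule ccontr)
    assume "\<not> ?thesis"
    then have w0: "w j = 0" if "j < p" for j using that by blast
    have wj: "w j = z ^ j * (\<Sum>n<p. b n * Z ^ (n * j))" for j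
      by (simp add: w_def power_mult_distrib power_mult sum_distrib_left mult_ac)
    have "(\<Sum>n<p. b n * Z ^ (n * j)) = 0" if "j < p" for j
      using w0[OF that] z unfolding wj by simp
    \<comment> \<open>If all resolvents vanished, dividing by z^j and summing over j would leave the
      term n = 0 alone, and this is p because \<open>b 0\<close> is the empty product.\<close>
    then have "(\<Sum>j<p. \<Sum>n<p. b n * Z ^ (n * j)) = 0" by simp
    moreover have "(\<Sum>j<p. \<Sum>n<p. b n * Z ^ (n * j)) = (\<Sum>n<p. b n * (\<Sum>j<p. Z ^ (n * j)))"
      by (subst sum.swap) (simp add: sum_distrib_left)
    moreover have "\<dots> = (\<Sum>n<p. if n = 0 then b n * of_nat p else 0)"
      by (intro sum.cong) (auto simp: Z_sum dest: dvd_imp_le)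
    moreover have "\<dots> = of_nat p" using p_pos by (simp add: b_def)
    ultimately show False by simp
  qed
  then obtain j where j: "w j \<noteq> 0" by blast
  have wL: "w j \<in> ?L" unfolding w_def using S bL gL by (intro subalg_sum subalg_mult)
  have \<eta>0: "\<eta> 0 \<noteq> 0" using \<eta>(2) p_pos by (metis finite_lessThan lessThan_iff prod_zero_iff zero_neq_one)
  \<comment> \<open>The resolvent itself is divided by \<open>\<eta> 0\<close> under \<phi>, so its
    inverse has the required law.\<close>
  have "\<phi> (inverse (w j)) = \<eta> 0 * inverse (w j)" if \<phi>: "embedding ?L \<phi>" "\<phi> z = Z * z" for \<phi>
  proof -
    let ?F = "\<lambda>n. b n * (Z ^ n * z) ^ j"
    have b': "\<eta> 0 * \<phi> (b n) = b (Suc n)" for n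
      unfolding b_def using \<eta>(1) conj[OF \<phi>]
      by (simp add: embedding_prod[OF S \<phi>(1)] prod.lessThan_Suc_shift del: prod.lessThan_Suc)
    have g': "\<phi> ((Z ^ n * z) ^ j) = (Z ^ Suc n * z) ^ j" for n
      using embedding_Z_mult[OF S \<phi>(1) zL] \<phi>(2) S zL
      by (simp add: embedding_power[OF S \<phi>(1)] subalg_mult subalg_power mult_ac)
    have "\<eta> 0 * \<phi> (w j) = (\<Sum>n<p. ?F (Suc n))"
      unfolding w_def using bL gL S
      by (subst embedding_sum[OF S \<phi>(1)])
        (auto simp: embedding_mult[OF S \<phi>(1)] g' sum_distrib_left subalg_mult mult.assoc[symmetric] b')
    also have "\<dots> = w j"
    proof -
      \<comment> \<open>The sum closes up cyclically because the norm and Z^p are both 1.\<close>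
      have "?F p = ?F 0" using \<eta>(2) by (simp add: b_def)
      moreover have "(\<Sum>n<p. ?F n) + ?F p = ?F 0 + (\<Sum>n<p. ?F (Suc n))"
        using sum.lessThan_Suc_shift[of ?F p] unfolding sum.lessThan_Suc .
      ultimately have "(\<Sum>n<p. ?F (Suc n)) + ?F 0 = (\<Sum>n<p. ?F n) + ?F 0" by (simp only: add.commute)
      then show ?thesis unfolding w_def by (simp only: add_right_cancel)
    qed
    finally have "\<phi> (w j) = inverse (\<eta> 0) * w j" using \<eta>0 by (simp add: field_simps)
    then show ?thesis using embedding_inverse[OF S \<phi>(1) wL] by simp
  qed
  then show ?thesis using that[of "inverse (w j)"] j wL S by (simp add: subalg_inverse)
qed

end

text \<open>The element \<open>e\<close> takes the place of d. The laws are required for every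
  embedding of k(t) or k(s) that multiplies the radical by \<zeta>, since such embeddings arise as
  restrictions of different maps in the tower.\<close>

locale radical_tower = root_of_unity p \<zeta> for p :: nat and \<zeta> :: "'k::field" +
  fixes a\<^sub>1 a\<^sub>2 a\<^sub>3 :: 'k and t u s c w e v W V :: "'k alg_closure"
  assumes ind: "independent_mod_powers p [a\<^sub>1, a\<^sub>2, a\<^sub>3]"
    and t: "t ^ p = to_ac a\<^sub>3" and u: "u ^ p = to_ac a\<^sub>2" and s: "s ^ p = to_ac a\<^sub>1"
    and c: "c \<in> adjoin (range to_ac) t" and w: "w \<in> adjoin (range to_ac) t" "w \<noteq> 0"
    and e: "e \<in> adjoin (range to_ac) s" and v: "v \<in> adjoin (range to_ac) s" "v \<noteq> 0"
    and w_conj: "\<And>\<phi>. embedding (adjoin (range to_ac) t) \<phi> \<Longrightarrow> \<phi> t = Z * t \<Longrightarrow> \<phi> w = (c * u) ^ p * w"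
    and c_norm: "\<And>\<phi>. embedding (adjoin (range to_ac) t) \<phi> \<Longrightarrow> \<phi> t = Z * t \<Longrightarrow>
      (\<Prod>i<p. (\<phi> ^^ i) c) * u ^ p = Z"
    and v_conj: "\<And>\<phi>. embedding (adjoin (range to_ac) s) \<phi> \<Longrightarrow> \<phi> s = Z * s \<Longrightarrow> \<phi> v = (e * inverse t) ^ p * v"
    and e_norm: "\<And>\<phi>. embedding (adjoin (range to_ac) s) \<phi> \<Longrightarrow> \<phi> s = Z * s \<Longrightarrow>
      (\<Prod>i<p. (\<phi> ^^ i) e) * inverse t ^ p = Z"
    and W: "W ^ p = w" and V: "V ^ p = v"
begin

definition K\<^sub>1 where "K\<^sub>1 = adjoin K\<^sub>0 t"
definition K\<^sub>2 where "K\<^sub>2 = adjoin K\<^sub>1 u"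
definition K\<^sub>3 where "K\<^sub>3 = adjoin K\<^sub>2 s"
definition K\<^sub>4 where "K\<^sub>4 = adjoin K\<^sub>3 W"
definition K\<^sub>5 where "K\<^sub>5 = adjoin K\<^sub>4 V"

lemma sub [simp]: "subalg K\<^sub>0" "subalg K\<^sub>1" "subalg K\<^sub>2" "subalg K\<^sub>3" "subalg K\<^sub>4" "subalg K\<^sub>5"
  unfolding K\<^sub>1_def K\<^sub>2_def K\<^sub>3_def K\<^sub>4_def K\<^sub>5_def by (intro subalg_adjoin subalg_base)+

lemma mono: "K\<^sub>0 \<subseteq> K\<^sub>1" "K\<^sub>1 \<subseteq> K\<^sub>2" "K\<^sub>2 \<subseteq> K\<^sub>3" "K\<^sub>3 \<subseteq> K\<^sub>4" "K\<^sub>4 \<subseteq> K\<^sub>5"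
  unfolding K\<^sub>1_def K\<^sub>2_def K\<^sub>3_def K\<^sub>4_def K\<^sub>5_def using sub[unfolded K\<^sub>1_def K\<^sub>2_def K\<^sub>3_def K\<^sub>4_def K\<^sub>5_def]
  by (simp_all add: adjoin_superset)

lemma gens: "t \<in> K\<^sub>1" "u \<in> K\<^sub>2" "s \<in> K\<^sub>3" "W \<in> K\<^sub>4" "V \<in> K\<^sub>5"
  unfolding K\<^sub>1_def K\<^sub>2_def K\<^sub>3_def K\<^sub>4_def K\<^sub>5_def using sub[unfolded K\<^sub>1_def K\<^sub>2_def K\<^sub>3_def K\<^sub>4_def K\<^sub>5_def]
  by (simp_all add: adjoin_gen)

lemma F_subset: "adjoin K\<^sub>0 s \<subseteq> K\<^sub>3"
  using mono gens by (intro adjoin_least) auto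

lemma mem [simp]:
  "t \<in> K\<^sub>2" "t \<in> K\<^sub>3" "t \<in> K\<^sub>4" "t \<in> K\<^sub>5" "u \<in> K\<^sub>3" "u \<in> K\<^sub>4" "u \<in> K\<^sub>5" "s \<in> K\<^sub>4" "s \<in> K\<^sub>5" "W \<in> K\<^sub>5"
  "t \<in> K\<^sub>1" "u \<in> K\<^sub>2" "s \<in> K\<^sub>3" "W \<in> K\<^sub>4" "V \<in> K\<^sub>5"
  "c \<in> K\<^sub>1" "c \<in> K\<^sub>3" "c \<in> K\<^sub>4" "c \<in> K\<^sub>5" "w \<in> K\<^sub>1" "w \<in> K\<^sub>3" "w \<in> K\<^sub>4" "w \<in> K\<^sub>5"
  "e \<in> K\<^sub>3" "e \<in> K\<^sub>4" "e \<in> K\<^sub>5" "v \<in> K\<^sub>3" "v \<in> K\<^sub>4" "v \<in> K\<^sub>5"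
  using mono gens F_subset c w v e unfolding K\<^sub>1_def[symmetric] by blast+

lemma nonzero [simp]: "a\<^sub>1 \<noteq> 0" "a\<^sub>2 \<noteq> 0" "a\<^sub>3 \<noteq> 0" "t \<noteq> 0" "u \<noteq> 0" "s \<noteq> 0" "W \<noteq> 0" "V \<noteq> 0"
proof -
  show a: "a\<^sub>1 \<noteq> 0" "a\<^sub>2 \<noteq> 0" "a\<^sub>3 \<noteq> 0" using ind by (auto simp: independent_mod_powers_def)
  have 0: "x \<noteq> 0" if "x ^ p = y" "y \<noteq> 0" for x y :: "'k alg_closure" using that p_pos by (auto simp: power_0_left)
  show "t \<noteq> 0" "u \<noteq> 0" "s \<noteq> 0" "W \<noteq> 0" "V \<noteq> 0"
    using 0[OF t] 0[OF u] 0[OF s] 0[OF W w(2)] 0[OF V v(2)] a by simp_all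
qed

lemma independence:
  assumes "a\<^sub>1 powi i * a\<^sub>2 powi j * a\<^sub>3 powi k = \<kappa> ^ p"
  shows "int p dvd i" "int p dvd j" "int p dvd k"
proof -
  define f where "f n = (if n = 0 then i else if n = 1 then j else k)" for n :: nat
  have "\<kappa> \<noteq> 0" using assms p_pos by (auto simp: power_0_left)
  moreover have "(\<Prod>n<length [a\<^sub>1, a\<^sub>2, a\<^sub>3]. [a\<^sub>1, a\<^sub>2, a\<^sub>3] ! n powi f n) = \<kappa> ^ p"
    using assms by (simp add: f_def numeral_3_eq_3 lessThan_Suc mult_ac)
  ultimately have "int p dvd f n" if "n < 3" for n
    using ind that unfolding independent_mod_powers_def by (metis length_Cons list.size(3) numeral_3_eq_3)
  from this[of 0] this[of 1] this[of 2] show "int p dvd i" "int p dvd j" "int p dvd k"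
    by (simp_all add: f_def)
qed

lemma not_p_dvd_1: "\<not> int p dvd 1"
  using p_gt_1 by simp

lemma t_notin: "t \<notin> K\<^sub>0"
proof
  assume "t \<in> K\<^sub>0"
  then obtain \<kappa> where "a\<^sub>3 = \<kappa> ^ p" using t by (auto simp flip: to_ac_power)
  then show False using independence(3)[of 0 0 1 \<kappa>] not_p_dvd_1 by simp
qed

lemma pow_mem: "t ^ p \<in> K\<^sub>0" "u ^ p \<in> K\<^sub>1" "s ^ p \<in> K\<^sub>2" "W ^ p \<in> K\<^sub>3" "V ^ p \<in> K\<^sub>4"
  by (simp_all add: t u s W V)

lemma emb1: "\<exists>\<phi>. embedding K\<^sub>1 \<phi> \<and> \<phi> t = Z ^ i * t"
  using embedding_extend[OF sub(1) embedding_id(2) pow_mem(1) t_notin, of "Z ^ i * t"]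
  unfolding K\<^sub>1_def by (auto simp: power_mult_distrib Z_pow_p)

lemma emb_base: "embedding K \<phi> \<Longrightarrow> x \<in> K\<^sub>0 \<Longrightarrow> \<phi> x = x"
  by (auto simp: embedding_def)

text \<open>By Kummer theory the only p-th roots of elements of k inside k(t) are the obvious
  ones.\<close>

lemma quotient_K1:
  assumes y: "y \<in> K\<^sub>1" "y ^ p \<in> K\<^sub>0"
  obtains r \<kappa> where "y = to_ac \<kappa> * t ^ r"
proof -
  obtain \<phi> where \<phi>: "embedding K\<^sub>1 \<phi>" "\<phi> t = Z ^ 1 * t" using emb1 by blast
  obtain r where "y / t ^ r \<in> K\<^sub>0"
    by (rule kummer_quotient[OF sub(1) \<phi>(1)[unfolded K\<^sub>1_def], where y = y])
      (use \<phi> y emb_base[OF \<phi>(1)] pow_mem in \<open>auto simp flip: K\<^sub>1_def\<close>)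
  then obtain \<kappa> where "y / t ^ r = to_ac \<kappa>" by auto
  then show ?thesis using that[of \<kappa> r] by (simp add: field_simps)
qed

lemma u_notin: "u \<notin> K\<^sub>1"
proof
  assume "u \<in> K\<^sub>1"
  then obtain r \<kappa> where "u = to_ac \<kappa> * t ^ r" by (rule quotient_K1) (simp add: u)
  then have "to_ac a\<^sub>2 = to_ac (\<kappa> ^ p * a\<^sub>3 ^ r)"
    unfolding u[symmetric] by (simp add: power_mult_distrib flip: t) (simp flip: power_mult add: mult.commute)
  \<comment> \<open>A relation with exponent 1 at \<open>a\<^sub>2\<close>, against
    independence.\<close>
  then have "a\<^sub>1 powi 0 * a\<^sub>2 powi 1 * a\<^sub>3 powi (- int r) = \<kappa> ^ p"
    by (simp only: to_ac_eq_iff) (simp add: power_int_minus field_simps)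
  then show False using independence(2) not_p_dvd_1 by blast
qed

lemma emb2: "\<exists>\<phi>. embedding K\<^sub>2 \<phi> \<and> \<phi> t = Z ^ i * t \<and> \<phi> u = Z ^ j * u"
proof -
  obtain \<phi> where \<phi>: "embedding K\<^sub>1 \<phi>" "\<phi> t = Z ^ i * t" using emb1 by blast
  have "(Z ^ j * u) ^ p = \<phi> (u ^ p)"
    using embedding_to_ac[OF sub(2) \<phi>(1)] by (simp add: power_mult_distrib Z_pow_p u)
  from embedding_extend[OF sub(2) \<phi>(1) pow_mem(2) u_notin this] show ?thesis
    unfolding K\<^sub>2_def[symmetric] using \<phi>(2) by (metis mem(11))
qed

lemma agree1:
  assumes "embedding K \<phi>" "embedding K \<psi>" "K\<^sub>1 \<subseteq> K" "\<phi> t = \<psi> t" "x \<in> K\<^sub>1"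
  shows "\<phi> x = \<psi> x"
  by (rule embedding_adjoin_eq[OF sub(1), of t \<phi> \<psi>])
    (use assms embedding_subset emb_base[OF assms(1)] emb_base[OF assms(2)] in \<open>auto simp flip: K\<^sub>1_def\<close>)

lemma agree2:
  assumes "embedding K \<phi>" "embedding K \<psi>" "K\<^sub>2 \<subseteq> K" "\<phi> t = \<psi> t" "\<phi> u = \<psi> u" "x \<in> K\<^sub>2"
  shows "\<phi> x = \<psi> x"
proof (rule embedding_adjoin_eq[OF sub(2), of u \<phi> \<psi>])
  show "\<phi> x = \<psi> x" if "x \<in> K\<^sub>1" for x using assms mono that by (intro agree1[of K \<phi> \<psi> x]) auto
qed (use assms embedding_subset in \<open>auto simp flip: K\<^sub>2_def\<close>)

lemma agree3:
  assumes "embedding K \<phi>" "embedding K \<psi>" "K\<^sub>3 \<subseteq> K" "\<phi> t = \<psi> t" "\<phi> u = \<psi> u" "\<phi> s = \<psi> s" "x \<in> K\<^sub>3"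
  shows "\<phi> x = \<psi> x"
proof (rule embedding_adjoin_eq[OF sub(3), of s \<phi> \<psi>])
  show "\<phi> x = \<psi> x" if "x \<in> K\<^sub>2" for x using assms mono that by (intro agree2[of K \<phi> \<psi> x]) auto
qed (use assms embedding_subset in \<open>auto simp flip: K\<^sub>3_def\<close>)

lemma agree4:
  assumes "embedding K \<phi>" "embedding K \<psi>" "K\<^sub>4 \<subseteq> K" "\<phi> t = \<psi> t" "\<phi> u = \<psi> u" "\<phi> s = \<psi> s"
    "\<phi> W = \<psi> W" "x \<in> K\<^sub>4"
  shows "\<phi> x = \<psi> x"
proof (rule embedding_adjoin_eq[OF sub(4), of W \<phi> \<psi>])
  show "\<phi> x = \<psi> x" if "x \<in> K\<^sub>3" for x using assms mono that by (intro agree3[of K \<phi> \<psi> x]) auto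
qed (use assms embedding_subset in \<open>auto simp flip: K\<^sub>4_def\<close>)

lemma agree5:
  assumes "embedding K\<^sub>5 \<phi>" "embedding K\<^sub>5 \<psi>" "\<phi> t = \<psi> t" "\<phi> u = \<psi> u" "\<phi> s = \<psi> s"
    "\<phi> W = \<psi> W" "\<phi> V = \<psi> V" "x \<in> K\<^sub>5"
  shows "\<phi> x = \<psi> x"
proof (rule embedding_adjoin_eq[OF sub(5), of V \<phi> \<psi>])
  show "\<phi> x = \<psi> x" if "x \<in> K\<^sub>4" for x using assms mono that by (intro agree4[of K\<^sub>5 \<phi> \<psi> x]) auto
qed (use assms embedding_subset in \<open>auto simp flip: K\<^sub>5_def\<close>)

text \<open>Kummer theory over k(t) and then over k strips from s a power of u and a power of t;
  what remains is a relation with exponent 1 at \<open>a\<^sub>1\<close>.\<close>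

lemma s_notin: "s \<notin> K\<^sub>2"
proof
  assume sK: "s \<in> K\<^sub>2"
  obtain \<phi> where \<phi>: "embedding K\<^sub>2 \<phi>" "\<phi> t = Z ^ 0 * t" "\<phi> u = Z ^ 1 * u" using emb2 by blast
  have id: "\<phi> x = x" if "x \<in> K\<^sub>1" for x
    using agree1[OF \<phi>(1) embedding_id(2) mono(2)] \<phi>(2) that by simp
  obtain q where q: "s / u ^ q \<in> K\<^sub>1"
    by (rule kummer_quotient[OF sub(2) \<phi>(1)[unfolded K\<^sub>2_def], where y = s])
      (use \<phi> id pow_mem sK embedding_to_ac[OF sub(3) \<phi>(1)] in \<open>auto simp: s simp flip: K\<^sub>2_def\<close>)
  have "(s / u ^ q) ^ p = to_ac (a\<^sub>1 / a\<^sub>2 ^ q)"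
    by (simp add: power_divide s flip: power_mult) (simp add: mult.commute[of q] power_mult u)
  then obtain r \<kappa> where "s / u ^ q = to_ac \<kappa> * t ^ r" using quotient_K1[OF q] by blast
  then have "s = to_ac \<kappa> * t ^ r * u ^ q" by (simp add: field_simps)
  then have "s ^ p = to_ac (\<kappa> ^ p * a\<^sub>3 ^ r * a\<^sub>2 ^ q)"
    by (simp add: power_mult_distrib flip: t u) (simp flip: power_mult add: mult.commute)
  then have "a\<^sub>1 = \<kappa> ^ p * a\<^sub>3 ^ r * a\<^sub>2 ^ q" unfolding s by (simp only: to_ac_eq_iff)
  then have "a\<^sub>1 powi 1 * a\<^sub>2 powi (- int q) * a\<^sub>3 powi (- int r) = \<kappa> ^ p"
    by (simp add: power_int_minus field_simps)
  then show False using independence(1) not_p_dvd_1 by blast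
qed

lemma emb3: "\<exists>\<phi>. embedding K\<^sub>3 \<phi> \<and> \<phi> t = Z ^ i * t \<and> \<phi> u = Z ^ j * u \<and> \<phi> s = Z ^ k * s"
proof -
  obtain \<phi> where \<phi>: "embedding K\<^sub>2 \<phi>" "\<phi> t = Z ^ i * t" "\<phi> u = Z ^ j * u" using emb2 by blast
  have "(Z ^ k * s) ^ p = \<phi> (s ^ p)"
    using embedding_to_ac[OF sub(3) \<phi>(1)] by (simp add: power_mult_distrib Z_pow_p s)
  from embedding_extend[OF sub(3) \<phi>(1) pow_mem(3) s_notin this] show ?thesis
    unfolding K\<^sub>3_def[symmetric] using \<phi>(2,3) by (metis mem(1,12))
qed

lemma image3:
  assumes \<phi>: "embedding K \<phi>" "K\<^sub>3 \<subseteq> K" and L: "subalg L" "\<phi> t \<in> L" "\<phi> u \<in> L" "\<phi> s \<in> L"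
  shows "\<phi> ` K\<^sub>3 \<subseteq> L"
proof -
  have 0: "\<phi> ` K\<^sub>0 \<subseteq> L" using emb_base[OF \<phi>(1)] L(1) by (auto simp: subalg_def)
  have 1: "\<phi> ` K\<^sub>1 \<subseteq> L" unfolding K\<^sub>1_def
    using \<phi> mono by (intro embedding_adjoin_image L 0 sub embedding_subset[OF \<phi>(1)]) (auto simp flip: K\<^sub>1_def)
  have 2: "\<phi> ` K\<^sub>2 \<subseteq> L" unfolding K\<^sub>2_def
    using \<phi> mono by (intro embedding_adjoin_image L 1 sub embedding_subset[OF \<phi>(1)]) (auto simp flip: K\<^sub>2_def)
  show ?thesis unfolding K\<^sub>3_def
    using \<phi> mono by (intro embedding_adjoin_image L 2 sub embedding_subset[OF \<phi>(1)]) (auto simp flip: K\<^sub>3_def)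
qed

lemma image5:
  assumes \<phi>: "embedding K\<^sub>5 \<phi>"
    and L: "subalg L" "\<phi> t \<in> L" "\<phi> u \<in> L" "\<phi> s \<in> L" "\<phi> W \<in> L" "\<phi> V \<in> L"
  shows "\<phi> ` K\<^sub>5 \<subseteq> L"
proof -
  have 3: "\<phi> ` K\<^sub>3 \<subseteq> L" using mono by (intro image3[OF \<phi>] L) auto
  have 4: "\<phi> ` K\<^sub>4 \<subseteq> L" unfolding K\<^sub>4_def
    using \<phi> mono by (intro embedding_adjoin_image L 3 sub embedding_subset[OF \<phi>]) (auto simp flip: K\<^sub>4_def)
  show ?thesis unfolding K\<^sub>5_def
    using \<phi> mono by (intro embedding_adjoin_image L 4 sub embedding_subset[OF \<phi>]) (auto simp flip: K\<^sub>5_def)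
qed

lemma conj_w: "embedding K \<phi> \<Longrightarrow> K\<^sub>1 \<subseteq> K \<Longrightarrow> \<phi> t = Z * t \<Longrightarrow> \<phi> w = (c * u * W) ^ p"
  using w_conj[of \<phi>] embedding_subset[of K \<phi> K\<^sub>1] by (simp add: K\<^sub>1_def power_mult_distrib W)

lemma norm_c: "embedding K \<phi> \<Longrightarrow> K\<^sub>1 \<subseteq> K \<Longrightarrow> \<phi> t = Z * t \<Longrightarrow> (\<Prod>i<p. (\<phi> ^^ i) c) * u ^ p = Z"
  using c_norm[of \<phi>] embedding_subset[of K \<phi> K\<^sub>1] by (simp add: K\<^sub>1_def)

lemma conj_v: "embedding K \<phi> \<Longrightarrow> K\<^sub>3 \<subseteq> K \<Longrightarrow> \<phi> s = Z * s \<Longrightarrow> \<phi> v = (e * inverse t * V) ^ p"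
  using v_conj[of \<phi>] embedding_subset[of K \<phi> "adjoin K\<^sub>0 s"] F_subset by (simp add: power_mult_distrib V)

lemma norm_e: "embedding K \<phi> \<Longrightarrow> K\<^sub>3 \<subseteq> K \<Longrightarrow> \<phi> s = Z * s \<Longrightarrow> (\<Prod>i<p. (\<phi> ^^ i) e) * inverse t ^ p = Z"
  using e_norm[of \<phi>] embedding_subset[of K \<phi> "adjoin K\<^sub>0 s"] F_subset by simp

text \<open>The elements \<open>e\<close> and \<open>v\<close> live over k(s) alone, so a map that
  fixes s fixes them whatever it does to t and u.\<close>

lemma fix_F: "embedding K \<phi> \<Longrightarrow> K\<^sub>3 \<subseteq> K \<Longrightarrow> \<phi> s = s \<Longrightarrow> x \<in> adjoin K\<^sub>0 s \<Longrightarrow> \<phi> x = x"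
  by (rule embedding_adjoin_eq[OF sub(1), of s \<phi> "\<lambda>x. x"])
    (auto simp: embedding_id emb_base intro: embedding_subset[OF _ subset_trans[OF F_subset]])

lemma fix_K1: "embedding K \<phi> \<Longrightarrow> K\<^sub>1 \<subseteq> K \<Longrightarrow> \<phi> t = t \<Longrightarrow> x \<in> K\<^sub>1 \<Longrightarrow> \<phi> x = x"
  by (rule agree1[of K \<phi> "\<lambda>x. x"]) (auto simp: embedding_id)

lemma Z_neq_1: "Z \<noteq> 1"
  using Z_pow_eq_1_iff[of 1] p_gt_1 by auto

text \<open>
  If \<open>W\<close> were in \<open>K\<^sub>3\<close>, the automorphism of \<open>K\<^sub>3\<close> with \<open>t \<mapsto> \<zeta> t\<close>, which has order \<open>p\<close>, would
  satisfy \<open>W = \<phi>\<^sup>p W = \<zeta> W\<close>.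
\<close>

lemma W_notin: "W \<notin> K\<^sub>3"
proof
  assume WK: "W \<in> K\<^sub>3"
  obtain \<phi> where \<phi>: "embedding K\<^sub>3 \<phi>" "\<phi> t = Z ^ 1 * t" "\<phi> u = Z ^ 0 * u" "\<phi> s = Z ^ 0 * s"
    using emb3 by blast
  have im: "\<phi> ` K\<^sub>3 \<subseteq> K\<^sub>3" by (rule image3[OF \<phi>(1)]) (use \<phi> in \<open>auto intro: subalg_mult\<close>)
  have "(\<phi> W) ^ p = (c * u * W) ^ p"
    using conj_w[OF \<phi>(1) subset_trans[OF mono(2,3)]] \<phi> embedding_power[OF sub(4) \<phi>(1) WK, of p] by (simp add: W)
  \<comment> \<open>The image of W is known only up to a power of \<zeta>; attached to c, this
    factor disappears from the norm.\<close>
  then obtain r where "\<phi> W = Z ^ r * (c * u * W)" by (rule root_ratio)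
  then have r: "\<phi> W = (Z ^ r * c) * u * W" by (simp add: mult_ac)
  have cc: "(\<phi> ^^ i) (Z ^ r * c) = Z ^ r * (\<phi> ^^ i) c" for i
    by (rule embedding_Z_mult[OF sub(4) embedding_funpow(1)[OF \<phi>(1) im]]) simp
  have "(\<phi> ^^ p) W = (\<Prod>i<p. Z ^ r * (\<phi> ^^ i) c) * u ^ p * W"
    using embedding_cocycle[OF sub(4) \<phi>(1) im _ _ WK _ r, of p] \<phi>(3)
    by (simp add: cc subalg_mult subalg_power)
  also have "\<dots> = Z * W"
    using norm_c[OF \<phi>(1)] mono \<phi>(2) by (auto simp: prod.distrib Z_pow_p)
  also have "(\<phi> ^^ p) W = W"
    using agree3[OF embedding_funpow(1)[OF \<phi>(1) im, of p] embedding_id(2), of W] WK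
      funpow_p_id[OF sub(4) \<phi>(1) _ \<phi>(2)] funpow_p_id[OF sub(4) \<phi>(1) _ \<phi>(3)] funpow_p_id[OF sub(4) \<phi>(1) _ \<phi>(4)]
    by auto
  finally show False using Z_neq_1 by simp
qed

text \<open>The argument for W is repeated with the map that moves only s. It must be defined on the
  field containing W, and can be extended there so as to fix W because it fixes w in k(t).\<close>

lemma V_notin: "V \<notin> K\<^sub>4"
proof
  assume VK: "V \<in> K\<^sub>4"
  obtain \<phi>\<^sub>3 where \<phi>\<^sub>3: "embedding K\<^sub>3 \<phi>\<^sub>3" "\<phi>\<^sub>3 t = Z ^ 0 * t" "\<phi>\<^sub>3 u = Z ^ 0 * u" "\<phi>\<^sub>3 s = Z ^ 1 * s"
    using emb3 by blast
  have "W ^ p = \<phi>\<^sub>3 (W ^ p)" using fix_K1[OF \<phi>\<^sub>3(1), of w] mono \<phi>\<^sub>3(2) by (auto simp: W)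
  from embedding_extend[OF sub(4) \<phi>\<^sub>3(1) pow_mem(4) W_notin this] obtain \<phi> where
    \<phi>: "embedding K\<^sub>4 \<phi>" "\<And>x. x \<in> K\<^sub>3 \<Longrightarrow> \<phi> x = \<phi>\<^sub>3 x" "\<phi> W = W"
    unfolding K\<^sub>4_def[symmetric] by blast
  have g: "\<phi> t = Z ^ 0 * t" "\<phi> u = Z ^ 0 * u" "\<phi> s = Z ^ 1 * s" "\<phi> W = Z ^ 0 * W"
    using \<phi>(2)[of t] \<phi>(2)[of u] \<phi>(2)[of s] \<phi>(3) \<phi>\<^sub>3 by simp_all
  have im3: "\<phi> ` K\<^sub>3 \<subseteq> K\<^sub>4"
    using mono by (intro image3[OF \<phi>(1)]) (auto simp: g intro: subalg_mult)
  have im: "\<phi> ` K\<^sub>4 \<subseteq> K\<^sub>4"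
    unfolding K\<^sub>4_def by (rule embedding_adjoin_image[OF sub(4)]) (use \<phi> im3 in \<open>auto simp flip: K\<^sub>4_def\<close>)
  have "(\<phi> V) ^ p = (e * inverse t * V) ^ p"
    using conj_v[OF \<phi>(1) mono(4)] g embedding_power[OF sub(5) \<phi>(1) VK, of p] by (simp add: V)
  then obtain r where "\<phi> V = Z ^ r * (e * inverse t * V)" by (rule root_ratio)
  then have r: "\<phi> V = (Z ^ r * e) * inverse t * V" by (simp add: mult_ac)
  have cc: "(\<phi> ^^ i) (Z ^ r * e) = Z ^ r * (\<phi> ^^ i) e" for i
    by (rule embedding_Z_mult[OF sub(5) embedding_funpow(1)[OF \<phi>(1) im]]) simp
  have "\<phi> (inverse t) = inverse t" using embedding_inverse[OF sub(5) \<phi>(1), of t] g(1) by simp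
  then have "(\<phi> ^^ p) V = (\<Prod>i<p. Z ^ r * (\<phi> ^^ i) e) * inverse t ^ p * V"
    using embedding_cocycle[OF sub(5) \<phi>(1) im _ _ VK _ r, of p]
    by (simp add: cc subalg_mult subalg_power subalg_inverse)
  also have "\<dots> = Z * V"
    using norm_e[OF \<phi>(1)] mono g(3) by (auto simp: prod.distrib Z_pow_p)
  also have "(\<phi> ^^ p) V = V"
    using agree4[OF embedding_funpow(1)[OF \<phi>(1) im, of p] embedding_id(2), of V] VK
      funpow_p_id[OF sub(5) \<phi>(1) _ g(1)] funpow_p_id[OF sub(5) \<phi>(1) _ g(2)]
      funpow_p_id[OF sub(5) \<phi>(1) _ g(3)] funpow_p_id[OF sub(5) \<phi>(1) _ g(4)]
    by auto
  finally show False using Z_neq_1 by simp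
qed

lemma emb5:
  assumes \<phi>: "embedding K\<^sub>3 \<phi>" and W': "W' ^ p = \<phi> w" and V': "V' ^ p = \<phi> v"
  obtains \<psi> where "embedding K\<^sub>5 \<psi>" "\<forall>x\<in>K\<^sub>3. \<psi> x = \<phi> x" "\<psi> W = W'" "\<psi> V = V'"
proof -
  have "W' ^ p = \<phi> (W ^ p)" using W' by (simp add: W)
  from embedding_extend[OF sub(4) \<phi> pow_mem(4) W_notin this] obtain \<phi>' where
    \<phi>': "embedding K\<^sub>4 \<phi>'" "\<And>x. x \<in> K\<^sub>3 \<Longrightarrow> \<phi>' x = \<phi> x" "\<phi>' W = W'"
    unfolding K\<^sub>4_def[symmetric] by blast
  have "V' ^ p = \<phi>' (V ^ p)" using V' \<phi>'(2)[of v] by (simp add: V)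
  from embedding_extend[OF sub(5) \<phi>'(1) pow_mem(5) V_notin this] obtain \<psi> where
    "embedding K\<^sub>5 \<psi>" "\<And>x. x \<in> K\<^sub>4 \<Longrightarrow> \<psi> x = \<phi>' x" "\<psi> V = V'"
    unfolding K\<^sub>5_def[symmetric] by blast
  then show ?thesis using that[of \<psi>] \<phi>' mono by (metis mem(14) subsetD)
qed

end

section \<open>The Galois group of the tower\<close>

context radical_tower
begin

abbreviation (input) "\<Gamma> \<equiv> galois_group K\<^sub>5"

lemma gal_carrier: "\<sigma> \<in> carrier \<Gamma> \<longleftrightarrow> \<sigma> \<in> extensional K\<^sub>5 \<and> bij_betw \<sigma> K\<^sub>5 K\<^sub>5 \<and> embedding K\<^sub>5 \<sigma>"
  by (rule galois_group_carrier) simp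

lemma gal_mult:
  "\<sigma> \<in> carrier \<Gamma> \<Longrightarrow> \<tau> \<in> carrier \<Gamma> \<Longrightarrow> x \<in> K\<^sub>5 \<Longrightarrow> (\<sigma> \<otimes>\<^bsub>\<Gamma>\<^esub> \<tau>) x = \<sigma> (\<tau> x)"
  by (simp add: galois_group_mult compose_def)

lemma gal_eqI:
  assumes "\<sigma> \<in> carrier \<Gamma>" "\<tau> \<in> carrier \<Gamma>"
    and "\<sigma> t = \<tau> t" "\<sigma> u = \<tau> u" "\<sigma> s = \<tau> s" "\<sigma> W = \<tau> W" "\<sigma> V = \<tau> V"
  shows "\<sigma> = \<tau>"
proof (rule extensionalityI[of _ K\<^sub>5])
  show "\<sigma> x = \<tau> x" if "x \<in> K\<^sub>5" for x
    by (rule agree5[of \<sigma> \<tau>]) (use assms that in \<open>simp_all add: gal_carrier\<close>)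
qed (use assms in \<open>auto simp: gal_carrier\<close>)

text \<open>A self-embedding of finite order is bijective, since one of its powers is the
  inverse.\<close>

lemma gal_restrict:
  assumes \<phi>: "embedding K\<^sub>5 \<phi>" "\<phi> ` K\<^sub>5 \<subseteq> K\<^sub>5" and n: "\<And>x. x \<in> K\<^sub>5 \<Longrightarrow> (\<phi> ^^ Suc n) x = x"
  shows "restrict \<phi> K\<^sub>5 \<in> carrier \<Gamma>"
proof -
  have "bij_betw \<phi> K\<^sub>5 K\<^sub>5"
  proof (rule bij_betwI[of _ _ _ "\<phi> ^^ n"])
    show "\<phi> \<in> K\<^sub>5 \<rightarrow> K\<^sub>5" using \<phi>(2) by auto
    show "(\<phi> ^^ n) \<in> K\<^sub>5 \<rightarrow> K\<^sub>5" using embedding_funpow(2)[OF \<phi>, of n] by auto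
    show "(\<phi> ^^ n) (\<phi> x) = x" if "x \<in> K\<^sub>5" for x using n[OF that] by (simp add: funpow_swap1)
    show "\<phi> ((\<phi> ^^ n) x) = x" if "x \<in> K\<^sub>5" for x using n[OF that] by simp
  qed
  moreover have "embedding K\<^sub>5 (restrict \<phi> K\<^sub>5)"
    using \<phi>(1) by (auto simp: embedding_def subalg_add subalg_mult)
  ultimately show ?thesis by (auto simp: gal_carrier)
qed

lemma gal_pow:
  assumes \<sigma>: "\<sigma> \<in> carrier \<Gamma>" "\<And>x. x \<in> K\<^sub>5 \<Longrightarrow> \<sigma> x = \<phi> x" and x: "x \<in> K\<^sub>5"
  shows "(\<sigma> [^]\<^bsub>\<Gamma>\<^esub> (n::nat)) x = (\<phi> ^^ n) x"
proof -
  interpret G: Group.group \<Gamma> by (rule group_galois_group) simp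
  show ?thesis using x
  proof (induction n arbitrary: x)
    case (Suc n)
    have "\<sigma> x \<in> K\<^sub>5" using \<sigma>(1) Suc.prems by (auto simp: gal_carrier bij_betw_def)
    then show ?case using Suc \<sigma> by (simp add: gal_mult funpow_swap1)
  qed (simp add: galois_group_one)
qed

text \<open>Three automorphisms that satisfy the relations define a homomorphism from the model. It
  is injective because the radicals detect all exponents, and surjective because any automorphism
  can be matched first on t, u, s and then corrected on W and V; no group order is computed.\<close>

theorem galois_group_iso: "galois_extension K\<^sub>5" "triple_group p \<cong> galois_group K\<^sub>5"
proof -
  interpret G: Group.group \<Gamma> by (rule group_galois_group) simp
  let ?H = "triple_group p"
  have K13: "K\<^sub>1 \<subseteq> K\<^sub>3" and K15: "K\<^sub>1 \<subseteq> K\<^sub>5" and K35: "K\<^sub>3 \<subseteq> K\<^sub>5" using mono by blast+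

  obtain \<alpha> where \<alpha>: "embedding K\<^sub>5 \<alpha>" "\<alpha> t = Z * t" "\<alpha> u = u" "\<alpha> s = s" "\<alpha> W = c * u * W" "\<alpha> V = V"
  proof -
    obtain \<phi> where \<phi>: "embedding K\<^sub>3 \<phi>" "\<phi> t = Z ^ 1 * t" "\<phi> u = Z ^ 0 * u" "\<phi> s = Z ^ 0 * s" using emb3 by blast
    \<comment> \<open>The image of W has to be a p-th root of the image of w. The root c u W
      reproduces the law of the eigenvector w in the other direction of the theorem.\<close>
    have "(c * u * W) ^ p = \<phi> w" using conj_w[OF \<phi>(1) K13] \<phi>(2) by simp
    moreover have "V ^ p = \<phi> v" using fix_F[OF \<phi>(1), of v] \<phi>(4) v by (simp add: V)
    ultimately obtain \<psi> where "embedding K\<^sub>5 \<psi>" "\<forall>x\<in>K\<^sub>3. \<psi> x = \<phi> x" "\<psi> W = c * u * W" "\<psi> V = V"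
      by (rule emb5[OF \<phi>(1)])
    with \<phi> that show ?thesis by simp
  qed
  obtain \<beta> where \<beta>: "embedding K\<^sub>5 \<beta>" "\<beta> t = t" "\<beta> u = u" "\<beta> s = Z * s" "\<beta> W = W" "\<beta> V = e * inverse t * V"
  proof -
    obtain \<phi> where \<phi>: "embedding K\<^sub>3 \<phi>" "\<phi> t = Z ^ 0 * t" "\<phi> u = Z ^ 0 * u" "\<phi> s = Z ^ 1 * s" using emb3 by blast
    have "W ^ p = \<phi> w" using fix_K1[OF \<phi>(1) K13, of w] \<phi>(2) by (simp add: W)
    moreover have "(e * inverse t * V) ^ p = \<phi> v" using conj_v[OF \<phi>(1)] \<phi>(4) by simp
    ultimately obtain \<psi> where "embedding K\<^sub>5 \<psi>" "\<forall>x\<in>K\<^sub>3. \<psi> x = \<phi> x" "\<psi> W = W" "\<psi> V = e * inverse t * V"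
      by (rule emb5[OF \<phi>(1)])
    with \<phi> that show ?thesis by simp
  qed
  obtain \<gamma> where \<gamma>: "embedding K\<^sub>5 \<gamma>" "\<gamma> t = t" "\<gamma> u = Z * u" "\<gamma> s = s" "\<gamma> W = W" "\<gamma> V = V"
  proof -
    obtain \<phi> where \<phi>: "embedding K\<^sub>3 \<phi>" "\<phi> t = Z ^ 0 * t" "\<phi> u = Z ^ 1 * u" "\<phi> s = Z ^ 0 * s" using emb3 by blast
    have "W ^ p = \<phi> w" using fix_K1[OF \<phi>(1) K13, of w] \<phi>(2) by (simp add: W)
    moreover have "V ^ p = \<phi> v" using fix_F[OF \<phi>(1), of v] \<phi>(4) v by (simp add: V)
    ultimately obtain \<psi> where "embedding K\<^sub>5 \<psi>" "\<forall>x\<in>K\<^sub>3. \<psi> x = \<phi> x" "\<psi> W = W" "\<psi> V = V"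
      by (rule emb5[OF \<phi>(1)])
    with \<phi> that show ?thesis by simp
  qed
  have \<alpha>im: "\<alpha> ` K\<^sub>5 \<subseteq> K\<^sub>5" by (rule image5) (simp_all add: \<alpha> subalg_mult)
  have \<beta>im: "\<beta> ` K\<^sub>5 \<subseteq> K\<^sub>5" by (rule image5) (simp_all add: \<beta> subalg_mult subalg_inverse)
  have \<gamma>im: "\<gamma> ` K\<^sub>5 \<subseteq> K\<^sub>5" by (rule image5) (simp_all add: \<gamma> subalg_mult)
  have \<alpha>n: "(\<alpha> ^^ n) t = Z ^ n * t" "(\<alpha> ^^ n) u = u" "(\<alpha> ^^ n) s = s" "(\<alpha> ^^ n) V = V" for n
    using funpow_root[OF sub(6) \<alpha>(1), of t 1 n] funpow_root[OF sub(6) \<alpha>(1), of _ 0 n] by (simp_all add: \<alpha>)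
  have \<beta>n: "(\<beta> ^^ n) t = t" "(\<beta> ^^ n) u = u" "(\<beta> ^^ n) s = Z ^ n * s" "(\<beta> ^^ n) W = W" for n
    using funpow_root[OF sub(6) \<beta>(1), of s 1 n] funpow_root[OF sub(6) \<beta>(1), of _ 0 n] by (simp_all add: \<beta>)
  have \<gamma>n: "(\<gamma> ^^ n) t = t" "(\<gamma> ^^ n) u = Z ^ n * u" "(\<gamma> ^^ n) s = s" "(\<gamma> ^^ n) W = W" "(\<gamma> ^^ n) V = V" for n
    using funpow_root[OF sub(6) \<gamma>(1), of u 1 n] funpow_root[OF sub(6) \<gamma>(1), of _ 0 n] by (simp_all add: \<gamma>)
  \<comment> \<open>Iteration produces the norm of c times u^p, which is \<zeta>. So the p-th power
    of \<alpha> moves W alone among the five radicals.\<close>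
  have \<alpha>W: "(\<alpha> ^^ p) W = Z * W"
    using embedding_cocycle[OF sub(6) \<alpha>(1) \<alpha>im _ _ _ \<alpha>(3,5), of p] norm_c[OF \<alpha>(1) K15 \<alpha>(2)] by simp
  have \<beta>t: "\<beta> (inverse t) = inverse t" using embedding_inverse[OF sub(6) \<beta>(1), of t] \<beta>(2) by simp
  have \<beta>V: "(\<beta> ^^ p) V = Z * V"
    using embedding_cocycle[OF sub(6) \<beta>(1) \<beta>im _ _ _ \<beta>t \<beta>(6), of p] norm_e[OF \<beta>(1) K35 \<beta>(4)]
    by (simp add: subalg_inverse)
  have \<alpha>Wm: "(\<alpha> ^^ (p * m)) W = Z ^ m * W" for m
    using funpow_root[OF sub(6) embedding_funpow(1)[OF \<alpha>(1) \<alpha>im, of p], of W 1 m] \<alpha>W by (simp add: funpow_mult)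
  have \<beta>Vm: "(\<beta> ^^ (p * m)) V = Z ^ m * V" for m
    using funpow_root[OF sub(6) embedding_funpow(1)[OF \<beta>(1) \<beta>im, of p], of V 1 m] \<beta>V by (simp add: funpow_mult)
  have \<alpha>p2: "(\<alpha> ^^ p\<^sup>2) g = g" if "g \<in> K\<^sub>5" for g
    using agree5[OF embedding_funpow(1)[OF \<alpha>(1) \<alpha>im] embedding_id(2) _ _ _ _ _ that, of "p\<^sup>2"]
    by (simp add: \<alpha>n power2_eq_square \<alpha>Wm power_mult)
  have \<beta>p2: "(\<beta> ^^ p\<^sup>2) g = g" if "g \<in> K\<^sub>5" for g
    using agree5[OF embedding_funpow(1)[OF \<beta>(1) \<beta>im] embedding_id(2) _ _ _ _ _ that, of "p\<^sup>2"]
    by (simp add: \<beta>n power2_eq_square \<beta>Vm power_mult)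
  have \<gamma>p: "(\<gamma> ^^ p) g = g" if "g \<in> K\<^sub>5" for g
    using agree5[OF embedding_funpow(1)[OF \<gamma>(1) \<gamma>im] embedding_id(2) _ _ _ _ _ that, of p]
    by (simp add: \<gamma>n)
  define x y z where "x = restrict \<alpha> K\<^sub>5" and "y = restrict \<beta> K\<^sub>5" and "z = restrict \<gamma> K\<^sub>5"
  have "Suc (p\<^sup>2 - 1) = p\<^sup>2" "Suc (p - 1) = p" by simp_all
  then have xyz [simp]: "x \<in> carrier \<Gamma>" "y \<in> carrier \<Gamma>" "z \<in> carrier \<Gamma>"
    unfolding x_def y_def z_def
    using gal_restrict[OF \<alpha>(1) \<alpha>im, of "p\<^sup>2 - 1"] gal_restrict[OF \<beta>(1) \<beta>im, of "p\<^sup>2 - 1"]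
      gal_restrict[OF \<gamma>(1) \<gamma>im, of "p - 1"] \<alpha>p2 \<beta>p2 \<gamma>p by metis+
  have xn: "(x [^]\<^bsub>\<Gamma>\<^esub> n) g = (\<alpha> ^^ n) g" and yn: "(y [^]\<^bsub>\<Gamma>\<^esub> n) g = (\<beta> ^^ n) g"
    and zn: "(z [^]\<^bsub>\<Gamma>\<^esub> n) g = (\<gamma> ^^ n) g" if "g \<in> K\<^sub>5" for n :: nat and g
    by (rule gal_pow; use xyz that in \<open>simp add: x_def y_def z_def\<close>)+
  have x: "x g = \<alpha> g" and y: "y g = \<beta> g" and z: "z g = \<gamma> g" if "g \<in> K\<^sub>5" for g
    using that by (simp_all add: x_def y_def z_def)
  have Zm [simp]: "Z * g \<in> K\<^sub>5" "Z ^ n * g \<in> K\<^sub>5" if "g \<in> K\<^sub>5" for g n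
    using that by (simp_all add: subalg_mult subalg_power)
  have cuW [simp]: "c * u * W \<in> K\<^sub>5" and etV [simp]: "e * inverse t * V \<in> K\<^sub>5"
    by (simp_all add: subalg_mult subalg_inverse)
  have \<alpha>Z: "\<alpha> (Z ^ n * g) = Z ^ n * \<alpha> g" and \<beta>Z: "\<beta> (Z ^ n * g) = Z ^ n * \<beta> g"
    and \<gamma>Z: "\<gamma> (Z ^ n * g) = Z ^ n * \<gamma> g" if "g \<in> K\<^sub>5" for g n
    using that by (auto intro: embedding_Z_mult[OF sub(6)] \<alpha>(1) \<beta>(1) \<gamma>(1))
  have \<alpha>Z1: "\<alpha> (Z * g) = Z * \<alpha> g" and \<beta>Z1: "\<beta> (Z * g) = Z * \<beta> g" and \<gamma>Z1: "\<gamma> (Z * g) = Z * \<gamma> g"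
    if "g \<in> K\<^sub>5" for g
    using embedding_Z_mult[OF sub(6) \<alpha>(1) that, of 1] embedding_Z_mult[OF sub(6) \<beta>(1) that, of 1]
      embedding_Z_mult[OF sub(6) \<gamma>(1) that, of 1] by simp_all
  have \<beta>c: "\<beta> c = c" and \<gamma>c: "\<gamma> c = c"
    using fix_K1[OF \<beta>(1) K15 \<beta>(2), of c] fix_K1[OF \<gamma>(1) K15 \<gamma>(2), of c] by simp_all
  have \<alpha>e: "\<alpha> e = e" and \<gamma>e: "\<gamma> e = e"
    using fix_F[OF \<alpha>(1) K35 \<alpha>(4) e] fix_F[OF \<gamma>(1) K35 \<gamma>(4) e] by simp_all
  have \<beta>cuW: "\<beta> (c * u * W) = c * u * W"
    by (simp add: embedding_mult[OF sub(6) \<beta>(1)] subalg_mult \<beta> \<beta>c)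
  \<comment> \<open>The factor u in the image of W makes \<gamma> and \<alpha> commute only up to
    the p-th power of \<alpha>. The factor t^-1 in the image of V likewise brings in the p-th power
    of \<beta>.\<close>
  have \<gamma>cuW: "\<gamma> (c * u * W) = Z * (c * u * W)"
    by (simp add: embedding_mult[OF sub(6) \<gamma>(1)] subalg_mult \<gamma> \<gamma>c)
  have \<alpha>etV: "\<alpha> (e * inverse t * V) = inverse Z * (e * inverse t * V)"
    by (simp add: embedding_mult[OF sub(6) \<alpha>(1)] embedding_inverse[OF sub(6) \<alpha>(1)] subalg_mult subalg_inverse \<alpha> \<alpha>e)
  have \<gamma>etV: "\<gamma> (e * inverse t * V) = e * inverse t * V"
    by (simp add: embedding_mult[OF sub(6) \<gamma>(1)] embedding_inverse[OF sub(6) \<gamma>(1)] subalg_mult subalg_inverse \<gamma> \<gamma>e)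
  have \<beta>p: "(\<beta> ^^ p) (Z * s) = Z * s" "(\<beta> ^^ p) (e * inverse t * V) = Z * (e * inverse t * V)"
    using \<beta>n(3)[of p] \<beta>Z1[of s] \<beta>Z1[of V] \<beta>V funpow_swap1[of \<beta> p s] funpow_swap1[of \<beta> p V] by (simp_all add: \<beta>)
  have "(\<alpha> ^^ p) (Z ^ 1 * u) = Z ^ 1 * (\<alpha> ^^ p) u"
    by (rule embedding_Z_mult[OF sub(6) embedding_funpow(1)[OF \<alpha>(1) \<alpha>im]]) simp
  then have \<alpha>p: "(\<alpha> ^^ p) (Z * t) = Z * t" "(\<alpha> ^^ p) (Z * u) = Z * u" "(\<alpha> ^^ p) (c * u * W) = Z * (c * u * W)"
    using \<alpha>n(1,2)[of p] \<alpha>Z1[of t] \<alpha>Z1[of W] \<alpha>W funpow_swap1[of \<alpha> p t] funpow_swap1[of \<alpha> p W]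
    by (simp_all add: \<alpha>)
  have yx: "y \<otimes>\<^bsub>\<Gamma>\<^esub> x = x \<otimes>\<^bsub>\<Gamma>\<^esub> y [^]\<^bsub>\<Gamma>\<^esub> (1 + p)"
    by (rule gal_eqI)
      (simp_all add: gal_mult yn \<beta>n \<beta>V x y \<alpha> \<beta> \<alpha>Z1 \<beta>Z1 \<beta>cuW \<alpha>etV \<beta>p)
  have zx: "z \<otimes>\<^bsub>\<Gamma>\<^esub> x = x [^]\<^bsub>\<Gamma>\<^esub> (1 + p) \<otimes>\<^bsub>\<Gamma>\<^esub> z"
    by (rule gal_eqI)
      (simp_all add: gal_mult xn \<alpha>n \<alpha>W x z \<alpha> \<gamma> \<alpha>Z1 \<gamma>Z1 \<gamma>cuW \<alpha>p)
  have zy: "z \<otimes>\<^bsub>\<Gamma>\<^esub> y = y \<otimes>\<^bsub>\<Gamma>\<^esub> z"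
    by (rule gal_eqI) (simp_all add: gal_mult y z \<beta> \<gamma> \<beta>Z1 \<gamma>Z1 \<gamma>etV)
  have one: "\<one>\<^bsub>\<Gamma>\<^esub> g = g" if "g \<in> K\<^sub>5" for g using that by (simp add: galois_group_one)
  have x1: "x [^]\<^bsub>\<Gamma>\<^esub> p\<^sup>2 = \<one>\<^bsub>\<Gamma>\<^esub>" and y1: "y [^]\<^bsub>\<Gamma>\<^esub> p\<^sup>2 = \<one>\<^bsub>\<Gamma>\<^esub>" and z1: "z [^]\<^bsub>\<Gamma>\<^esub> p = \<one>\<^bsub>\<Gamma>\<^esub>"
    by (rule gal_eqI; simp add: xn yn zn \<alpha>p2 \<beta>p2 \<gamma>p one)+
  define f where "f = (\<lambda>(i :: nat, j :: nat, k :: nat). x [^]\<^bsub>\<Gamma>\<^esub> i \<otimes>\<^bsub>\<Gamma>\<^esub> y [^]\<^bsub>\<Gamma>\<^esub> j \<otimes>\<^bsub>\<Gamma>\<^esub> z [^]\<^bsub>\<Gamma>\<^esub> k)"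
  have f: "f \<in> hom ?H \<Gamma>"
    unfolding f_def by (rule G.triple_hom) (use yx zx zy x1 y1 z1 in auto)
  have gh: "group_hom ?H \<Gamma> f"
    by (intro group_hom.intro group_hom_axioms.intro group_triple_group p_pos G.group_axioms f)
  note f_closed = group_hom.hom_closed[OF gh]
  have f_app: "f (i, j, k) g = (\<alpha> ^^ i) ((\<beta> ^^ j) ((\<gamma> ^^ k) g))" if "g \<in> K\<^sub>5" for i j k g
  proof -
    have "(\<gamma> ^^ k) g \<in> K\<^sub>5" using embedding_funpow(2)[OF \<gamma>(1) \<gamma>im] that by blast
    moreover from this have "(\<beta> ^^ j) ((\<gamma> ^^ k) g) \<in> K\<^sub>5" using embedding_funpow(2)[OF \<beta>(1) \<beta>im] by blast
    ultimately show ?thesis using that by (simp add: f_def gal_mult xn yn zn)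
  qed
  have \<alpha>nZ: "(\<alpha> ^^ m) (Z ^ n * g) = Z ^ n * (\<alpha> ^^ m) g" and \<beta>nZ: "(\<beta> ^^ m) (Z ^ n * g) = Z ^ n * (\<beta> ^^ m) g"
    if "g \<in> K\<^sub>5" for m n g
    using that embedding_funpow(1)[OF \<alpha>(1) \<alpha>im] embedding_funpow(1)[OF \<beta>(1) \<beta>im]
    by (auto intro: embedding_Z_mult[OF sub(6)])
  have f_t: "f (i, j, k) t = Z ^ i * t" and f_s: "f (i, j, k) s = Z ^ j * s" and f_u: "f (i, j, k) u = Z ^ k * u" for i j k
    by (simp_all add: f_app \<gamma>n \<beta>n \<alpha>n \<alpha>nZ \<beta>nZ)
  have p2: "p < p\<^sup>2" "1 < p\<^sup>2" using p_gt_1 by (auto simp: power2_eq_square intro: less_trans)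
  \<comment> \<open>t, s and u detect the exponents modulo p; once i and j are multiples of p, W and
    V detect the quotients modulo p.\<close>
  have inj: "inj_on f (carrier ?H)"
  proof (rule group_hom.inj_on_one_iff[OF gh, THEN iffD2], intro allI impI)
    fix g assume g: "g \<in> carrier ?H" "f g = \<one>\<^bsub>\<Gamma>\<^esub>"
    obtain i j k where gg: "g = (i, j, k)" "i < p\<^sup>2" "j < p\<^sup>2" "k < p" using g by (auto simp: triple_carrier)
    have "Z ^ i = 1" "Z ^ j = 1" "Z ^ k = 1"
      using f_t[of i j k] f_s[of i j k] f_u[of i j k] g(2) by (simp_all add: gg one)
    then have d: "p dvd i" "p dvd j" "p dvd k" by (simp_all add: Z_pow_eq_1_iff)
    then have k: "k = 0" using gg(4) by (auto dest: dvd_imp_le)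
    obtain m n where mn: "i = p * m" "j = p * n" using d by (auto simp: dvd_def)
    have "Z ^ m = 1" using f_app[of W i j k] g(2) by (simp add: gg one mn \<gamma>n \<beta>n \<alpha>Wm)
    moreover have "Z ^ n = 1" using f_app[of V i j k] g(2) by (simp add: gg one mn \<gamma>n \<beta>Vm \<alpha>nZ \<alpha>n)
    ultimately have "p\<^sup>2 dvd i" "p\<^sup>2 dvd j" by (simp_all add: Z_pow_eq_1_iff mn power2_eq_square)
    then have "i = 0" "j = 0" using gg by (auto dest: dvd_imp_le)
    then show "g = \<one>\<^bsub>?H\<^esub>" by (simp add: gg k triple_one)
  qed
  have sub_im: "subgroup (f ` carrier ?H) \<Gamma>" by (rule group_hom.img_is_subgroup[OF gh])
  have f100: "f (1, 0, 0) = x" and f010: "f (0, 1, 0) = y" by (simp_all add: f_def)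
  have xy_im: "x \<in> f ` carrier ?H" "y \<in> f ` carrier ?H"
    using p2 p_gt_1 by (auto simp: triple_carrier simp flip: f100 f010 intro!: imageI)
  have pow_im: "g [^]\<^bsub>\<Gamma>\<^esub> (n::nat) \<in> f ` carrier ?H" if "g \<in> f ` carrier ?H" for g n
    using that by (induction n) (auto intro: subgroup.one_closed[OF sub_im] subgroup.m_closed[OF sub_im])
  have surj: "\<rho> \<in> f ` carrier ?H" if \<rho>: "\<rho> \<in> carrier \<Gamma>" for \<rho>
  proof -
    have \<rho>e: "embedding K\<^sub>5 \<rho>" using \<rho> by (simp add: gal_carrier)
    have root: "\<exists>i<p. \<rho> g = Z ^ i * \<kappa> g"
      if "g \<in> K\<^sub>5" "\<rho> (g ^ p) = \<kappa> (g ^ p)" "embedding K\<^sub>5 \<kappa>" for g \<kappa>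
    proof -
      have "(\<rho> g) ^ p = (\<kappa> g) ^ p"
        using that embedding_power[OF sub(6) \<rho>e] embedding_power[OF sub(6) that(3)] by simp
      then obtain i where "i < p" "\<rho> g = Z ^ i * \<kappa> g" by (rule root_ratio)
      then show ?thesis by blast
    qed
    have base: "\<rho> (to_ac b) = to_ac b" for b using \<rho>e by (simp add: embedding_def)
    obtain i where i: "i < p" "\<rho> t = Z ^ i * t"
      using root[of t "\<lambda>x. x"] base by (auto simp: t embedding_id)
    obtain j where j: "j < p" "\<rho> s = Z ^ j * s"
      using root[of s "\<lambda>x. x"] base by (auto simp: s embedding_id)
    obtain k where k: "k < p" "\<rho> u = Z ^ k * u"
      using root[of u "\<lambda>x. x"] base by (auto simp: u embedding_id)
    define \<kappa> where "\<kappa> = f (i, j, k)"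
    have ijk: "(i, j, k) \<in> carrier ?H" using i j k p2 by (auto simp: triple_carrier)
    have \<kappa>: "\<kappa> \<in> carrier \<Gamma>" unfolding \<kappa>_def using ijk by (rule f_closed)
    then have \<kappa>e: "embedding K\<^sub>5 \<kappa>" by (simp add: gal_carrier)
    have eq3: "\<rho> g = \<kappa> g" if "g \<in> K\<^sub>3" for g
      using agree3[OF \<rho>e \<kappa>e K35 _ _ _ that] i j k by (simp add: \<kappa>_def f_t f_s f_u)
    obtain m where m: "\<rho> W = Z ^ m * \<kappa> W" using root[of W \<kappa>] eq3[of w] \<kappa>e by (auto simp: W)
    obtain n where n: "\<rho> V = Z ^ n * \<kappa> V" using root[of V \<kappa>] eq3[of v] \<kappa>e by (auto simp: V)
    have \<kappa>Z: "\<kappa> (Z ^ l * g) = Z ^ l * \<kappa> g" if "g \<in> K\<^sub>5" for l g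
      using embedding_Z_mult[OF sub(6) \<kappa>e that] .
    \<comment> \<open>What separates \<rho> from \<kappa> is a power of \<zeta> on W and one on V.
      Powers of x and y with exponents divisible by p supply these and leave the other radicals
      alone.\<close>
    have "\<rho> = \<kappa> \<otimes>\<^bsub>\<Gamma>\<^esub> (x [^]\<^bsub>\<Gamma>\<^esub> (p * m) \<otimes>\<^bsub>\<Gamma>\<^esub> y [^]\<^bsub>\<Gamma>\<^esub> (p * n))"
      by (rule gal_eqI)
        (simp_all add: \<rho> \<kappa> gal_mult xn yn \<alpha>n \<beta>n \<alpha>Wm \<beta>Vm \<alpha>nZ \<kappa>Z m n eq3 power_mult)
    moreover have "\<kappa> \<in> f ` carrier ?H" unfolding \<kappa>_def using ijk by (rule imageI)
    ultimately show ?thesis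
      using pow_im xy_im by (auto intro!: subgroup.m_closed[OF sub_im])
  qed
  have "f ` carrier ?H \<subseteq> carrier \<Gamma>" using f_closed by blast
  then have "f ` carrier ?H = carrier \<Gamma>" using surj by blast
  with f inj have "f \<in> Group.iso ?H \<Gamma>" by (simp add: iso_iff)
  then show "?H \<cong> \<Gamma>" by (rule is_isoI)

  \<comment> \<open>A fixed element descends the tower one radical at a time. At each level some
    automorphism fixes the field below and scales the radical by \<zeta>: the p-th powers of \<beta>
    and \<alpha> for V and W, then \<beta>, \<gamma> and \<alpha> for s, u and t.\<close>
  have fixed: "g \<in> K\<^sub>0" if g: "g \<in> K\<^sub>5" "\<And>\<sigma>. \<sigma> \<in> carrier \<Gamma> \<Longrightarrow> \<sigma> g = g" for g
  proof -
    have \<beta>pe: "embedding K\<^sub>5 (\<beta> ^^ p)" and \<alpha>pe: "embedding K\<^sub>5 (\<alpha> ^^ p)"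
      using embedding_funpow(1) \<alpha>(1) \<alpha>im \<beta>(1) \<beta>im by blast+
    have gx: "\<alpha> g = g" "\<beta> g = g" "\<gamma> g = g" using g(2)[of x] g(2)[of y] g(2)[of z] x[OF g(1)] y[OF g(1)] z[OF g(1)] by simp_all
    have gp: "(\<alpha> ^^ n) g = g" "(\<beta> ^^ n) g = g" for n by (induction n; simp add: gx)+
    have "(\<beta> ^^ p) h = h" if "h \<in> K\<^sub>4" for h
      using agree4[OF \<beta>pe embedding_id(2) mono(5) _ _ _ _ that] by (simp add: \<beta>n)
    from kummer_fixed[OF sub(5) \<beta>pe[unfolded K\<^sub>5_def] this \<beta>V pow_mem(5) g(1)[unfolded K\<^sub>5_def] gp(2)]
    have 4: "g \<in> adjoin K\<^sub>3 W" by (simp only: K\<^sub>4_def)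
    have "(\<alpha> ^^ p) h = h" if "h \<in> K\<^sub>3" for h
      using agree3[OF \<alpha>pe embedding_id(2) K35 _ _ _ that] by (simp add: \<alpha>n)
    from kummer_fixed[OF sub(4) embedding_subset[OF \<alpha>pe mono(5), unfolded K\<^sub>4_def] this \<alpha>W pow_mem(4) 4 gp(1)]
    have 3: "g \<in> adjoin K\<^sub>2 s" by (simp only: K\<^sub>3_def)
    have "\<beta> h = h" if "h \<in> K\<^sub>2" for h
      using agree2[OF \<beta>(1) embedding_id(2) subset_trans[OF mono(3) K35] _ _ that] by (simp add: \<beta>)
    from kummer_fixed[OF sub(3) embedding_subset[OF \<beta>(1) K35, unfolded K\<^sub>3_def] this \<beta>(4) pow_mem(3) 3 gx(2)]
    have 2: "g \<in> adjoin K\<^sub>1 u" by (simp only: K\<^sub>2_def)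
    from kummer_fixed[OF sub(2) embedding_subset[OF \<gamma>(1) subset_trans[OF mono(3) K35], unfolded K\<^sub>2_def]
      fix_K1[OF \<gamma>(1) K15 \<gamma>(2)] \<gamma>(3) pow_mem(2) 2 gx(3)]
    have 1: "g \<in> adjoin K\<^sub>0 t" by (simp only: K\<^sub>1_def)
    from kummer_fixed[OF sub(1) embedding_subset[OF \<alpha>(1) K15, unfolded K\<^sub>1_def] emb_base[OF \<alpha>(1)]
      \<alpha>(2) pow_mem(1) 1 gx(1)]
    show "g \<in> K\<^sub>0" .
  qed
  have "\<sigma> h = h" if "\<sigma> \<in> carrier \<Gamma>" "h \<in> K\<^sub>0" for \<sigma> h
    using that emb_base[of K\<^sub>5 \<sigma> h] by (simp add: gal_carrier)
  moreover have "K\<^sub>0 \<subseteq> K\<^sub>5" using mono by blast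
  ultimately have eq: "{g \<in> K\<^sub>5. \<forall>\<sigma>\<in>carrier \<Gamma>. \<sigma> g = g} = K\<^sub>0" using fixed by blast
  show "galois_extension K\<^sub>5"
    unfolding galois_extension_def extension_field_iff_subalg by (rule conjI[OF sub(6) eq])
qed

end

section \<open>The tower attached to a pair of split algebras\<close>

context root_of_unity
begin

theorem realizable_of_parameters:
  fixes a\<^sub>1 a\<^sub>2 a\<^sub>3 :: 'k
  assumes ind: "independent_mod_powers p [a\<^sub>1, a\<^sub>2, a\<^sub>3]"
    and 1: "brauer_trivial (cyclic_algebra p (inverse \<zeta> * a\<^sub>2) a\<^sub>3 \<zeta>)"
    and 2: "brauer_trivial (cyclic_algebra p a\<^sub>1 (\<zeta> * a\<^sub>3) \<zeta>)"
  shows "galois_realizable TYPE('k) (phi4_221a p)"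
proof -
  have npow: "c ^ p \<noteq> a\<^sub>1" "c ^ p \<noteq> a\<^sub>3" for c
    using independent_not_power[OF ind, of 0 c] independent_not_power[OF ind, of 2 c] p_gt_1 by auto
  have nz: "a\<^sub>1 \<noteq> 0" "a\<^sub>2 \<noteq> 0" "a\<^sub>3 \<noteq> 0" using ind by (auto simp: independent_mod_powers_def)
  have root: "\<exists>z. z ^ p = b" for b :: "'k alg_closure" using nth_root_exists[of p b] p_pos by blast
  obtain t u s where tus: "t ^ p = to_ac a\<^sub>3" "u ^ p = to_ac a\<^sub>2" "s ^ p = to_ac a\<^sub>1" using root by metis
  have tus0: "t \<noteq> 0" "s \<noteq> 0" using tus nz by (auto simp: power_0_left)
  obtain f where f: "(\<Prod>i<p. poly (map_poly to_ac f) (Z ^ i * t)) = to_ac (inverse \<zeta> * a\<^sub>2)"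
    using norm_of_split_right[OF 1 npow(2) tus(1)] by blast
  obtain f' where f': "(\<Prod>i<p. poly (map_poly to_ac f') (Z ^ i * s)) = to_ac (\<zeta> * a\<^sub>3)"
    using norm_of_split_left[OF 2 npow(1) tus(3)] by blast
  have ev_mem: "poly (map_poly to_ac g) (Z ^ i * y) \<in> adjoin K\<^sub>0 y" for g i y
  proof -
    have S: "subalg (adjoin K\<^sub>0 y)" and y: "y \<in> adjoin K\<^sub>0 y"
      by (intro subalg_adjoin adjoin_gen subalg_base)+
    then show ?thesis by (intro subalg_poly coeffs_in_to_ac subalg_mult subalg_power subalg_to_ac)
  qed
  have ev_conj: "\<phi> (poly (map_poly to_ac g) (Z ^ i * y)) = poly (map_poly to_ac g) (Z ^ Suc i * y)"
    if \<phi>: "embedding (adjoin K\<^sub>0 y) \<phi>" "\<phi> y = Z * y" for \<phi> g i y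
  proof -
    have S: "subalg (adjoin K\<^sub>0 y)" and y: "y \<in> adjoin K\<^sub>0 y"
      by (intro subalg_adjoin adjoin_gen subalg_base)+
    then show ?thesis
      using embedding_poly_to_ac[OF S \<phi>(1), of "Z ^ i * y" g] embedding_Z_mult[OF S \<phi>(1) y, of i] \<phi>(2)
      by (simp add: subalg_mult subalg_power mult_ac)
  qed
  let ?g = "\<lambda>i. poly (map_poly to_ac f) (Z ^ i * t)" and ?g' = "\<lambda>i. poly (map_poly to_ac f') (Z ^ i * s)"
  \<comment> \<open>f(t) has norm \<open>inverse \<zeta> * a\<^sub>2\<close>, so its inverse has the
    norm that gives \<zeta> when multiplied by \<open>a\<^sub>2\<close>. The index i lists the
    conjugates.\<close>
  define c where "c i = inverse (?g i)" for i
  define e where "e i = ?g' i" for i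
  have Lt: "subalg (adjoin K\<^sub>0 t)" and Ls: "subalg (adjoin K\<^sub>0 s)" by (intro subalg_adjoin subalg_base)+
  have cL: "c i \<in> adjoin K\<^sub>0 t" for i unfolding c_def by (intro subalg_inverse Lt ev_mem)
  have eL: "e i \<in> adjoin K\<^sub>0 s" for i unfolding e_def by (rule ev_mem)
  have c_conj: "\<phi> (c i) = c (Suc i)" if "embedding (adjoin K\<^sub>0 t) \<phi>" "\<phi> t = Z * t" for \<phi> i
    unfolding c_def using ev_conj[OF that] embedding_inverse[OF Lt that(1) ev_mem] by simp
  have e_conj: "\<phi> (e i) = e (Suc i)" if "embedding (adjoin K\<^sub>0 s) \<phi>" "\<phi> s = Z * s" for \<phi> i
    unfolding e_def using ev_conj[OF that] by simp
  have c_prod: "(\<Prod>i<p. c i) * to_ac a\<^sub>2 = Z"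
    using prod_inversef[of ?g "{..<p}"] f nz by (simp add: c_def o_def)
  have e_prod: "(\<Prod>i<p. e i) * inverse (to_ac a\<^sub>3) = Z"
    using f' nz by (simp add: e_def)
  obtain w where w: "w \<in> adjoin K\<^sub>0 t" "w \<noteq> 0"
    "\<And>\<phi>. embedding (adjoin K\<^sub>0 t) \<phi> \<Longrightarrow> \<phi> t = Z * t \<Longrightarrow> \<phi> w = c 0 ^ p * to_ac a\<^sub>2 * w"
  \<comment> \<open>Hilbert 90 is applied to the p-th power of c u, because c u is not in k(t). Its
    norm is \<zeta>^p = 1.\<close>
  proof (rule hilbert90[OF tus0(1), of "\<lambda>i. c i ^ p * to_ac a\<^sub>2"])
    show "c i ^ p * to_ac a\<^sub>2 \<in> adjoin K\<^sub>0 t" for i using Lt cL by (intro subalg_mult subalg_power subalg_to_ac)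
    have "(\<Prod>i<p. c i ^ p * to_ac a\<^sub>2) = ((\<Prod>i<p. c i) * to_ac a\<^sub>2) ^ p"
      by (simp add: prod.distrib prod_power_distrib power_mult_distrib)
    then show "(\<Prod>i<p. c i ^ p * to_ac a\<^sub>2) = 1" by (simp add: c_prod)
    show "\<phi> (c i ^ p * to_ac a\<^sub>2) = c (Suc i) ^ p * to_ac a\<^sub>2"
      if "embedding (adjoin K\<^sub>0 t) \<phi>" "\<phi> t = Z * t" for \<phi> i
      using Lt cL that by (simp add: embedding_mult[OF Lt that(1)] embedding_power[OF Lt that(1)]
          embedding_to_ac[OF Lt that(1)] subalg_power c_conj)
  qed blast
  obtain v where v: "v \<in> adjoin K\<^sub>0 s" "v \<noteq> 0"
    "\<And>\<phi>. embedding (adjoin K\<^sub>0 s) \<phi> \<Longrightarrow> \<phi> s = Z * s \<Longrightarrow> \<phi> v = e 0 ^ p * to_ac (inverse a\<^sub>3) * v"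
  proof (rule hilbert90[OF tus0(2), of "\<lambda>i. e i ^ p * to_ac (inverse a\<^sub>3)"])
    show "e i ^ p * to_ac (inverse a\<^sub>3) \<in> adjoin K\<^sub>0 s" for i using Ls eL by (intro subalg_mult subalg_power subalg_to_ac)
    have "(\<Prod>i<p. e i ^ p * to_ac (inverse a\<^sub>3)) = ((\<Prod>i<p. e i) * inverse (to_ac a\<^sub>3)) ^ p"
      by (simp add: prod.distrib prod_power_distrib power_mult_distrib)
    then show "(\<Prod>i<p. e i ^ p * to_ac (inverse a\<^sub>3)) = 1" by (simp only: e_prod Z_p)
    show "\<phi> (e i ^ p * to_ac (inverse a\<^sub>3)) = e (Suc i) ^ p * to_ac (inverse a\<^sub>3)"
      if "embedding (adjoin K\<^sub>0 s) \<phi>" "\<phi> s = Z * s" for \<phi> i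
      using Ls eL that by (simp add: embedding_mult[OF Ls that(1)] embedding_power[OF Ls that(1)]
          embedding_to_ac[OF Ls that(1)] subalg_power e_conj del: to_ac_inverse)
  qed blast
  obtain W V where WV: "W ^ p = w" "V ^ p = v" using root by metis
  have c_fun: "(\<phi> ^^ i) (c 0) = c i" if "embedding (adjoin K\<^sub>0 t) \<phi>" "\<phi> t = Z * t" for \<phi> i
    by (induction i) (simp_all add: c_conj[OF that])
  have e_fun: "(\<phi> ^^ i) (e 0) = e i" if "embedding (adjoin K\<^sub>0 s) \<phi>" "\<phi> s = Z * s" for \<phi> i
    by (induction i) (simp_all add: e_conj[OF that])
  interpret radical_tower p \<zeta> a\<^sub>1 a\<^sub>2 a\<^sub>3 t u s "c 0" w "e 0" v W V
  proof
    show "\<phi> w = (c 0 * u) ^ p * w" if "embedding (adjoin K\<^sub>0 t) \<phi>" "\<phi> t = Z * t" for \<phi>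
      using w(3)[OF that] by (simp add: power_mult_distrib tus)
    show "(\<Prod>i<p. (\<phi> ^^ i) (c 0)) * u ^ p = Z" if "embedding (adjoin K\<^sub>0 t) \<phi>" "\<phi> t = Z * t" for \<phi>
      using c_prod by (simp add: c_fun[OF that] tus)
    show "\<phi> v = (e 0 * inverse t) ^ p * v" if "embedding (adjoin K\<^sub>0 s) \<phi>" "\<phi> s = Z * s" for \<phi>
      using v(3)[OF that] by (simp add: power_mult_distrib power_inverse tus)
    show "(\<Prod>i<p. (\<phi> ^^ i) (e 0)) * inverse t ^ p = Z" if "embedding (adjoin K\<^sub>0 s) \<phi>" "\<phi> s = Z * s" for \<phi>
      using e_prod by (simp add: e_fun[OF that] power_inverse tus)
  qed (use ind tus cL w eL v WV in auto)
  interpret H: Group.group "triple_group p" by (rule group_triple_group) simp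
  have "galois_group K\<^sub>5 \<cong> triple_group p" by (rule H.iso_sym[OF galois_group_iso(2)])
  from Group.iso_trans[OF this phi4_221a_iso_triple_group[OF p_gt_1]]
  have "galois_group K\<^sub>5 \<cong> phi4_221a p" .
  with galois_group_iso(1) show ?thesis unfolding galois_realizable_def by blast
qed

end

theorem theorem4p2:
  fixes p :: nat and \<zeta> :: "'k::field"
  assumes "Factorial_Ring.prime p" and "odd p"
    and "CHAR('k) \<noteq> p"
    and "primitive_root_of_unity p \<zeta>"
  shows "galois_realizable TYPE('k) (phi4_221a p) \<longleftrightarrow>
    (\<exists>a\<^sub>1 a\<^sub>2 a\<^sub>3 :: 'k.
       independent_mod_powers p [a\<^sub>1, a\<^sub>2, a\<^sub>3] \<and>
       brauer_trivial (cyclic_algebra p (inverse \<zeta> * a\<^sub>2) a\<^sub>3 \<zeta>) \<and>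
       brauer_trivial (cyclic_algebra p a\<^sub>1 (\<zeta> * a\<^sub>3) \<zeta>))"
proof -
  interpret root_of_unity p \<zeta> by unfold_locales (use assms in auto)
  show ?thesis using parameters_of_realizable realizable_of_parameters by blast
qed

end
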